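(* The collection $\mathfrak{XExt}$ of all crossed extensions of groupoid crossed modules is a weak $2$-category whose $1$-arrows are semi-exchangers and whose $2$-arrows are semi-exchanger morphisms (with the compositions and units described in the context).
   Context: Weak $2$-category means bicategory. **Groupoids and crossed modules.** In a topological groupoid $\mathcal G\rightrightarrows\mathcal G^0$ an arrow $g:x\to y$ has source $s(g)=x$, target $t(g)=y$; $gf$ is defined when $s(g)=t(f)$; units are identified with identity arrows. Strict morphisms of topological groupoids are continuous functors. A bundle of topological groups over $X$ is a topological groupoid $\mathcal H\rightrightarrows X$ with $s=t$; its fibre at $x$ is $\mathcal H^x$. An action by automorphisms of $\mathcal G\rightrightarrows X$ on $\mathcal H\to X$ assigns to each $g:x\to y$ an isomorphism of topological groups $\mathcal H^y\to\mathcal H^x$, $h\mapsto h^g$, continuous in $(h,g)$, with $h^{gf}=(h^g)^f$ and $h^{1_x}=h$. A groupoid crossed module $\mathfrak G=(\mathcal H\xrightarrow{\partial}\mathcal G)$ with unit space $X$ consists of a topological groupoid $\mathcal G\rightrightarrows X$, a bundle of topological groups $\mathcal H\to X$, a strict morphism $\partial:\mathcal H\to\mathcal G$ that is the identity on $X$, and an action by automorphisms of $\mathcal G$ on $\mathcal H$ such that $\partial(h^g)=g^{-1}\partial(h)g$ for $h\in\mathcal H^{t(g)}$ and $k^{\partial(h)}=h^{-1}kh$ for $h,k$ in the same fibre. **Crossed extensions (objects)** (standing convention of the paper: all crossed modules are pulled back so that all groupoids involved have one unit space). A crossed extension $(\mathfrak G_1,\mathcal M,\mathfrak G_2)$ with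 unit space $X$ consists of crossed modules $\mathfrak G_i=(\mathcal H_i\xrightarrow{\partial_i}\mathcal G_i)$ over $X$, a topological groupoid $\mathcal M\rightrightarrows X$, and strict morphisms, identity on $X$, $\alpha_1:\mathcal H_1\to\mathcal M$, $\alpha_2:\mathcal M\to\mathcal G_1$, $\beta_1:\mathcal H_2\to\mathcal M$, $\beta_2:\mathcal M\to\mathcal G_2$ such that $\alpha_2\alpha_1=\partial_1$, $\beta_2\beta_1=\partial_2$; both $\mathcal H_2\xrightarrow{\beta_1}\mathcal M\xrightarrow{\alpha_2}\mathcal G_1$ and $\mathcal H_1\xrightarrow{\alpha_1}\mathcal M\xrightarrow{\beta_2}\mathcal G_2$ are extensions of topological groupoids (first map a homeomorphism onto its image, second map surjective, image of the first equal to the kernel of the second); and $\alpha_1(h_1^{\alpha_2(m)})=m^{-1}\alpha_1(h_1)m$, $\beta_1(h_2^{\beta_2(m)})=m^{-1}\beta_1(h_2)m$ for $m\in\mathcal M$ and $h_1,h_2$ in the fibres over $t(m)$. **Semi-exchangers (1-arrows).** A generalized morphism from $\mathcal M\rightrightarrows X$ to $\mathcal N\rightrightarrows Y$ is a space $P$ with continuous maps $X\xleftarrow{\varphi}P\xrightarrow{\psi}Y$ and commuting continuous left $\mathcal M$-action (moment map $\varphi$) and right $\mathcal N$-action (moment map $\psi$), $\varphi$ being $\mathcal N$-invariant and $\psi$ being $\mathcal M$-invariant, with $\varphi:P\to X$ a locally trivial principal $\mathcal N$-bundle. Let $\mathbf A=(\mathfrak G_1,\mathcal M,\mathfrak G_2)$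 (unit space $X$, morphisms $\alpha_i,\beta_i$) and $\mathbf B=(\mathfrak G_3,\mathcal N,\mathfrak G_4)$ (unit space $Y$, morphisms $\delta_1:\mathcal H_3\to\mathcal N$, $\delta_2:\mathcal N\to\mathcal G_3$, $\theta_1:\mathcal H_4\to\mathcal N$, $\theta_2:\mathcal N\to\mathcal G_4$). A semi-exchanger from $\mathbf A$ to $\mathbf B$ is a generalized morphism $P$ from $\mathcal M$ to $\mathcal N$ such that (E1) the left action of $\mathcal H_1$ via $\alpha_1$ and the right action of $\mathcal H_3$ via $\delta_1$ on $P$ are free and have the same orbit space, $P/\mathcal H_1=P/\mathcal H_3$; (E2) the left action of $\mathcal H_2$ via $\beta_1$ and the right action of $\mathcal H_4$ via $\theta_1$ are free and have the same orbit space, $P/\mathcal H_2=P/\mathcal H_4$. The composite of semi-exchangers $P:\mathbf A\to\mathbf B$ and $Q:\mathbf B\to\mathbf C$ is $P\bullet_{\mathcal N}Q=(P\times_YQ)/((pn,q)\sim(p,nq))$ with the induced actions. The unit at $\mathbf A$ is $\mathbf I_{\mathcal M}$: the space $\mathcal M$ with $X\xleftarrow{t}\mathcal M\xrightarrow{s}X$ and left and right multiplication. **Semi-exchanger morphisms (2-arrows).** A morphism $P\to Q$ of semi-exchangers from $\mathbf A$ to $\mathbf B$ is a continuous map commuting with the maps to $X$ and $Y$ and with the actions of $\mathcal M$ and $\mathcal N$. Two morphisms $P\to Q\to T$ are composed as maps; for $\eta_1:P_1\to Q_1$ (semi-exchangers $\mathbf A\to\mathbf B$) and $\eta_2:P_2\to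 Q_2$ (semi-exchangers $\mathbf B\to\mathbf C$), $\eta_1\star_v\eta_2:P_1\bullet_{\mathcal N}P_2\to Q_1\bullet_{\mathcal N}Q_2$ is $[p_1,p_2]\mapsto[\eta_1(p_1),\eta_2(p_2)]$. The associator is $[p,[q,t]]\mapsto[[p,q],t]$ and the unitors are $[m,p]\mapsto mp$ and $[p,n]\mapsto pn$. *)

theory Defs
  imports "HOL-Analysis.Analysis" "HOL-Library.Infinite_Typeclass"
begin

text \<open>
  The points of all spaces lie in one type \<open>'u\<close>; a space is an arbitrary
  \<open>'u topology\<close> and its carrier is the \<open>topspace\<close>. Every structure map is required to
  take the value \<open>undefined\<close> outside its domain, so that equality of records is equality of the
  mathematical structures.
\<close>

section \<open>Topological preliminaries\<close>

definition fibre_prod ::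
    "'a topology \<Rightarrow> ('a \<Rightarrow> 'c) \<Rightarrow> 'b topology \<Rightarrow> ('b \<Rightarrow> 'c) \<Rightarrow> ('a \<times> 'b) topology" where
  "fibre_prod X f Y g = subtopology (prod_topology X Y) {(x, y). f x = g y}"

definition final_topology :: "'a topology \<Rightarrow> ('a \<Rightarrow> 'b) \<Rightarrow> 'b topology" where
  "final_topology X c =
     topology (\<lambda>U. U \<subseteq> c ` topspace X \<and> openin X {x \<in> topspace X. c x \<in> U})"

lemma openin_final_topology:
  "openin (final_topology X c) U \<longleftrightarrow> U \<subseteq> c ` topspace X \<and> openin X {x \<in> topspace X. c x \<in> U}"
proof -
  have "istopology (\<lambda>U. U \<subseteq> c ` topspace X \<and> openin X {x \<in> topspace X. c x \<in> U})"
    unfolding istopology_def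
  proof (intro conjI allI impI)
    fix S T
    assume S: "S \<subseteq> c ` topspace X \<and> openin X {x \<in> topspace X. c x \<in> S}"
      and T: "T \<subseteq> c ` topspace X \<and> openin X {x \<in> topspace X. c x \<in> T}"
    show "S \<inter> T \<subseteq> c ` topspace X" using S by blast
    have "{x \<in> topspace X. c x \<in> S \<inter> T} = {x \<in> topspace X. c x \<in> S} \<inter> {x \<in> topspace X. c x \<in> T}"
      by blast
    then show "openin X {x \<in> topspace X. c x \<in> S \<inter> T}" using S T by (simp add: openin_Int)
  next
    fix K
    assume K: "\<forall>S\<in>K. S \<subseteq> c ` topspace X \<and> openin X {x \<in> topspace X. c x \<in> S}"
    show "\<Union> K \<subseteq> c ` topspace X" using K by blast
    have "{x \<in> topspace X. c x \<in> \<Union> K} = \<Union> ((\<lambda>S. {x \<in> topspace X. c x \<in> S}) ` K)" by blast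
    then show "openin X {x \<in> topspace X. c x \<in> \<Union> K}" using K by auto
  qed
  then show ?thesis unfolding final_topology_def by (simp add: topology_inverse')
qed

lemma topspace_final_topology: "topspace (final_topology X c) = c ` topspace X"
proof (rule subset_antisym)
  show "topspace (final_topology X c) \<subseteq> c ` topspace X"
    using openin_final_topology[of X c "topspace (final_topology X c)"] by simp
  have "{x \<in> topspace X. c x \<in> c ` topspace X} = topspace X" by blast
  then have "openin (final_topology X c) (c ` topspace X)" by (simp add: openin_final_topology)
  then show "c ` topspace X \<subseteq> topspace (final_topology X c)" by (rule openin_subset)
qed

lemma quotient_map_final_topology: "quotient_map X (final_topology X c) c"
  by (auto simp: quotient_map_def topspace_final_topology openin_final_topology)

text \<open>
  \<open>descend S c f\<close> is the function \<open>c x \<mapsto> f x\<close> on \<open>c ` S\<close>, for \<open>f\<close> constant on the fibres of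
  \<open>c\<close> in \<open>S\<close>.
\<close>
definition descend :: "'a set \<Rightarrow> ('a \<Rightarrow> 'b) \<Rightarrow> ('a \<Rightarrow> 'c) \<Rightarrow> 'b \<Rightarrow> 'c" where
  "descend S c f = (\<lambda>z\<in>c ` S. THE w. \<exists>x\<in>S. c x = z \<and> w = f x)"

lemma descend_eq:
  assumes "x \<in> S" "\<And>y. y \<in> S \<Longrightarrow> c y = c x \<Longrightarrow> f y = f x"
  shows "descend S c f (c x) = f x"
proof -
  have "(THE w. \<exists>y\<in>S. c y = c x \<and> w = f y) = f x"
    using assms by (intro the_equality) metis+
  then show ?thesis using assms(1) by (simp add: descend_def)
qed


section \<open>Topological groupoids and crossed modules\<close>

record 'u groupoid =
  arr :: "'u topology"
  obj :: "'u topology"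
  src :: "'u \<Rightarrow> 'u"
  tgt :: "'u \<Rightarrow> 'u"
  one :: "'u \<Rightarrow> 'u"
  mul :: "'u \<Rightarrow> 'u \<Rightarrow> 'u"
  ginv :: "'u \<Rightarrow> 'u"

text \<open>
  \<open>mul G g f\<close> is the composite \<open>gf\<close>, defined when \<open>src G g = tgt G f\<close>. The identification of
  units with identity arrows is made by the map \<open>one G\<close>, which is a homeomorphism onto its image
  because \<open>src G\<close> is a continuous left inverse.
\<close>
locale topological_groupoid =
  fixes G :: "'u groupoid"
  assumes src_cont: "continuous_map (arr G) (obj G) (src G)"
    and tgt_cont: "continuous_map (arr G) (obj G) (tgt G)"
    and one_cont: "continuous_map (obj G) (arr G) (one G)"
    and mul_cont: "continuous_map (fibre_prod (arr G) (src G) (arr G) (tgt G)) (arr G)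
                     (\<lambda>(g, f). mul G g f)"
    and ginv_cont: "continuous_map (arr G) (arr G) (ginv G)"
    and src_one: "x \<in> topspace (obj G) \<Longrightarrow> src G (one G x) = x"
    and tgt_one: "x \<in> topspace (obj G) \<Longrightarrow> tgt G (one G x) = x"
    and src_mul: "\<lbrakk>g \<in> topspace (arr G); f \<in> topspace (arr G); src G g = tgt G f\<rbrakk>
                    \<Longrightarrow> src G (mul G g f) = src G f"
    and tgt_mul: "\<lbrakk>g \<in> topspace (arr G); f \<in> topspace (arr G); src G g = tgt G f\<rbrakk>
                    \<Longrightarrow> tgt G (mul G g f) = tgt G g"
    and mul_assoc: "\<lbrakk>k \<in> topspace (arr G); g \<in> topspace (arr G); f \<in> topspace (arr G);
                      src G k = tgt G g; src G g = tgt G f\<rbrakk>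
                    \<Longrightarrow> mul G (mul G k g) f = mul G k (mul G g f)"
    and one_mul: "g \<in> topspace (arr G) \<Longrightarrow> mul G (one G (tgt G g)) g = g"
    and mul_one: "g \<in> topspace (arr G) \<Longrightarrow> mul G g (one G (src G g)) = g"
    and src_ginv: "g \<in> topspace (arr G) \<Longrightarrow> src G (ginv G g) = tgt G g"
    and tgt_ginv: "g \<in> topspace (arr G) \<Longrightarrow> tgt G (ginv G g) = src G g"
    and ginv_mul: "g \<in> topspace (arr G) \<Longrightarrow> mul G (ginv G g) g = one G (src G g)"
    and mul_ginv: "g \<in> topspace (arr G) \<Longrightarrow> mul G g (ginv G g) = one G (tgt G g)"
    and src_ext: "src G \<in> extensional (topspace (arr G))"
    and tgt_ext: "tgt G \<in> extensional (topspace (arr G))"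
    and one_ext: "one G \<in> extensional (topspace (obj G))"
    and ginv_ext: "ginv G \<in> extensional (topspace (arr G))"
    and mul_ext: "(\<lambda>(g, f). mul G g f)
                    \<in> extensional (topspace (fibre_prod (arr G) (src G) (arr G) (tgt G)))"

locale group_bundle = topological_groupoid H for H :: "'u groupoid" +
  assumes src_eq_tgt: "h \<in> topspace (arr H) \<Longrightarrow> src H h = tgt H h"

text \<open>Continuous functors that are the identity on the common unit space.\<close>
locale strict_morphism =
  dom: topological_groupoid G + cod: topological_groupoid K
  for G K :: "'u groupoid" and F :: "'u \<Rightarrow> 'u" +
  assumes same_units: "obj K = obj G"
    and cont: "continuous_map (arr G) (arr K) F"
    and src_map: "g \<in> topspace (arr G) \<Longrightarrow> src K (F g) = src G g"
    and tgt_map: "g \<in> topspace (arr G) \<Longrightarrow> tgt K (F g) = tgt G g"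
    and one_map: "x \<in> topspace (obj G) \<Longrightarrow> F (one G x) = one K x"
    and mul_map: "\<lbrakk>g \<in> topspace (arr G); f \<in> topspace (arr G); src G g = tgt G f\<rbrakk>
                    \<Longrightarrow> F (mul G g f) = mul K (F g) (F f)"
    and ext: "F \<in> extensional (topspace (arr G))"

definition fibre :: "'u groupoid \<Rightarrow> 'u \<Rightarrow> 'u topology" where
  "fibre H x = subtopology (arr H) {h. src H h = x}"

text \<open>\<open>act h g\<close> is \<open>h\<^sup>g\<close>.\<close>
locale automorphism_action =
  G: topological_groupoid G + H: group_bundle H
  for G H :: "'u groupoid" and act :: "'u \<Rightarrow> 'u \<Rightarrow> 'u" +
  assumes same_units: "obj H = obj G"
    and act_homeo: "g \<in> topspace (arr G) \<Longrightarrow>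
          homeomorphic_map (fibre H (tgt G g)) (fibre H (src G g)) (\<lambda>h. act h g)"
    and act_hom: "\<lbrakk>g \<in> topspace (arr G); h \<in> topspace (fibre H (tgt G g));
                   k \<in> topspace (fibre H (tgt G g))\<rbrakk>
                  \<Longrightarrow> act (mul H h k) g = mul H (act h g) (act k g)"
    and act_cont: "continuous_map (fibre_prod (arr H) (src H) (arr G) (tgt G)) (arr H)
                     (\<lambda>(h, g). act h g)"
    and act_mul: "\<lbrakk>g \<in> topspace (arr G); f \<in> topspace (arr G); src G g = tgt G f;
                   h \<in> topspace (fibre H (tgt G g))\<rbrakk>
                  \<Longrightarrow> act h (mul G g f) = act (act h g) f"
    and act_one: "\<lbrakk>x \<in> topspace (obj G); h \<in> topspace (fibre H x)\<rbrakk> \<Longrightarrow> act h (one G x) = h"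
    and act_ext: "(\<lambda>(h, g). act h g)
                    \<in> extensional (topspace (fibre_prod (arr H) (src H) (arr G) (tgt G)))"

record 'u crossed_mod =
  cmH :: "'u groupoid"
  cmG :: "'u groupoid"
  bdry :: "'u \<Rightarrow> 'u"
  cmact :: "'u \<Rightarrow> 'u \<Rightarrow> 'u"

locale crossed_module =
  bd: strict_morphism "cmH C" "cmG C" "bdry C" +
  ac: automorphism_action "cmG C" "cmH C" "cmact C"
  for C :: "'u crossed_mod" +
  assumes bdry_act:
      "\<lbrakk>g \<in> topspace (arr (cmG C)); h \<in> topspace (fibre (cmH C) (tgt (cmG C) g))\<rbrakk>
       \<Longrightarrow> bdry C (cmact C h g) = mul (cmG C) (ginv (cmG C) g) (mul (cmG C) (bdry C h) g)"
    and peiffer: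
      "\<lbrakk>x \<in> topspace (obj (cmH C)); h \<in> topspace (fibre (cmH C) x); k \<in> topspace (fibre (cmH C) x)\<rbrakk>
       \<Longrightarrow> cmact C k (bdry C h) = mul (cmH C) (ginv (cmH C) h) (mul (cmH C) k h)"


section \<open>Crossed extensions\<close>

locale groupoid_extension =
  i: strict_morphism K E i + p: strict_morphism E G p
  for K E G :: "'u groupoid" and i p :: "'u \<Rightarrow> 'u" +
  assumes embedding: "embedding_map (arr K) (arr E) i"
    and surjective: "p ` topspace (arr E) = topspace (arr G)"
    and exact: "i ` topspace (arr K) = {e \<in> topspace (arr E). p e \<in> one G ` topspace (obj G)}"

record 'u crossed_ext =
  mod1 :: "'u crossed_mod"
  mid :: "'u groupoid"
  mod2 :: "'u crossed_mod"
  al1 :: "'u \<Rightarrow> 'u"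
  al2 :: "'u \<Rightarrow> 'u"
  be1 :: "'u \<Rightarrow> 'u"
  be2 :: "'u \<Rightarrow> 'u"

locale crossed_extension =
  cm1: crossed_module "mod1 A" + cm2: crossed_module "mod2 A" +
  ex21: groupoid_extension "cmH (mod2 A)" "mid A" "cmG (mod1 A)" "be1 A" "al2 A" +
  ex12: groupoid_extension "cmH (mod1 A)" "mid A" "cmG (mod2 A)" "al1 A" "be2 A"
  for A :: "'u crossed_ext" +
  assumes al_bdry: "h \<in> topspace (arr (cmH (mod1 A))) \<Longrightarrow> al2 A (al1 A h) = bdry (mod1 A) h"
    and be_bdry: "h \<in> topspace (arr (cmH (mod2 A))) \<Longrightarrow> be2 A (be1 A h) = bdry (mod2 A) h"
    and al_act: "\<lbrakk>m \<in> topspace (arr (mid A));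
                  h \<in> topspace (fibre (cmH (mod1 A)) (tgt (mid A) m))\<rbrakk>
       \<Longrightarrow> al1 A (cmact (mod1 A) h (al2 A m)) =
           mul (mid A) (ginv (mid A) m) (mul (mid A) (al1 A h) m)"
    and be_act: "\<lbrakk>m \<in> topspace (arr (mid A));
                  h \<in> topspace (fibre (cmH (mod2 A)) (tgt (mid A) m))\<rbrakk>
       \<Longrightarrow> be1 A (cmact (mod2 A) h (be2 A m)) =
           mul (mid A) (ginv (mid A) m) (mul (mid A) (be1 A h) m)"


section \<open>Generalized morphisms\<close>

record 'u gen_mor =
  spc :: "'u topology"
  lmom :: "'u \<Rightarrow> 'u"
  rmom :: "'u \<Rightarrow> 'u"
  lact :: "'u \<Rightarrow> 'u \<Rightarrow> 'u"
  ract :: "'u \<Rightarrow> 'u \<Rightarrow> 'u"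

locale left_action =
  topological_groupoid G
  for G :: "'u groupoid" and P :: "'u topology" and mom :: "'u \<Rightarrow> 'u" and act :: "'u \<Rightarrow> 'u \<Rightarrow> 'u" +
  assumes mom_cont: "continuous_map P (obj G) mom"
    and act_cont: "continuous_map (fibre_prod (arr G) (src G) P mom) P (\<lambda>(g, p). act g p)"
    and mom_act: "\<lbrakk>g \<in> topspace (arr G); p \<in> topspace P; src G g = mom p\<rbrakk>
                    \<Longrightarrow> mom (act g p) = tgt G g"
    and act_mul: "\<lbrakk>g \<in> topspace (arr G); f \<in> topspace (arr G); p \<in> topspace P;
                   src G g = tgt G f; src G f = mom p\<rbrakk>
                    \<Longrightarrow> act (mul G g f) p = act g (act f p)"
    and act_one: "p \<in> topspace P \<Longrightarrow> act (one G (mom p)) p = p"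
    and mom_ext: "mom \<in> extensional (topspace P)"
    and act_ext: "(\<lambda>(g, p). act g p) \<in> extensional (topspace (fibre_prod (arr G) (src G) P mom))"

locale right_action =
  topological_groupoid G
  for G :: "'u groupoid" and P :: "'u topology" and mom :: "'u \<Rightarrow> 'u" and act :: "'u \<Rightarrow> 'u \<Rightarrow> 'u" +
  assumes mom_cont: "continuous_map P (obj G) mom"
    and act_cont: "continuous_map (fibre_prod P mom (arr G) (tgt G)) P (\<lambda>(p, g). act p g)"
    and mom_act: "\<lbrakk>p \<in> topspace P; g \<in> topspace (arr G); mom p = tgt G g\<rbrakk>
                    \<Longrightarrow> mom (act p g) = src G g"
    and act_mul: "\<lbrakk>p \<in> topspace P; g \<in> topspace (arr G); f \<in> topspace (arr G);
                   mom p = tgt G g; src G g = tgt G f\<rbrakk>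
                    \<Longrightarrow> act p (mul G g f) = act (act p g) f"
    and act_one: "p \<in> topspace P \<Longrightarrow> act p (one G (mom p)) = p"
    and mom_ext: "mom \<in> extensional (topspace P)"
    and act_ext: "(\<lambda>(p, g). act p g) \<in> extensional (topspace (fibre_prod P mom (arr G) (tgt G)))"

text \<open>
  \<open>pr : P \<rightarrow> X\<close> is a locally trivial principal \<open>N\<close>-bundle: over a neighbourhood \<open>U\<close> of each
  point it is isomorphic, as a right \<open>N\<close>-space over \<open>U\<close>, to the pullback of the unit bundle
  \<open>tgt : N \<rightarrow> obj N\<close> along a continuous map \<open>U \<rightarrow> obj N\<close>. (Surjectivity, fibrewise freeness and
  transitivity then hold automatically; they are listed for definiteness.)
\<close>
locale principal_bundle =
  right_action N P mom act
  for N :: "'u groupoid" and P X :: "'u topology" and pr mom :: "'u \<Rightarrow> 'u"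
    and act :: "'u \<Rightarrow> 'u \<Rightarrow> 'u" +
  assumes pr_cont: "continuous_map P X pr"
    and pr_surj: "pr ` topspace P = topspace X"
    and pr_act: "\<lbrakk>p \<in> topspace P; n \<in> topspace (arr N); mom p = tgt N n\<rbrakk> \<Longrightarrow> pr (act p n) = pr p"
    and act_free: "\<lbrakk>p \<in> topspace P; n \<in> topspace (arr N); mom p = tgt N n; act p n = p\<rbrakk>
                     \<Longrightarrow> n = one N (mom p)"
    and act_trans: "\<lbrakk>p \<in> topspace P; q \<in> topspace P; pr p = pr q\<rbrakk>
                     \<Longrightarrow> \<exists>n\<in>topspace (arr N). mom p = tgt N n \<and> q = act p n"
    and locally_trivial: "x \<in> topspace X \<Longrightarrow>
      \<exists>U f \<tau>. openin X U \<and> x \<in> U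
        \<and> continuous_map (subtopology X U) (obj N) f
        \<and> homeomorphic_map (fibre_prod (subtopology X U) f (arr N) (tgt N))
             (subtopology P {p \<in> topspace P. pr p \<in> U}) \<tau>
        \<and> (\<forall>u\<in>U. \<forall>n\<in>topspace (arr N). f u = tgt N n \<longrightarrow>
             pr (\<tau> (u, n)) = u \<and> mom (\<tau> (u, n)) = src N n \<and>
             (\<forall>k\<in>topspace (arr N). src N n = tgt N k \<longrightarrow> \<tau> (u, mul N n k) = act (\<tau> (u, n)) k))"

locale generalized_morphism =
  L: left_action M "spc P" "lmom P" "lact P" +
  R: principal_bundle N "spc P" "obj M" "lmom P" "rmom P" "ract P"
  for M N :: "'u groupoid" and P :: "'u gen_mor" +
  assumes rmom_lact: "\<lbrakk>m \<in> topspace (arr M); p \<in> topspace (spc P); src M m = lmom P p\<rbrakk>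
                        \<Longrightarrow> rmom P (lact P m p) = rmom P p"
    and actions_commute:
      "\<lbrakk>m \<in> topspace (arr M); p \<in> topspace (spc P); n \<in> topspace (arr N);
        src M m = lmom P p; rmom P p = tgt N n\<rbrakk>
       \<Longrightarrow> ract P (lact P m p) n = lact P m (ract P p n)"


section \<open>Semi-exchangers\<close>

text \<open>
  Orbits of the bundle of groups \<open>H\<close> acting on \<open>P\<close> through a morphism \<open>a\<close>. Orbit spaces are sets
  of orbits with the quotient topology of \<open>spc P\<close>, so two of them are equal as spaces as soon as
  they are equal as sets.
\<close>
definition left_orbit :: "'u groupoid \<Rightarrow> ('u \<Rightarrow> 'u) \<Rightarrow> 'u gen_mor \<Rightarrow> 'u \<Rightarrow> 'u set" where
  "left_orbit H a P p = {lact P (a h) p | h. h \<in> topspace (arr H) \<and> src H h = lmom P p}"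

definition right_orbit :: "'u groupoid \<Rightarrow> ('u \<Rightarrow> 'u) \<Rightarrow> 'u gen_mor \<Rightarrow> 'u \<Rightarrow> 'u set" where
  "right_orbit H a P p = {ract P p (a h) | h. h \<in> topspace (arr H) \<and> rmom P p = tgt H h}"

definition left_free :: "'u groupoid \<Rightarrow> ('u \<Rightarrow> 'u) \<Rightarrow> 'u gen_mor \<Rightarrow> bool" where
  "left_free H a P \<longleftrightarrow>
     (\<forall>p\<in>topspace (spc P). \<forall>h\<in>topspace (arr H).
        src H h = lmom P p \<and> lact P (a h) p = p \<longrightarrow> h = one H (lmom P p))"

definition right_free :: "'u groupoid \<Rightarrow> ('u \<Rightarrow> 'u) \<Rightarrow> 'u gen_mor \<Rightarrow> bool" where
  "right_free H a P \<longleftrightarrow>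
     (\<forall>p\<in>topspace (spc P). \<forall>h\<in>topspace (arr H).
        rmom P p = tgt H h \<and> ract P p (a h) = p \<longrightarrow> h = one H (rmom P p))"

locale semi_exchanger =
  A: crossed_extension A + B: crossed_extension B +
  generalized_morphism "mid A" "mid B" P
  for A B :: "'u crossed_ext" and P :: "'u gen_mor" +
  assumes E1_left_free: "left_free (cmH (mod1 A)) (al1 A) P"
    and E1_right_free: "right_free (cmH (mod1 B)) (al1 B) P"
    and E1_orbits: "left_orbit (cmH (mod1 A)) (al1 A) P ` topspace (spc P)
                    = right_orbit (cmH (mod1 B)) (al1 B) P ` topspace (spc P)"
    and E2_left_free: "left_free (cmH (mod2 A)) (be1 A) P"
    and E2_right_free: "right_free (cmH (mod2 B)) (be1 B) P"
    and E2_orbits: "left_orbit (cmH (mod2 A)) (be1 A) P ` topspace (spc P)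
                    = right_orbit (cmH (mod2 B)) (be1 B) P ` topspace (spc P)"

locale semi_exchanger_morphism =
  P: semi_exchanger A B P + Q: semi_exchanger A B Q
  for A B :: "'u crossed_ext" and P Q :: "'u gen_mor" and f :: "'u \<Rightarrow> 'u" +
  assumes cont: "continuous_map (spc P) (spc Q) f"
    and lmom_map: "p \<in> topspace (spc P) \<Longrightarrow> lmom Q (f p) = lmom P p"
    and rmom_map: "p \<in> topspace (spc P) \<Longrightarrow> rmom Q (f p) = rmom P p"
    and lact_map: "\<lbrakk>m \<in> topspace (arr (mid A)); p \<in> topspace (spc P); src (mid A) m = lmom P p\<rbrakk>
                    \<Longrightarrow> f (lact P m p) = lact Q m (f p)"
    and ract_map: "\<lbrakk>p \<in> topspace (spc P); n \<in> topspace (arr (mid B)); rmom P p = tgt (mid B) n\<rbrakk>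
                    \<Longrightarrow> f (ract P p n) = ract Q (f p) n"
    and ext: "f \<in> extensional (topspace (spc P))"

definition unit_gen_mor :: "'u groupoid \<Rightarrow> 'u gen_mor" where
  "unit_gen_mor M = \<lparr>spc = arr M, lmom = tgt M, rmom = src M, lact = mul M, ract = mul M\<rparr>"


section \<open>The composite of generalized morphisms\<close>

text \<open>
  The set of classes \<open>[p, q]\<close> has to be realised by points of \<open>'u\<close> again. This is done by
  representing each class by the code, under a fixed injection of \<open>'u \<times> 'u\<close> into \<open>'u\<close>, of one of
  its elements. Such an injection exists when \<open>'u\<close> is infinite.
\<close>
definition pair_code :: "'u \<times> 'u \<Rightarrow> 'u" where
  "pair_code = (SOME f. inj f)"

lemma inj_pair_code: "inj (pair_code :: 'u::infinite \<times> 'u \<Rightarrow> 'u)"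
proof -
  obtain f :: "'u \<times> 'u \<Rightarrow> 'u" where "bij_betw f (UNIV \<times> UNIV) UNIV"
    using card_of_Times_same_infinite[of "UNIV :: 'u set"] infinite_UNIV card_of_ordIso by blast
  then have "inj f" by (simp add: bij_betw_def)
  then show ?thesis unfolding pair_code_def by (rule someI[of "\<lambda>f. inj f"])
qed

definition pairs :: "'u gen_mor \<Rightarrow> 'u gen_mor \<Rightarrow> ('u \<times> 'u) topology" where
  "pairs P Q = fibre_prod (spc P) (rmom P) (spc Q) (lmom Q)"

text \<open>For groupoid actions the relation \<open>(pn, q) \<sim> (p, nq)\<close> is already an equivalence relation.\<close>
definition balance :: "'u groupoid \<Rightarrow> 'u gen_mor \<Rightarrow> 'u gen_mor \<Rightarrow> (('u \<times> 'u) \<times> ('u \<times> 'u)) set" where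
  "balance N P Q = {((ract P p n, q), (p, lact Q n q)) | p n q.
      p \<in> topspace (spc P) \<and> n \<in> topspace (arr N) \<and> q \<in> topspace (spc Q) \<and>
      rmom P p = tgt N n \<and> src N n = lmom Q q}"

definition cls :: "'u groupoid \<Rightarrow> 'u gen_mor \<Rightarrow> 'u gen_mor \<Rightarrow> 'u \<times> 'u \<Rightarrow> 'u" where
  "cls N P Q z = pair_code (SOME w. w \<in> balance N P Q `` {z})"

definition comp_gen_mor ::
    "'u groupoid \<Rightarrow> 'u groupoid \<Rightarrow> 'u groupoid \<Rightarrow> 'u gen_mor \<Rightarrow> 'u gen_mor \<Rightarrow> 'u gen_mor" where
  "comp_gen_mor M N L P Q =
     (let S = topspace (pairs P Q); c = cls N P Q;
          lm = descend S c (\<lambda>(p, q). lmom P p);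
          rm = descend S c (\<lambda>(p, q). rmom Q q)
      in \<lparr>spc = final_topology (pairs P Q) c, lmom = lm, rmom = rm,
          lact = (\<lambda>m z. if m \<in> topspace (arr M) \<and> z \<in> c ` S \<and> src M m = lm z
                        then descend S c (\<lambda>(p, q). c (lact P m p, q)) z else undefined),
          ract = (\<lambda>z l. if z \<in> c ` S \<and> l \<in> topspace (arr L) \<and> rm z = tgt L l
                        then descend S c (\<lambda>(p, q). c (p, ract Q q l)) z else undefined)\<rparr>)"


section \<open>The data of the bicategory\<close>

text \<open>1-arrows and 2-arrows are labelled by their source and target.\<close>

record 'u sx =
  sx_dom :: "'u crossed_ext"
  sx_cod :: "'u crossed_ext"
  sx_mor :: "'u gen_mor"

record 'u sxm =
  sxm_dom :: "'u sx"
  sxm_cod :: "'u sx"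
  sxm_map :: "'u \<Rightarrow> 'u"

definition XExt_obj :: "'u crossed_ext set" where
  "XExt_obj = {A. crossed_extension A}"

definition XExt_arr1 :: "'u sx set" where
  "XExt_arr1 = {P. semi_exchanger (sx_dom P) (sx_cod P) (sx_mor P)}"

definition XExt_arr2 :: "'u sxm set" where
  "XExt_arr2 = {\<eta>. sx_dom (sxm_dom \<eta>) = sx_dom (sxm_cod \<eta>) \<and> sx_cod (sxm_dom \<eta>) = sx_cod (sxm_cod \<eta>)
     \<and> semi_exchanger_morphism (sx_dom (sxm_dom \<eta>)) (sx_cod (sxm_dom \<eta>))
         (sx_mor (sxm_dom \<eta>)) (sx_mor (sxm_cod \<eta>)) (sxm_map \<eta>)}"

abbreviation sx_pts :: "'u sx \<Rightarrow> 'u set" where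
  "sx_pts P \<equiv> topspace (spc (sx_mor P))"

definition sx_unit :: "'u crossed_ext \<Rightarrow> 'u sx" where
  "sx_unit A = \<lparr>sx_dom = A, sx_cod = A, sx_mor = unit_gen_mor (mid A)\<rparr>"

definition sx_comp :: "'u sx \<Rightarrow> 'u sx \<Rightarrow> 'u sx" where
  "sx_comp P Q = \<lparr>sx_dom = sx_dom P, sx_cod = sx_cod Q,
     sx_mor = comp_gen_mor (mid (sx_dom P)) (mid (sx_cod P)) (mid (sx_cod Q))
                (sx_mor P) (sx_mor Q)\<rparr>"

definition sx_pairs :: "'u sx \<Rightarrow> 'u sx \<Rightarrow> ('u \<times> 'u) set" where
  "sx_pairs P Q = topspace (pairs (sx_mor P) (sx_mor Q))"

text \<open>\<open>sx_cls P Q (p, q)\<close> is the point \<open>[p, q]\<close> of the composite.\<close>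
definition sx_cls :: "'u sx \<Rightarrow> 'u sx \<Rightarrow> 'u \<times> 'u \<Rightarrow> 'u" where
  "sx_cls P Q = cls (mid (sx_cod P)) (sx_mor P) (sx_mor Q)"

definition sxm_id :: "'u sx \<Rightarrow> 'u sxm" where
  "sxm_id P = \<lparr>sxm_dom = P, sxm_cod = P, sxm_map = (\<lambda>p\<in>sx_pts P. p)\<rparr>"

definition sxm_comp :: "'u sxm \<Rightarrow> 'u sxm \<Rightarrow> 'u sxm" where
  "sxm_comp \<eta> \<mu> = \<lparr>sxm_dom = sxm_dom \<eta>, sxm_cod = sxm_cod \<mu>,
     sxm_map = (\<lambda>p\<in>sx_pts (sxm_dom \<eta>). sxm_map \<mu> (sxm_map \<eta> p))\<rparr>"

definition sxm_star :: "'u sxm \<Rightarrow> 'u sxm \<Rightarrow> 'u sxm" where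
  "sxm_star \<eta> \<mu> = \<lparr>sxm_dom = sx_comp (sxm_dom \<eta>) (sxm_dom \<mu>),
     sxm_cod = sx_comp (sxm_cod \<eta>) (sxm_cod \<mu>),
     sxm_map = descend (sx_pairs (sxm_dom \<eta>) (sxm_dom \<mu>)) (sx_cls (sxm_dom \<eta>) (sxm_dom \<mu>))
       (\<lambda>(p, q). sx_cls (sxm_cod \<eta>) (sxm_cod \<mu>) (sxm_map \<eta> p, sxm_map \<mu> q))\<rparr>"

definition sx_assoc :: "'u sx \<Rightarrow> 'u sx \<Rightarrow> 'u sx \<Rightarrow> 'u sxm" where
  "sx_assoc P Q T = \<lparr>sxm_dom = sx_comp P (sx_comp Q T), sxm_cod = sx_comp (sx_comp P Q) T,
     sxm_map = descend {(p, q, t). (p, q) \<in> sx_pairs P Q \<and> (q, t) \<in> sx_pairs Q T}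
       (\<lambda>(p, q, t). sx_cls P (sx_comp Q T) (p, sx_cls Q T (q, t)))
       (\<lambda>(p, q, t). sx_cls (sx_comp P Q) T (sx_cls P Q (p, q), t))\<rparr>"

definition sx_lunit :: "'u sx \<Rightarrow> 'u sxm" where
  "sx_lunit P = (let I = sx_unit (sx_dom P) in
     \<lparr>sxm_dom = sx_comp I P, sxm_cod = P,
      sxm_map = descend (sx_pairs I P) (sx_cls I P) (\<lambda>(m, p). lact (sx_mor P) m p)\<rparr>)"

definition sx_runit :: "'u sx \<Rightarrow> 'u sxm" where
  "sx_runit P = (let I = sx_unit (sx_cod P) in
     \<lparr>sxm_dom = sx_comp P I, sxm_cod = P,
      sxm_map = descend (sx_pairs P I) (sx_cls P I) (\<lambda>(p, n). ract (sx_mor P) p n)\<rparr>)"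


section \<open>Bicategories\<close>

text \<open>
  All compositions are in diagrammatic order: \<open>P \<odot> Q : A \<rightarrow> C\<close> for \<open>P : A \<rightarrow> B\<close>, \<open>Q : B \<rightarrow> C\<close>;
  \<open>\<eta> \<Zsemi> \<mu>\<close> is the composite of \<open>\<eta> : P \<Rightarrow> Q\<close> and \<open>\<mu> : Q \<Rightarrow> T\<close>; and
  \<open>\<eta> \<star> \<mu> : P \<odot> P' \<Rightarrow> Q \<odot> Q'\<close> for \<open>\<eta> : P \<Rightarrow> Q\<close> and \<open>\<mu> : P' \<Rightarrow> Q'\<close>. The operations are only
  constrained on composable arguments.
\<close>
locale bicategory =
  fixes Obj :: "'o set"
    and Arr1 :: "'h set" and dom1 cod1 :: "'h \<Rightarrow> 'o"
    and Arr2 :: "'c set" and dom2 cod2 :: "'c \<Rightarrow> 'h"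
    and id2 :: "'h \<Rightarrow> 'c"
    and vcomp :: "'c \<Rightarrow> 'c \<Rightarrow> 'c"  (infixl "\<Zsemi>" 55)
    and id1 :: "'o \<Rightarrow> 'h"
    and comp1 :: "'h \<Rightarrow> 'h \<Rightarrow> 'h"  (infixl "\<odot>" 75)
    and hcomp :: "'c \<Rightarrow> 'c \<Rightarrow> 'c"  (infixl "\<star>" 70)
    and asc :: "'h \<Rightarrow> 'h \<Rightarrow> 'h \<Rightarrow> 'c"
    and lun run :: "'h \<Rightarrow> 'c"
  assumes dom1: "P \<in> Arr1 \<Longrightarrow> dom1 P \<in> Obj"
    and cod1: "P \<in> Arr1 \<Longrightarrow> cod1 P \<in> Obj"
    and dom2: "\<eta> \<in> Arr2 \<Longrightarrow> dom2 \<eta> \<in> Arr1"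
    and cod2: "\<eta> \<in> Arr2 \<Longrightarrow> cod2 \<eta> \<in> Arr1"
    and parallel_dom: "\<eta> \<in> Arr2 \<Longrightarrow> dom1 (dom2 \<eta>) = dom1 (cod2 \<eta>)"
    and parallel_cod: "\<eta> \<in> Arr2 \<Longrightarrow> cod1 (dom2 \<eta>) = cod1 (cod2 \<eta>)"
    \<comment> \<open>the hom-categories\<close>
    and id2_type: "P \<in> Arr1 \<Longrightarrow> id2 P \<in> Arr2 \<and> dom2 (id2 P) = P \<and> cod2 (id2 P) = P"
    and vcomp_type: "\<lbrakk>\<eta> \<in> Arr2; \<mu> \<in> Arr2; cod2 \<eta> = dom2 \<mu>\<rbrakk>
          \<Longrightarrow> \<eta> \<Zsemi> \<mu> \<in> Arr2 \<and> dom2 (\<eta> \<Zsemi> \<mu>) = dom2 \<eta> \<and> cod2 (\<eta> \<Zsemi> \<mu>) = cod2 \<mu>"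
    and vcomp_assoc: "\<lbrakk>\<eta> \<in> Arr2; \<mu> \<in> Arr2; \<nu> \<in> Arr2; cod2 \<eta> = dom2 \<mu>; cod2 \<mu> = dom2 \<nu>\<rbrakk>
          \<Longrightarrow> (\<eta> \<Zsemi> \<mu>) \<Zsemi> \<nu> = \<eta> \<Zsemi> (\<mu> \<Zsemi> \<nu>)"
    and vcomp_id_left: "\<eta> \<in> Arr2 \<Longrightarrow> id2 (dom2 \<eta>) \<Zsemi> \<eta> = \<eta>"
    and vcomp_id_right: "\<eta> \<in> Arr2 \<Longrightarrow> \<eta> \<Zsemi> id2 (cod2 \<eta>) = \<eta>"
    \<comment> \<open>units and the composition functors\<close>
    and id1_type: "A \<in> Obj \<Longrightarrow> id1 A \<in> Arr1 \<and> dom1 (id1 A) = A \<and> cod1 (id1 A) = A"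
    and comp1_type: "\<lbrakk>P \<in> Arr1; Q \<in> Arr1; cod1 P = dom1 Q\<rbrakk>
          \<Longrightarrow> P \<odot> Q \<in> Arr1 \<and> dom1 (P \<odot> Q) = dom1 P \<and> cod1 (P \<odot> Q) = cod1 Q"
    and hcomp_type: "\<lbrakk>\<eta> \<in> Arr2; \<mu> \<in> Arr2; cod1 (dom2 \<eta>) = dom1 (dom2 \<mu>)\<rbrakk>
          \<Longrightarrow> \<eta> \<star> \<mu> \<in> Arr2 \<and> dom2 (\<eta> \<star> \<mu>) = dom2 \<eta> \<odot> dom2 \<mu> \<and> cod2 (\<eta> \<star> \<mu>) = cod2 \<eta> \<odot> cod2 \<mu>"
    and hcomp_id: "\<lbrakk>P \<in> Arr1; Q \<in> Arr1; cod1 P = dom1 Q\<rbrakk> \<Longrightarrow> id2 P \<star> id2 Q = id2 (P \<odot> Q)"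
    and interchange: "\<lbrakk>\<eta> \<in> Arr2; \<eta>' \<in> Arr2; \<mu> \<in> Arr2; \<mu>' \<in> Arr2;
           cod2 \<eta> = dom2 \<eta>'; cod2 \<mu> = dom2 \<mu>'; cod1 (dom2 \<eta>) = dom1 (dom2 \<mu>)\<rbrakk>
          \<Longrightarrow> (\<eta> \<Zsemi> \<eta>') \<star> (\<mu> \<Zsemi> \<mu>') = (\<eta> \<star> \<mu>) \<Zsemi> (\<eta>' \<star> \<mu>')"
    \<comment> \<open>associator and unitors: natural isomorphisms\<close>
    and asc_type: "\<lbrakk>P \<in> Arr1; Q \<in> Arr1; T \<in> Arr1; cod1 P = dom1 Q; cod1 Q = dom1 T\<rbrakk>
          \<Longrightarrow> asc P Q T \<in> Arr2 \<and> dom2 (asc P Q T) = P \<odot> (Q \<odot> T) \<and> cod2 (asc P Q T) = (P \<odot> Q) \<odot> T"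
    and asc_iso: "\<lbrakk>P \<in> Arr1; Q \<in> Arr1; T \<in> Arr1; cod1 P = dom1 Q; cod1 Q = dom1 T\<rbrakk>
          \<Longrightarrow> \<exists>\<beta>\<in>Arr2. dom2 \<beta> = (P \<odot> Q) \<odot> T \<and> cod2 \<beta> = P \<odot> (Q \<odot> T)
                \<and> asc P Q T \<Zsemi> \<beta> = id2 (P \<odot> (Q \<odot> T)) \<and> \<beta> \<Zsemi> asc P Q T = id2 ((P \<odot> Q) \<odot> T)"
    and asc_natural: "\<lbrakk>\<eta> \<in> Arr2; \<mu> \<in> Arr2; \<nu> \<in> Arr2;
           cod1 (dom2 \<eta>) = dom1 (dom2 \<mu>); cod1 (dom2 \<mu>) = dom1 (dom2 \<nu>)\<rbrakk>
          \<Longrightarrow> (\<eta> \<star> (\<mu> \<star> \<nu>)) \<Zsemi> asc (cod2 \<eta>) (cod2 \<mu>) (cod2 \<nu>)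
              = asc (dom2 \<eta>) (dom2 \<mu>) (dom2 \<nu>) \<Zsemi> ((\<eta> \<star> \<mu>) \<star> \<nu>)"
    and lun_type: "P \<in> Arr1 \<Longrightarrow> lun P \<in> Arr2 \<and> dom2 (lun P) = id1 (dom1 P) \<odot> P \<and> cod2 (lun P) = P"
    and lun_iso: "P \<in> Arr1 \<Longrightarrow> \<exists>\<beta>\<in>Arr2. dom2 \<beta> = P \<and> cod2 \<beta> = id1 (dom1 P) \<odot> P
                \<and> lun P \<Zsemi> \<beta> = id2 (id1 (dom1 P) \<odot> P) \<and> \<beta> \<Zsemi> lun P = id2 P"
    and lun_natural: "\<eta> \<in> Arr2 \<Longrightarrow>
           (id2 (id1 (dom1 (dom2 \<eta>))) \<star> \<eta>) \<Zsemi> lun (cod2 \<eta>) = lun (dom2 \<eta>) \<Zsemi> \<eta>"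
    and run_type: "P \<in> Arr1 \<Longrightarrow> run P \<in> Arr2 \<and> dom2 (run P) = P \<odot> id1 (cod1 P) \<and> cod2 (run P) = P"
    and run_iso: "P \<in> Arr1 \<Longrightarrow> \<exists>\<beta>\<in>Arr2. dom2 \<beta> = P \<and> cod2 \<beta> = P \<odot> id1 (cod1 P)
                \<and> run P \<Zsemi> \<beta> = id2 (P \<odot> id1 (cod1 P)) \<and> \<beta> \<Zsemi> run P = id2 P"
    and run_natural: "\<eta> \<in> Arr2 \<Longrightarrow>
           (\<eta> \<star> id2 (id1 (cod1 (dom2 \<eta>)))) \<Zsemi> run (cod2 \<eta>) = run (dom2 \<eta>) \<Zsemi> \<eta>"
    \<comment> \<open>coherence\<close>
    and pentagon: "\<lbrakk>P \<in> Arr1; Q \<in> Arr1; T \<in> Arr1; V \<in> Arr1;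
           cod1 P = dom1 Q; cod1 Q = dom1 T; cod1 T = dom1 V\<rbrakk>
          \<Longrightarrow> asc P Q (T \<odot> V) \<Zsemi> asc (P \<odot> Q) T V
              = (id2 P \<star> asc Q T V) \<Zsemi> asc P (Q \<odot> T) V \<Zsemi> (asc P Q T \<star> id2 V)"
    and triangle: "\<lbrakk>P \<in> Arr1; Q \<in> Arr1; cod1 P = dom1 Q\<rbrakk>
          \<Longrightarrow> asc P (id1 (cod1 P)) Q \<Zsemi> (run P \<star> id2 Q) = id2 P \<star> lun Q"

end

theory Submission
  imports Defs
begin

text \<open>
  A locally trivial principal bundle \<open>P \<rightarrow> X\<close> has local sections and a continuous division: for
  \<open>p\<close>, \<open>p'\<close> in one fibre, the unique \<open>n\<close> with \<open>p n = p'\<close>, written \<open>p\<^sup>-\<^sup>1p'\<close>, depends continuously on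
  \<open>(p, p')\<close>. Conversely these two features give local triviality (\<open>principal_bundle_if_division\<close>).
  The topology in the theorem is handled through them.

  The difficulty is the composite \<open>P \<bullet> Q\<close>, a quotient of \<open>P \<times>\<^sub>Y Q\<close>. The groupoid in the middle
  may fail to have an open source map, so the quotient map need not be open, and its product with
  a space need not be a quotient map; even the continuity of the induced actions is therefore
  not a formality. A local section \<open>s\<close> of \<open>P \<rightarrow> X\<close> helps: over its domain,
  \<open>[p, q] \<mapsto> (s x, (s(x)\<^sup>-\<^sup>1p) q)\<close>, with \<open>x\<close> the image of \<open>p\<close>, is a well-defined continuous right
  inverse of the quotient map. Hence continuous families of classes lift locally to continuous
  families of representatives (\<open>local_lift\<close>), and every map that is given by a continuous
  formula on representatives is continuous. In this way \<open>P \<bullet> Q\<close> gets continuous actions, local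
  sections \<open>x \<mapsto> [s x, s'(y)]\<close> with \<open>y\<close> the right moment of \<open>s x\<close>, and the continuous division
  \<open>[p, q]\<^sup>-\<^sup>1[p', q'] = q\<^sup>-\<^sup>1((p\<^sup>-\<^sup>1p') q')\<close>, so it is again a generalized morphism.

  The conditions (E1) and (E2) have the same shape, called \<open>exchange\<close> below: two bundles of
  groups act freely from the two sides with the same orbits. Since orbits partition, this
  means that the orbits through each single point agree, so \<open>\<alpha>(h) p = p \<delta>(k)\<close> can be solved for
  \<open>k\<close>. Then \<open>[\<alpha>(h) p, q] = [p \<delta>(k), q] = [p, \<delta>(k) q]\<close>, which transports orbits and freeness
  through a composite. For the unit, the condition holds because the images of the two
  bundles in the middle groupoid are normal.

  A morphism of principal bundles over the same base is invertible, its inverse being continuous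
  by the formula \<open>q \<mapsto> s(x) (f(s x)\<^sup>-\<^sup>1q)\<close>. So all 2-arrows are isomorphisms, in
  particular the associators and unitors. What remains are equations between 2-arrows, which
  are compared on points such as \<open>[p, [q, t]]\<close>.
\<close>

section \<open>Continuity on fibre products and local continuity\<close>

lemma continuous_map_if_locally:
  assumes "\<And>x. x \<in> topspace X \<Longrightarrow>
             \<exists>U. openin X U \<and> x \<in> U \<and> continuous_map (subtopology X U) Y f"
  shows "continuous_map X Y f"
proof -
  obtain U where U: "\<And>x. x \<in> topspace X \<Longrightarrow>
      openin X (U x) \<and> x \<in> U x \<and> continuous_map (subtopology X (U x)) Y f"
    using assms by metis
  show ?thesis by (rule pasting_lemma[where I = "topspace X" and T = U and f = "\<lambda>_. f"]) (use U in auto)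
qed

lemma topspace_fibre_prod:
  "topspace (fibre_prod X f Y g) = {(x, y). x \<in> topspace X \<and> y \<in> topspace Y \<and> f x = g y}"
  by (auto simp: fibre_prod_def)

lemma continuous_map_into_fibre_prod:
  assumes "continuous_map Z X a" "continuous_map Z Y b" "\<And>z. z \<in> topspace Z \<Longrightarrow> f (a z) = g (b z)"
  shows "continuous_map Z (fibre_prod X f Y g) (\<lambda>z. (a z, b z))"
  using assms by (auto simp: fibre_prod_def continuous_map_in_subtopology continuous_map_pairedI)

lemma continuous_map_fst_fibre_prod: "continuous_map (fibre_prod X f Y g) X fst"
  and continuous_map_snd_fibre_prod: "continuous_map (fibre_prod X f Y g) Y snd"
  by (auto simp: fibre_prod_def intro: continuous_map_from_subtopology continuous_map_fst continuous_map_snd)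

text \<open>
  Multiplications, actions and divisions are defined on fibre products only; this is the rule by
  which composites of such partial operations are seen to be continuous.
\<close>
lemma continuous_map_on_fibre_prod:
  assumes "continuous_map (fibre_prod X f Y g) W (\<lambda>(x, y). h x y)"
    and "continuous_map Z X a" "continuous_map Z Y b" "\<And>z. z \<in> topspace Z \<Longrightarrow> f (a z) = g (b z)"
  shows "continuous_map Z W (\<lambda>z. h (a z) (b z))"
proof -
  have "continuous_map Z (fibre_prod X f Y g) (\<lambda>z. (a z, b z))"
    by (rule continuous_map_into_fibre_prod) (use assms in auto)
  from continuous_map_compose[OF this assms(1)] show ?thesis by (simp add: o_def)
qed

lemma continuous_map_mem: "continuous_map X Y f \<Longrightarrow> x \<in> topspace X \<Longrightarrow> f x \<in> topspace Y"
  by (auto simp: continuous_map_def)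

lemma continuous_map_compose_on:
  assumes "continuous_map Y W g" "continuous_map X Y f"
  shows "continuous_map X W (\<lambda>x. g (f x))"
  using continuous_map_compose[OF assms(2,1)] by (simp add: o_def)

lemma continuous_map_cong_on:
  assumes "continuous_map X Y f" "\<And>x. x \<in> topspace X \<Longrightarrow> f x = g x"
  shows "continuous_map X Y g"
  using assms continuous_map_eq by blast

section \<open>Topological groupoids\<close>

context topological_groupoid begin

lemma src_obj: "g \<in> topspace (arr G) \<Longrightarrow> src G g \<in> topspace (obj G)"
  using src_cont by (rule continuous_map_mem)

lemma tgt_obj: "g \<in> topspace (arr G) \<Longrightarrow> tgt G g \<in> topspace (obj G)"
  using tgt_cont by (rule continuous_map_mem)

lemma one_arr: "x \<in> topspace (obj G) \<Longrightarrow> one G x \<in> topspace (arr G)"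
  using one_cont by (rule continuous_map_mem)

lemma ginv_arr: "g \<in> topspace (arr G) \<Longrightarrow> ginv G g \<in> topspace (arr G)"
  using ginv_cont by (rule continuous_map_mem)

lemma mul_arr:
  "\<lbrakk>g \<in> topspace (arr G); f \<in> topspace (arr G); src G g = tgt G f\<rbrakk>
     \<Longrightarrow> mul G g f \<in> topspace (arr G)"
  using continuous_map_mem[OF mul_cont, of "(g, f)"] by (simp add: topspace_fibre_prod)

lemmas src_tgt_simps = src_one tgt_one src_mul tgt_mul src_ginv tgt_ginv

lemma mul_ginv_cancel_left:
  assumes "g \<in> topspace (arr G)" "f \<in> topspace (arr G)" "tgt G g = tgt G f"
  shows "mul G g (mul G (ginv G g) f) = f"
  using assms by (metis mul_assoc mul_ginv one_mul src_ginv tgt_ginv ginv_arr)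

lemma ginv_mul_cancel_left:
  assumes "g \<in> topspace (arr G)" "f \<in> topspace (arr G)" "src G g = tgt G f"
  shows "mul G (ginv G g) (mul G g f) = f"
  using assms by (metis mul_assoc ginv_mul one_mul src_ginv ginv_arr)

lemma ginv_ginv: "g \<in> topspace (arr G) \<Longrightarrow> ginv G (ginv G g) = g"
  by (metis ginv_arr ginv_mul ginv_mul_cancel_left mul_one src_ginv tgt_ginv)

lemma mul_left_unit:
  assumes "g \<in> topspace (arr G)" "k \<in> topspace (arr G)" "src G k = tgt G g" "mul G k g = g"
  shows "k = one G (tgt G g)"
  using assms by (metis mul_assoc mul_ginv mul_one tgt_ginv ginv_arr)

lemma mul_right_unit:
  assumes "g \<in> topspace (arr G)" "k \<in> topspace (arr G)" "src G g = tgt G k" "mul G g k = g"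
  shows "k = one G (src G g)"
  using assms by (metis ginv_mul_cancel_left ginv_mul)

end

section \<open>Actions\<close>

context left_action begin

lemma act_spc: "\<lbrakk>g \<in> topspace (arr G); p \<in> topspace P; src G g = mom p\<rbrakk> \<Longrightarrow> act g p \<in> topspace P"
  using continuous_map_mem[OF act_cont, of "(g, p)"] by (simp add: topspace_fibre_prod)

lemma mom_obj: "p \<in> topspace P \<Longrightarrow> mom p \<in> topspace (obj G)"
  using mom_cont by (rule continuous_map_mem)

lemma act_ginv:
  assumes "g \<in> topspace (arr G)" "p \<in> topspace P" "src G g = mom p"
  shows "act (ginv G g) (act g p) = p"
  using assms by (metis act_mul act_one ginv_arr ginv_mul src_ginv)

end

context right_action begin

lemma act_spc: "\<lbrakk>p \<in> topspace P; g \<in> topspace (arr G); mom p = tgt G g\<rbrakk> \<Longrightarrow> act p g \<in> topspace P"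
  using continuous_map_mem[OF act_cont, of "(p, g)"] by (simp add: topspace_fibre_prod)

lemma mom_obj: "p \<in> topspace P \<Longrightarrow> mom p \<in> topspace (obj G)"
  using mom_cont by (rule continuous_map_mem)

lemma act_ginv:
  assumes "p \<in> topspace P" "g \<in> topspace (arr G)" "mom p = tgt G g"
  shows "act (act p g) (ginv G g) = p"
  using assms by (metis act_mul act_one ginv_arr mul_ginv tgt_ginv)

text \<open>
  The element \<open>n k\<^sup>-\<^sup>1\<close> fixes \<open>p\<close>.
\<close>
lemma act_cancel_if_free:
  assumes free: "\<And>k. \<lbrakk>k \<in> topspace (arr G); mom p = tgt G k; act p k = p\<rbrakk> \<Longrightarrow> k = one G (mom p)"
    and p: "p \<in> topspace P" and nk: "n \<in> topspace (arr G)" "k \<in> topspace (arr G)"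
    "mom p = tgt G n" "mom p = tgt G k" "act p n = act p k"
  shows "n = k"
proof -
  have s: "src G n = src G k" using p nk mom_act by metis
  have k': "ginv G k \<in> topspace (arr G)" "tgt G (ginv G k) = src G n" "src G (ginv G k) = tgt G k"
    using nk s by (simp_all add: ginv_arr src_tgt_simps)
  have "act p (mul G n (ginv G k)) = act (act p n) (ginv G k)"
    using p nk k' by (intro act_mul) auto
  also have "\<dots> = p" using p nk act_ginv by auto
  finally have "mul G n (ginv G k) = one G (mom p)"
    using nk k' by (intro free) (auto intro!: mul_arr simp: src_tgt_simps)
  moreover have "mul G (mul G n (ginv G k)) k = mul G n (mul G (ginv G k) k)"
    using nk k' by (intro mul_assoc) auto
  ultimately show ?thesis using nk s by (metis one_mul mul_one ginv_mul)
qed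

end

section \<open>Principal bundles by local sections and division\<close>

context principal_bundle begin

text \<open>The division \<open>p\<^sup>-\<^sup>1q\<close>; it is determined uniquely, by freeness of the action.\<close>
definition divn :: "'u \<Rightarrow> 'u \<Rightarrow> 'u" where
  "divn p q = (SOME n. n \<in> topspace (arr N) \<and> mom p = tgt N n \<and> q = act p n)"

lemma divn:
  assumes "p \<in> topspace P" "q \<in> topspace P" "pr p = pr q"
  shows divn_arr: "divn p q \<in> topspace (arr N)"
    and tgt_divn: "tgt N (divn p q) = mom p"
    and act_divn: "act p (divn p q) = q"
    and src_divn: "src N (divn p q) = mom q"
proof -
  have *: "divn p q \<in> topspace (arr N) \<and> mom p = tgt N (divn p q) \<and> q = act p (divn p q)"
    unfolding divn_def by (rule someI_ex) (use act_trans[OF assms] in blast)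
  then show "divn p q \<in> topspace (arr N)" "tgt N (divn p q) = mom p" "act p (divn p q) = q"
    by auto
  then show "src N (divn p q) = mom q" using mom_act[of p "divn p q"] assms by auto
qed

lemma act_inj:
  assumes "p \<in> topspace P" "n \<in> topspace (arr N)" "k \<in> topspace (arr N)"
    "mom p = tgt N n" "mom p = tgt N k" "act p n = act p k"
  shows "n = k"
  by (rule act_cancel_if_free[OF _ assms]) (erule (2) act_free[OF assms(1)])

lemma divn_act: "\<lbrakk>p \<in> topspace P; n \<in> topspace (arr N); mom p = tgt N n\<rbrakk> \<Longrightarrow> divn p (act p n) = n"
  by (rule act_inj[of p]) (auto simp: divn pr_act act_spc)

text \<open>
  A local trivialization turns the unit section of the groupoid into a section of the bundle.
\<close>
lemma local_section:
  assumes x: "x \<in> topspace X"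
  obtains U s where "openin X U" "x \<in> U" "continuous_map (subtopology X U) P s"
    "\<And>u. u \<in> U \<Longrightarrow> s u \<in> topspace P" "\<And>u. u \<in> U \<Longrightarrow> pr (s u) = u"
proof -
  obtain U f \<tau> where U: "openin X U" "x \<in> U" and f: "continuous_map (subtopology X U) (obj N) f"
    and hom: "homeomorphic_map (fibre_prod (subtopology X U) f (arr N) (tgt N))
             (subtopology P {p \<in> topspace P. pr p \<in> U}) \<tau>"
    and \<tau>: "\<And>u n. u \<in> U \<Longrightarrow> n \<in> topspace (arr N) \<Longrightarrow> f u = tgt N n \<Longrightarrow> pr (\<tau> (u, n)) = u"
    using locally_trivial[OF x] by blast
  have top: "topspace (subtopology X U) = U" using U openin_subset by (auto simp: topspace_subtopology)
  have fU: "f u \<in> topspace (obj N)" if "u \<in> U" for u using f that top continuous_map_mem by metis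
  define s where "s u = \<tau> (u, one N (f u))" for u
  have "continuous_map (subtopology X U) (fibre_prod (subtopology X U) f (arr N) (tgt N))
          (\<lambda>u. (u, one N (f u)))"
    using fU top by (intro continuous_map_into_fibre_prod continuous_map_compose_on[OF one_cont f])
      (auto simp: tgt_one)
  moreover have "continuous_map (fibre_prod (subtopology X U) f (arr N) (tgt N)) P \<tau>"
    using homeomorphic_imp_continuous_map[OF hom] continuous_map_in_subtopology by blast
  ultimately have s: "continuous_map (subtopology X U) P s"
    unfolding s_def by (rule continuous_map_compose_on[rotated])
  show thesis
    using that[OF U s] s top \<tau> fU continuous_map_mem[OF s] by (simp add: s_def one_arr tgt_one)
qed

text \<open>
  In a local trivialization the division is \<open>((u, a), (u, b)) \<mapsto> a\<^sup>-\<^sup>1b\<close>.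
\<close>
lemma divn_cont: "continuous_map (fibre_prod P pr P pr) (arr N) (\<lambda>(p, q). divn p q)"
proof (rule continuous_map_if_locally)
  let ?D = "fibre_prod P pr P pr"
  fix z0 assume z0: "z0 \<in> topspace ?D"
  then have x: "pr (fst z0) \<in> topspace X"
    using continuous_map_mem[OF pr_cont] by (auto simp: topspace_fibre_prod)
  obtain U f \<tau> where U: "openin X U" "pr (fst z0) \<in> U"
    and hom: "homeomorphic_map (fibre_prod (subtopology X U) f (arr N) (tgt N))
             (subtopology P {p \<in> topspace P. pr p \<in> U}) \<tau>"
    and \<tau>: "\<And>u n. u \<in> U \<Longrightarrow> n \<in> topspace (arr N) \<Longrightarrow> f u = tgt N n \<Longrightarrow>
             pr (\<tau> (u, n)) = u \<and> mom (\<tau> (u, n)) = src N n \<and>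
             (\<forall>k\<in>topspace (arr N). src N n = tgt N k \<longrightarrow> \<tau> (u, mul N n k) = act (\<tau> (u, n)) k)"
    using locally_trivial[OF x] by meson
  obtain \<sigma> where \<sigma>: "homeomorphic_maps (fibre_prod (subtopology X U) f (arr N) (tgt N))
             (subtopology P {p \<in> topspace P. pr p \<in> U}) \<tau> \<sigma>"
    using hom homeomorphic_map_maps by blast
  define W where "W = {z \<in> topspace ?D. pr (fst z) \<in> U}"
  define a where "a p = snd (\<sigma> p)" for p
  have pr_fst: "continuous_map ?D X (\<lambda>z. pr (fst z))"
    by (rule continuous_map_compose_on[OF pr_cont continuous_map_fst_fibre_prod])
  have W: "openin ?D W"
    unfolding W_def by (rule openin_continuous_map_preimage[OF pr_fst U(1)])
  have a_cont: "continuous_map (subtopology P {p \<in> topspace P. pr p \<in> U}) (arr N) a"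
    unfolding a_def by (rule continuous_map_compose_on[OF continuous_map_snd_fibre_prod])
      (use \<sigma> in \<open>auto simp: homeomorphic_maps_def\<close>)
  have a: "a p \<in> topspace (arr N) \<and> f (pr p) = tgt N (a p) \<and> \<tau> (pr p, a p) = p"
    if "p \<in> topspace P" "pr p \<in> U" for p
  proof -
    have "p \<in> topspace (subtopology P {p \<in> topspace P. pr p \<in> U})" using that by simp
    then have 1: "\<sigma> p \<in> topspace (fibre_prod (subtopology X U) f (arr N) (tgt N))" "\<tau> (\<sigma> p) = p"
      using \<sigma> unfolding homeomorphic_maps_def by (auto dest: continuous_map_mem simp del: topspace_subtopology)
    then obtain u n where un: "\<sigma> p = (u, n)" "u \<in> U" "n \<in> topspace (arr N)" "f u = tgt N n"
      by (auto simp: topspace_fibre_prod)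
    then show ?thesis using \<tau>[of u n] 1 by (auto simp: a_def)
  qed
  have proj: "continuous_map (subtopology ?D W) (subtopology P {p \<in> topspace P. pr p \<in> U}) fst"
    "continuous_map (subtopology ?D W) (subtopology P {p \<in> topspace P. pr p \<in> U}) snd"
    by (auto simp: continuous_map_in_subtopology W_def topspace_fibre_prod
          intro: continuous_map_from_subtopology continuous_map_fst_fibre_prod continuous_map_snd_fibre_prod)
  have "continuous_map (subtopology ?D W) (arr N) (\<lambda>z. mul N (ginv N (a (fst z))) (a (snd z)))"
  proof (rule continuous_map_on_fibre_prod[OF mul_cont])
    show "continuous_map (subtopology ?D W) (arr N) (\<lambda>z. ginv N (a (fst z)))"
      by (rule continuous_map_compose_on[OF ginv_cont continuous_map_compose_on[OF a_cont proj(1)]])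
    show "continuous_map (subtopology ?D W) (arr N) (\<lambda>z. a (snd z))"
      by (rule continuous_map_compose_on[OF a_cont proj(2)])
    fix z assume "z \<in> topspace (subtopology ?D W)"
    then obtain p q where "z = (p, q)" "p \<in> topspace P" "q \<in> topspace P" "pr p = pr q" "pr p \<in> U"
      by (auto simp: W_def topspace_fibre_prod)
    then show "src N (ginv N (a (fst z))) = tgt N (a (snd z))"
      using a[of p] a[of q] by (simp add: src_ginv)
  qed
  moreover have "mul N (ginv N (a p)) (a q) = divn p q"
    if "(p, q) \<in> topspace (subtopology ?D W)" for p q
  proof -
    have pq: "p \<in> topspace P" "q \<in> topspace P" "pr p = pr q" "pr p \<in> U"
      using that by (auto simp: W_def topspace_fibre_prod)
    note ap = a[OF pq(1,4)] and aq = a[OF pq(2) pq(4)[unfolded pq(3)]]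
    let ?n = "mul N (ginv N (a p)) (a q)"
    have t: "tgt N (a p) = tgt N (a q)" using ap aq pq(3) by metis
    have n: "?n \<in> topspace (arr N)" "tgt N ?n = src N (a p)"
      using ap aq t by (simp_all add: mul_arr ginv_arr src_tgt_simps)
    have "act p ?n = \<tau> (pr p, mul N (a p) ?n)" using \<tau>[of "pr p" "a p"] ap n pq by metis
    also have "\<dots> = q" using mul_ginv_cancel_left[of "a p" "a q"] ap aq t pq(3) by metis
    finally have "act p ?n = q" .
    moreover have "mom p = tgt N ?n" using \<tau>[of "pr p" "a p"] ap n pq by metis
    ultimately show ?thesis using divn_act pq n by metis
  qed
  ultimately have "continuous_map (subtopology ?D W) (arr N) (\<lambda>(p, q). divn p q)"
    by (elim continuous_map_cong_on) auto
  then show "\<exists>W. openin ?D W \<and> z0 \<in> W \<and> continuous_map (subtopology ?D W) (arr N) (\<lambda>(p, q). divn p q)"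
    using W U z0 W_def by blast
qed

end

text \<open>
  A local section \<open>s\<close> gives the trivialization \<open>(u, n) \<mapsto> s(u) n\<close>, and the division \<open>d\<close> makes its
  inverse \<open>p \<mapsto> (pr p, d (s (pr p)) p)\<close> continuous.
\<close>
lemma (in right_action) principal_bundle_if_division:
  assumes pr_cont: "continuous_map P X pr"
    and pr_surj: "pr ` topspace P = topspace X"
    and pr_act: "\<And>p n. \<lbrakk>p \<in> topspace P; n \<in> topspace (arr G); mom p = tgt G n\<rbrakk> \<Longrightarrow> pr (act p n) = pr p"
    and act_free: "\<And>p n. \<lbrakk>p \<in> topspace P; n \<in> topspace (arr G); mom p = tgt G n; act p n = p\<rbrakk>
                     \<Longrightarrow> n = one G (mom p)"
    and d_cont: "continuous_map (fibre_prod P pr P pr) (arr G) (\<lambda>(p, q). d p q)"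
    and d: "\<And>p q. \<lbrakk>p \<in> topspace P; q \<in> topspace P; pr p = pr q\<rbrakk>
              \<Longrightarrow> mom p = tgt G (d p q) \<and> act p (d p q) = q"
    and sections: "\<And>x. x \<in> topspace X \<Longrightarrow> \<exists>U s. openin X U \<and> x \<in> U
              \<and> continuous_map (subtopology X U) P s \<and> (\<forall>u\<in>U. pr (s u) = u)"
  shows "principal_bundle G P X pr mom act"
proof -
  have d_arr: "d p q \<in> topspace (arr G)" if "p \<in> topspace P" "q \<in> topspace P" "pr p = pr q" for p q
    using continuous_map_mem[OF d_cont, of "(p, q)"] that by (simp add: topspace_fibre_prod)
  have d_act: "d p (act p n) = n" if "p \<in> topspace P" "n \<in> topspace (arr G)" "mom p = tgt G n" for p n
  proof -
    have an: "act p n \<in> topspace P" "pr p = pr (act p n)" using that act_spc pr_act by auto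
    show ?thesis
      by (rule act_cancel_if_free[of p]) (use that act_free d_arr[OF _ an] d[OF _ an] in auto)
  qed
  have loc: "\<exists>U f \<tau>. openin X U \<and> x \<in> U
        \<and> continuous_map (subtopology X U) (obj G) f
        \<and> homeomorphic_map (fibre_prod (subtopology X U) f (arr G) (tgt G))
             (subtopology P {p \<in> topspace P. pr p \<in> U}) \<tau>
        \<and> (\<forall>u\<in>U. \<forall>n\<in>topspace (arr G). f u = tgt G n \<longrightarrow>
             pr (\<tau> (u, n)) = u \<and> mom (\<tau> (u, n)) = src G n \<and>
             (\<forall>k\<in>topspace (arr G). src G n = tgt G k \<longrightarrow> \<tau> (u, mul G n k) = act (\<tau> (u, n)) k))"
    if x: "x \<in> topspace X" for x
  proof -
    obtain U s where U: "openin X U" "x \<in> U" and s: "continuous_map (subtopology X U) P s"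
      and prs: "\<And>u. u \<in> U \<Longrightarrow> pr (s u) = u" using sections[OF x] by metis
    have top: "topspace (subtopology X U) = U" using U openin_subset by (auto simp: topspace_subtopology)
    have sP: "s u \<in> topspace P" if "u \<in> U" for u using s that top continuous_map_mem by metis
    define f where "f u = mom (s u)" for u
    define \<tau> where "\<tau> = (\<lambda>(u, n). act (s u) n)"
    define \<sigma> where "\<sigma> p = (pr p, d (s (pr p)) p)" for p
    let ?T = "fibre_prod (subtopology X U) f (arr G) (tgt G)"
    let ?P = "subtopology P {p \<in> topspace P. pr p \<in> U}"
    have f: "continuous_map (subtopology X U) (obj G) f"
      unfolding f_def by (rule continuous_map_compose_on[OF mom_cont s])
    have "continuous_map ?T P (\<lambda>z. act (s (fst z)) (snd z))"
      by (rule continuous_map_on_fibre_prod[OF act_cont])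
        (auto intro: continuous_map_compose_on[OF s] continuous_map_fst_fibre_prod
           continuous_map_snd_fibre_prod simp: topspace_fibre_prod f_def)
    then have t1: "continuous_map ?T ?P \<tau>"
      by (auto simp: continuous_map_in_subtopology \<tau>_def case_prod_unfold topspace_fibre_prod
            act_spc sP f_def pr_act prs)
    have pr': "continuous_map ?P (subtopology X U) pr"
      by (auto simp: continuous_map_in_subtopology intro: continuous_map_from_subtopology pr_cont)
    have id: "continuous_map ?P P (\<lambda>p. p)"
      by (rule continuous_map_from_subtopology) (simp add: continuous_map_id[unfolded id_def])
    have "continuous_map ?P (arr G) (\<lambda>p. d (s (pr p)) p)"
      by (rule continuous_map_on_fibre_prod[OF d_cont])
        (auto intro: continuous_map_compose_on[OF s pr'] id simp: prs)
    then have t2: "continuous_map ?P ?T \<sigma>"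
      unfolding \<sigma>_def using d sP prs
      by (intro continuous_map_into_fibre_prod pr') (auto simp: f_def)
    have "homeomorphic_maps ?T ?P \<tau> \<sigma>"
      unfolding homeomorphic_maps_def using t1 t2 sP prs d
      by (auto simp: topspace_fibre_prod \<tau>_def \<sigma>_def f_def pr_act d_act)
    then have "homeomorphic_map ?T ?P \<tau>" using homeomorphic_map_maps by blast
    moreover have "\<forall>u\<in>U. \<forall>n\<in>topspace (arr G). f u = tgt G n \<longrightarrow>
             pr (\<tau> (u, n)) = u \<and> mom (\<tau> (u, n)) = src G n \<and>
             (\<forall>k\<in>topspace (arr G). src G n = tgt G k \<longrightarrow> \<tau> (u, mul G n k) = act (\<tau> (u, n)) k)"
      using sP prs by (simp add: \<tau>_def f_def pr_act mom_act act_mul)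
    ultimately show ?thesis using U f by blast
  qed
  have trans: "\<exists>n\<in>topspace (arr G). mom p = tgt G n \<and> q = act p n"
    if "p \<in> topspace P" "q \<in> topspace P" "pr p = pr q" for p q
    using d_arr[OF that] d[OF that] by metis
  show ?thesis
    by (rule principal_bundle.intro[OF right_action_axioms principal_bundle_axioms.intro])
      (rule pr_cont, rule pr_surj, erule (2) pr_act, erule (3) act_free, erule (2) trans, erule loc)
qed

section \<open>The composite of two generalized morphisms\<close>

locale composable =
  P: generalized_morphism M N P + Q: generalized_morphism N L Q
  for M N L :: "'u::infinite groupoid" and P Q :: "'u gen_mor"
begin

abbreviation "c \<equiv> cls N P Q"
abbreviation "S \<equiv> topspace (pairs P Q)"
abbreviation "R \<equiv> comp_gen_mor M N L P Q"

lemma mem_pairs: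
  "(p, q) \<in> S \<longleftrightarrow> p \<in> topspace (spc P) \<and> q \<in> topspace (spc Q) \<and> rmom P p = lmom Q q"
  by (simp add: pairs_def topspace_fibre_prod)

lemma mem_balance:
  "((p, q), (p', q')) \<in> balance N P Q \<longleftrightarrow>
     p' \<in> topspace (spc P) \<and> q \<in> topspace (spc Q) \<and>
     (\<exists>n\<in>topspace (arr N). rmom P p' = tgt N n \<and> src N n = lmom Q q \<and> p = ract P p' n \<and> q' = lact Q n q)"
  by (auto simp: balance_def)

lemma equiv_balance: "equiv S (balance N P Q)"
proof (rule equivI)
  show "balance N P Q \<subseteq> S \<times> S"
    by (auto simp: balance_def mem_pairs P.R.act_spc P.R.mom_act Q.L.act_spc Q.L.mom_act)
  show "refl_on S (balance N P Q)"
  proof (rule refl_onI, clarify)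
    fix p q assume pq: "(p, q) \<in> S"
    then have "rmom P p \<in> topspace (obj N)" "ract P p (one N (rmom P p)) = p"
      "lact Q (one N (lmom Q q)) q = q"
      using P.R.mom_obj P.R.act_one Q.L.act_one unfolding mem_pairs by blast+
    then show "((p, q), (p, q)) \<in> balance N P Q"
      using pq unfolding mem_balance mem_pairs
      by (intro conjI bexI[of _ "one N (rmom P p)"])
        (auto simp: P.R.one_arr P.R.src_tgt_simps)
  qed
  show "sym (balance N P Q)"
  proof (rule symI, clarify)
    fix p q p' q' assume "((p, q), (p', q')) \<in> balance N P Q"
    then obtain n where n: "p' \<in> topspace (spc P)" "q \<in> topspace (spc Q)" "n \<in> topspace (arr N)"
      "rmom P p' = tgt N n" "src N n = lmom Q q" "p = ract P p' n" "q' = lact Q n q"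
      unfolding mem_balance by blast
    then show "((p', q'), (p, q)) \<in> balance N P Q"
      unfolding mem_balance
      by (intro conjI bexI[of _ "ginv N n"])
        (simp_all add: P.R.act_spc P.R.mom_act Q.L.act_spc Q.L.mom_act P.R.ginv_arr P.R.src_tgt_simps
           P.R.act_ginv Q.L.act_ginv)
  qed
  show "trans (balance N P Q)"
  proof (rule transI, clarify)
    fix p q p' q' p'' q''
    assume "((p, q), (p', q')) \<in> balance N P Q" "((p', q'), (p'', q'')) \<in> balance N P Q"
    then obtain n k where n: "p' \<in> topspace (spc P)" "q \<in> topspace (spc Q)" "n \<in> topspace (arr N)"
      "rmom P p' = tgt N n" "src N n = lmom Q q" "p = ract P p' n" "q' = lact Q n q"
      and k: "p'' \<in> topspace (spc P)" "k \<in> topspace (arr N)"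
      "rmom P p'' = tgt N k" "src N k = lmom Q q'" "p' = ract P p'' k" "q'' = lact Q k q'"
      unfolding mem_balance by blast
    have "src N k = tgt N n" using n k Q.L.mom_act by metis
    then show "((p, q), (p'', q'')) \<in> balance N P Q"
      using n k unfolding mem_balance
      by (intro conjI bexI[of _ "mul N k n"])
        (auto simp: P.R.mul_arr P.R.src_tgt_simps P.R.act_mul Q.L.act_mul)
  qed
qed

text \<open>
  A class is coded by a chosen member, and the choice depends only on the class as a set.
\<close>
lemma cls_eq_iff_balance:
  assumes "z \<in> S" "w \<in> S"
  shows "c z = c w \<longleftrightarrow> (z, w) \<in> balance N P Q"
proof
  let ?rep = "\<lambda>z. SOME w. w \<in> balance N P Q `` {z}"
  have rep: "(v, ?rep v) \<in> balance N P Q" if "v \<in> S" for v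
  proof -
    have "v \<in> balance N P Q `` {v}" using equiv_class_self[OF equiv_balance that] .
    then have "?rep v \<in> balance N P Q `` {v}" by (rule someI)
    then show ?thesis by simp
  qed
  assume "c z = c w"
  then have "?rep z = ?rep w" unfolding cls_def by (rule injD[OF inj_pair_code])
  then show "(z, w) \<in> balance N P Q"
    using rep[OF assms(1)] rep[OF assms(2)] equiv_balance unfolding equiv_def
    by (metis symE transE)
next
  assume "(z, w) \<in> balance N P Q"
  then have "balance N P Q `` {z} = balance N P Q `` {w}"
    by (rule equiv_class_eq[OF equiv_balance])
  then show "c z = c w" by (simp add: cls_def)
qed

lemma cls_eq_iff:
  assumes "(p, q) \<in> S" "(p', q') \<in> S"
  shows "c (p, q) = c (p', q') \<longleftrightarrow>
    (\<exists>n\<in>topspace (arr N). rmom P p = tgt N n \<and> src N n = lmom Q q' \<and> p' = ract P p n \<and> q = lact Q n q')"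
proof -
  have "c (p, q) = c (p', q') \<longleftrightarrow> ((p', q'), (p, q)) \<in> balance N P Q"
    using cls_eq_iff_balance[OF assms(2,1)] by metis
  then show ?thesis using assms unfolding mem_balance mem_pairs by blast
qed

lemma cls_balance:
  assumes "p \<in> topspace (spc P)" "n \<in> topspace (arr N)" "q \<in> topspace (spc Q)"
    "rmom P p = tgt N n" "src N n = lmom Q q"
  shows "c (ract P p n, q) = c (p, lact Q n q)"
proof -
  have "((ract P p n, q), (p, lact Q n q)) \<in> balance N P Q"
    using assms by (auto simp: balance_def)
  then show ?thesis using cls_eq_iff_balance equiv_balance unfolding equiv_def by blast
qed

text \<open>
  Only the invariance of \<open>f\<close> along the class of the given point is asked for, because formulas such
  as \<open>[p, q] \<mapsto> [m p, q]\<close> make sense only on those classes on which \<open>m\<close> acts.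
\<close>
lemma descend_cls:
  assumes pq: "(p, q) \<in> S"
    and f: "\<And>n q'. \<lbrakk>n \<in> topspace (arr N); q' \<in> topspace (spc Q); rmom P p = tgt N n;
              src N n = lmom Q q'; q = lact Q n q'\<rbrakk> \<Longrightarrow> f (ract P p n, q') = f (p, q)"
  shows "descend S c f (c (p, q)) = f (p, q)"
proof (rule descend_eq[OF pq])
  fix y assume y: "y \<in> S" "c y = c (p, q)"
  obtain p' q' where y': "y = (p', q')" by (cases y)
  then obtain n where "n \<in> topspace (arr N)" "rmom P p = tgt N n" "src N n = lmom Q q'"
    "p' = ract P p n" "q = lact Q n q'"
    using cls_eq_iff[OF pq] y by metis
  then show "f y = f (p, q)" using f y y' mem_pairs by metis
qed

lemma spc_comp: "spc R = final_topology (pairs P Q) c"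
  by (simp add: comp_gen_mor_def Let_def)

lemma topspace_comp: "topspace (spc R) = c ` S"
  by (simp add: spc_comp topspace_final_topology)

lemma cls_in_comp: "(p, q) \<in> S \<Longrightarrow> c (p, q) \<in> topspace (spc R)"
  by (simp add: topspace_comp)

lemma comp_cases:
  assumes "z \<in> topspace (spc R)"
  obtains p q where "z = c (p, q)" "(p, q) \<in> S" "p \<in> topspace (spc P)" "q \<in> topspace (spc Q)"
    "rmom P p = lmom Q q"
proof -
  obtain w where "w \<in> S" "z = c w" using assms topspace_comp by auto
  then show thesis using that mem_pairs by (cases w) blast
qed

lemma lmom_cls: "(p, q) \<in> S \<Longrightarrow> lmom R (c (p, q)) = lmom P p"
  by (simp add: comp_gen_mor_def Let_def)
    (rule descend_cls[THEN trans]; simp add: mem_pairs P.R.pr_act)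

lemma rmom_cls: "(p, q) \<in> S \<Longrightarrow> rmom R (c (p, q)) = rmom Q q"
  by (simp add: comp_gen_mor_def Let_def)
    (rule descend_cls[THEN trans]; simp add: mem_pairs Q.rmom_lact)

lemma lact_cls:
  assumes "(p, q) \<in> S" "m \<in> topspace (arr M)" "src M m = lmom P p"
  shows "lact R m (c (p, q)) = c (lact P m p, q)"
proof -
  have "lact R m (c (p, q)) = descend S c (\<lambda>(p, q). c (lact P m p, q)) (c (p, q))"
    using assms lmom_cls[OF assms(1)] by (simp add: comp_gen_mor_def Let_def)
  also have "\<dots> = c (lact P m p, q)"
    by (rule descend_cls[OF assms(1), THEN trans])
      (use assms in \<open>auto simp: mem_pairs P.actions_commute[symmetric] P.L.act_spc P.rmom_lact intro!: cls_balance\<close>)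
  finally show ?thesis .
qed

lemma ract_cls:
  assumes "(p, q) \<in> S" "l \<in> topspace (arr L)" "rmom Q q = tgt L l"
  shows "ract R (c (p, q)) l = c (p, ract Q q l)"
proof -
  have "ract R (c (p, q)) l = descend S c (\<lambda>(p, q). c (p, ract Q q l)) (c (p, q))"
    using assms rmom_cls[OF assms(1)] by (simp add: comp_gen_mor_def Let_def)
  also have "\<dots> = c (p, ract Q q l)"
    by (rule descend_cls[OF assms(1), THEN trans])
      (use assms in \<open>auto simp: mem_pairs Q.actions_commute Q.R.act_spc Q.rmom_lact Q.R.pr_act intro!: cls_balance\<close>)
  finally show ?thesis .
qed

lemma mem_pairs_lact:
  "\<lbrakk>(p, q) \<in> S; m \<in> topspace (arr M); src M m = lmom P p\<rbrakk> \<Longrightarrow> (lact P m p, q) \<in> S"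
  by (simp add: mem_pairs P.L.act_spc P.rmom_lact)

lemma mem_pairs_ract:
  "\<lbrakk>(p, q) \<in> S; l \<in> topspace (arr L); rmom Q q = tgt L l\<rbrakk> \<Longrightarrow> (p, ract Q q l) \<in> S"
  by (simp add: mem_pairs Q.R.act_spc Q.R.pr_act)

lemma quotient_map_cls: "quotient_map (pairs P Q) (spc R) c"
  by (simp add: spc_comp quotient_map_final_topology)

lemma continuous_map_cls:
  assumes "continuous_map Z (spc P) a" "continuous_map Z (spc Q) b"
    "\<And>z. z \<in> topspace Z \<Longrightarrow> rmom P (a z) = lmom Q (b z)"
  shows "continuous_map Z (spc R) (\<lambda>z. c (a z, b z))"
proof (rule continuous_map_compose_on[OF quotient_imp_continuous_map[OF quotient_map_cls]])
  show "continuous_map Z (pairs P Q) (\<lambda>z. (a z, b z))"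
    unfolding pairs_def by (rule continuous_map_into_fibre_prod) (use assms in auto)
qed

lemma continuous_map_from_comp:
  assumes "continuous_map (pairs P Q) W g" "\<And>p q. (p, q) \<in> S \<Longrightarrow> f (c (p, q)) = g (p, q)"
  shows "continuous_map (spc R) W f"
proof (rule continuous_compose_quotient_map[OF quotient_map_cls])
  show "continuous_map (pairs P Q) W (f \<circ> c)"
    by (rule continuous_map_cong_on[OF assms(1)]) (use assms(2) in \<open>auto simp: o_def\<close>)
qed

lemma pairs_fst: "continuous_map (pairs P Q) (spc P) fst"
  and pairs_snd: "continuous_map (pairs P Q) (spc Q) snd"
  unfolding pairs_def by (rule continuous_map_fst_fibre_prod continuous_map_snd_fibre_prod)+

lemma lmom_comp_cont: "continuous_map (spc R) (obj M) (lmom R)"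
  by (rule continuous_map_from_comp[where g = "\<lambda>z. lmom P (fst z)"])
    (auto intro: continuous_map_compose_on[OF P.L.mom_cont pairs_fst] simp: lmom_cls)

lemma rmom_comp_cont: "continuous_map (spc R) (obj L) (rmom R)"
  by (rule continuous_map_from_comp[where g = "\<lambda>z. rmom Q (snd z)"])
    (auto intro: continuous_map_compose_on[OF Q.R.mom_cont pairs_snd] simp: rmom_cls)

text \<open>
  Over the domain of a local section \<open>\<sigma>\<close> of \<open>P\<close>, every class contains exactly one pair whose first
  component is a value of \<open>\<sigma>\<close>, because the right action on \<open>P\<close> is free and transitive on fibres.
  Choosing this pair is continuous on representatives, and it remains so on classes because a
  quotient map restricts to a quotient map over an open set.
\<close>
lemma cls_local_section:
  assumes z0: "z0 \<in> topspace (spc R)"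
  obtains W s where "openin (spc R) W" "z0 \<in> W"
    "continuous_map (subtopology (spc R) W) (pairs P Q) s" "\<And>z. z \<in> W \<Longrightarrow> c (s z) = z"
proof -
  have "lmom R z0 \<in> topspace (obj M)" using continuous_map_mem[OF lmom_comp_cont z0] .
  then obtain U \<sigma> where U: "openin (obj M) U" "lmom R z0 \<in> U"
    and \<sigma>: "continuous_map (subtopology (obj M) U) (spc P) \<sigma>"
      "\<And>u. u \<in> U \<Longrightarrow> \<sigma> u \<in> topspace (spc P)" "\<And>u. u \<in> U \<Longrightarrow> lmom P (\<sigma> u) = u"
    by (rule P.R.local_section) blast
  define W where "W = {z \<in> topspace (spc R). lmom R z \<in> U}"
  define V where "V = {w \<in> S. c w \<in> W}"
  define g where "g = (\<lambda>(p, q). (\<sigma> (lmom P p), lact Q (P.R.divn (\<sigma> (lmom P p)) p) q))"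
  define s where "s = descend S c g"
  have W: "openin (spc R) W"
    unfolding W_def by (rule openin_continuous_map_preimage[OF lmom_comp_cont U(1)])
  have V: "(p, q) \<in> V \<longleftrightarrow> (p, q) \<in> S \<and> lmom P p \<in> U" for p q
    by (auto simp: V_def W_def lmom_cls cls_in_comp)
  have VS: "V \<subseteq> S" by (auto simp: V_def)
  have n: "P.R.divn (\<sigma> (lmom P p)) p \<in> topspace (arr N)"
    "tgt N (P.R.divn (\<sigma> (lmom P p)) p) = rmom P (\<sigma> (lmom P p))"
    "src N (P.R.divn (\<sigma> (lmom P p)) p) = lmom Q q"
    "ract P (\<sigma> (lmom P p)) (P.R.divn (\<sigma> (lmom P p)) p) = p"
    if "(p, q) \<in> V" for p q
    using that \<sigma>(2,3)[of "lmom P p"] P.R.divn[of "\<sigma> (lmom P p)" p] by (auto simp: V mem_pairs)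
  \<comment> \<open>\<open>g\<close> is constant on classes since \<open>\<sigma>\<^sup>-\<^sup>1(p k) = (\<sigma>\<^sup>-\<^sup>1p) k\<close>\<close>
  have sg: "s (c (p, q)) = g (p, q)" if pq: "(p, q) \<in> V" for p q
    unfolding s_def
  proof (rule descend_cls)
    show "(p, q) \<in> S" using pq VS by blast
    then have p: "p \<in> topspace (spc P)" by (simp add: mem_pairs)
    fix k q' assume k: "k \<in> topspace (arr N)" "q' \<in> topspace (spc Q)" "rmom P p = tgt N k"
      "src N k = lmom Q q'" "q = lact Q k q'"
    let ?\<sigma> = "\<sigma> (lmom P p)"
    let ?n = "P.R.divn ?\<sigma> p"
    have s: "?\<sigma> \<in> topspace (spc P)" "lmom P ?\<sigma> = lmom P p" using \<sigma> pq V by auto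
    have nk: "src N ?n = tgt N k" using P.R.divn[OF s(1) p s(2)] k by simp
    have "ract P ?\<sigma> (mul N ?n k) = ract P p k"
      using n[OF pq] k nk s P.R.act_mul by simp
    then have "P.R.divn ?\<sigma> (ract P p k) = mul N ?n k"
      using n[OF pq] k nk s P.R.divn_act[of ?\<sigma> "mul N ?n k"]
      by (simp add: P.R.mul_arr P.R.src_tgt_simps)
    then show "g (ract P p k, q') = g (p, q)"
      using n[OF pq] k nk p by (simp add: g_def P.R.pr_act Q.L.act_mul)
  qed
  have V_fst: "continuous_map (subtopology (pairs P Q) V) (spc P) fst"
    and V_snd: "continuous_map (subtopology (pairs P Q) V) (spc Q) snd"
    by (intro continuous_map_from_subtopology pairs_fst pairs_snd)+
  have "continuous_map (subtopology (pairs P Q) V) (subtopology (obj M) U) (\<lambda>w. lmom P (fst w))"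
    unfolding continuous_map_in_subtopology
    using continuous_map_compose_on[OF P.L.mom_cont V_fst] V by auto
  then have s1: "continuous_map (subtopology (pairs P Q) V) (spc P) (\<lambda>w. \<sigma> (lmom P (fst w)))"
    by (rule continuous_map_compose_on[OF \<sigma>(1)])
  have s2: "continuous_map (subtopology (pairs P Q) V) (arr N) (\<lambda>w. P.R.divn (\<sigma> (lmom P (fst w))) (fst w))"
    by (rule continuous_map_on_fibre_prod[OF P.R.divn_cont s1 V_fst]) (use \<sigma>(3) V in auto)
  have s3: "continuous_map (subtopology (pairs P Q) V) (spc Q)
         (\<lambda>w. lact Q (P.R.divn (\<sigma> (lmom P (fst w))) (fst w)) (snd w))"
    by (rule continuous_map_on_fibre_prod[OF Q.L.act_cont s2 V_snd]) (use n V in auto)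
  have "continuous_map (subtopology (pairs P Q) V) (pairs P Q) g"
    unfolding pairs_def g_def case_prod_unfold
  proof (rule continuous_map_into_fibre_prod)
    show "rmom P (\<sigma> (lmom P (fst z))) =
        lmom Q (lact Q (P.R.divn (\<sigma> (lmom P (fst z))) (fst z)) (snd z))"
      if "z \<in> topspace (subtopology (fibre_prod (spc P) (rmom P) (spc Q) (lmom Q)) V)" for z
      using that n[of "fst z" "snd z"] Q.L.mom_act by (auto simp: topspace_fibre_prod)
  qed (use s1 s3 in \<open>simp_all add: pairs_def\<close>)
  then have "continuous_map (subtopology (pairs P Q) V) (pairs P Q) (s \<circ> c)"
    by (rule continuous_map_cong_on) (use sg VS in auto)
  moreover have "quotient_map (subtopology (pairs P Q) V) (subtopology (spc R) W) c"
    by (rule quotient_map_restriction[OF quotient_map_cls]) (use W V_def in auto)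
  ultimately have "continuous_map (subtopology (spc R) W) (pairs P Q) s"
    using continuous_compose_quotient_map by blast
  moreover have "c (s z) = z" if zW: "z \<in> W" for z
  proof -
    have "z \<in> topspace (spc R)" using zW by (simp add: W_def)
    then obtain p q where "z = c (p, q)" "(p, q) \<in> S" "q \<in> topspace (spc Q)"
      by (rule comp_cases)
    then have pq: "z = c (p, q)" "(p, q) \<in> V" "q \<in> topspace (spc Q)"
      using zW by (simp_all add: V_def)
    then have "c (s z) = c (g (p, q))" using sg by simp
    also have "\<dots> = c (ract P (\<sigma> (lmom P p)) (P.R.divn (\<sigma> (lmom P p)) p), q)"
      unfolding g_def prod.case using n[OF pq(2)] pq \<sigma>(2)[of "lmom P p"] V by (intro cls_balance[symmetric]) auto
    also have "\<dots> = z" using n[OF pq(2)] pq by simp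
    finally show ?thesis .
  qed
  moreover have "z0 \<in> W" using z0 U by (simp add: W_def)
  ultimately show thesis using that W by blast
qed

text \<open>
  This replaces the openness of the quotient map: to prove that a map from \<open>Z\<close> is continuous near a
  point, the classes \<open>a z\<close> on which it depends may be replaced by continuous representatives.
\<close>
lemma local_lift:
  assumes a: "continuous_map Z (spc R) a" and z0: "z0 \<in> topspace Z"
  obtains U p q where "openin Z U" "z0 \<in> U"
    "continuous_map (subtopology Z U) (spc P) p" "continuous_map (subtopology Z U) (spc Q) q"
    "\<And>z. z \<in> U \<Longrightarrow> (p z, q z) \<in> S" "\<And>z. z \<in> U \<Longrightarrow> c (p z, q z) = a z"
proof -
  obtain W s where W: "openin (spc R) W" "a z0 \<in> W"
    and s: "continuous_map (subtopology (spc R) W) (pairs P Q) s" "\<And>z. z \<in> W \<Longrightarrow> c (s z) = z"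
    by (rule cls_local_section[OF continuous_map_mem[OF a z0]]) blast
  define U where "U = {z \<in> topspace Z. a z \<in> W}"
  have U: "openin Z U" unfolding U_def by (rule openin_continuous_map_preimage[OF a W(1)])
  have "continuous_map (subtopology Z U) (subtopology (spc R) W) a"
    unfolding continuous_map_in_subtopology U_def
    using a by (auto intro: continuous_map_from_subtopology)
  then have sa: "continuous_map (subtopology Z U) (pairs P Q) (\<lambda>z. s (a z))"
    by (rule continuous_map_compose_on[OF s(1)])
  show thesis
  proof (rule that[OF U])
    show "z0 \<in> U" using z0 W U_def by simp
    show "continuous_map (subtopology Z U) (spc P) (\<lambda>z. fst (s (a z)))"
      by (rule continuous_map_compose_on[OF pairs_fst sa])
    show "continuous_map (subtopology Z U) (spc Q) (\<lambda>z. snd (s (a z)))"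
      by (rule continuous_map_compose_on[OF pairs_snd sa])
    fix z assume z: "z \<in> U"
    then show "(fst (s (a z)), snd (s (a z))) \<in> S"
      using continuous_map_mem[OF sa, of z] U_def by simp
    show "c (fst (s (a z)), snd (s (a z))) = a z" using s z U_def by simp
  qed
qed

section \<open>The composite is a generalized morphism\<close>

text \<open>
  If \<open>[p, q l] = [p, q k]\<close>, an element \<open>n\<close> that moves one pair to the other fixes \<open>p\<close>, so it is a
  unit by freeness on \<open>P\<close>, and freeness on \<open>Q\<close> applies to \<open>q l = q k\<close>.
\<close>
lemma ract_comp_inj:
  assumes "(p, q) \<in> S" "l \<in> topspace (arr L)" "k \<in> topspace (arr L)"
    "rmom Q q = tgt L l" "rmom Q q = tgt L k" "c (p, ract Q q l) = c (p, ract Q q k)"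
  shows "l = k"
proof -
  have "(p, ract Q q l) \<in> S" "(p, ract Q q k) \<in> S" using assms mem_pairs_ract by blast+
  then obtain n where n: "n \<in> topspace (arr N)" "rmom P p = tgt N n" "src N n = lmom Q (ract Q q k)"
    "p = ract P p n" "ract Q q l = lact Q n (ract Q q k)"
    using cls_eq_iff assms(6) by blast
  have pq: "p \<in> topspace (spc P)" "q \<in> topspace (spc Q)" "rmom P p = lmom Q q"
    using assms mem_pairs by auto
  have qk: "ract Q q k \<in> topspace (spc Q)" "lmom Q (ract Q q k) = lmom Q q"
    using pq assms Q.R.act_spc Q.R.pr_act by auto
  have "n = one N (rmom P p)" using P.R.act_free n pq by metis
  then have "ract Q q l = ract Q q k" using n(5) Q.L.act_one[OF qk(1)] qk pq by simp
  then show ?thesis using Q.R.act_inj pq assms by blast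
qed

definition comp_divn :: "'u \<Rightarrow> 'u \<Rightarrow> 'u" where
  "comp_divn z w = (SOME l. l \<in> topspace (arr L) \<and> rmom R z = tgt L l \<and> ract R z l = w)"

text \<open>
  With \<open>n = p\<^sup>-\<^sup>1p'\<close> one has \<open>[p', q'] = [p n, q'] = [p, n q']\<close>, so that the division in the
  composite is the one between \<open>q\<close> and \<open>n q'\<close> in \<open>Q\<close>.
\<close>
lemma comp_divn_cls:
  assumes pq: "(p, q) \<in> S" and pq': "(p', q') \<in> S" and eq: "lmom P p = lmom P p'"
  defines "n \<equiv> P.R.divn p p'"
  shows "n \<in> topspace (arr N)" "src N n = lmom Q q'" "lmom Q q = lmom Q (lact Q n q')"
    "rmom Q q = tgt L (comp_divn (c (p, q)) (c (p', q')))"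
    "ract R (c (p, q)) (comp_divn (c (p, q)) (c (p', q'))) = c (p', q')"
    "comp_divn (c (p, q)) (c (p', q')) = Q.R.divn q (lact Q n q')"
proof -
  have p: "p \<in> topspace (spc P)" "p' \<in> topspace (spc P)" "q \<in> topspace (spc Q)" "q' \<in> topspace (spc Q)"
    "rmom P p = lmom Q q" "rmom P p' = lmom Q q'"
    using pq pq' mem_pairs by auto
  show n1: "n \<in> topspace (arr N)" and n2: "src N n = lmom Q q'"
    unfolding n_def using P.R.divn[OF p(1,2) eq] p by auto
  have n3: "tgt N n = rmom P p" "ract P p n = p'"
    unfolding n_def using P.R.divn[OF p(1,2) eq] by auto
  show n4: "lmom Q q = lmom Q (lact Q n q')" using Q.L.mom_act n1 n2 n3 p by simp
  have nq: "lact Q n q' \<in> topspace (spc Q)" using Q.L.act_spc n1 n2 p by simp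
  define l where "l = Q.R.divn q (lact Q n q')"
  have l: "l \<in> topspace (arr L)" "rmom Q q = tgt L l" "ract Q q l = lact Q n q'"
    unfolding l_def using Q.R.divn[OF p(3) nq n4] by auto
  have act: "ract R (c (p, q)) l = c (p', q')"
    using ract_cls[OF pq l(1,2)] l(3) cls_balance[of p n q'] n1 n2 n3 p by simp
  have "comp_divn (c (p, q)) (c (p', q')) = l"
    unfolding comp_divn_def
  proof (rule some_equality)
    fix k assume k: "k \<in> topspace (arr L) \<and> rmom R (c (p, q)) = tgt L k \<and> ract R (c (p, q)) k = c (p', q')"
    then have "rmom Q q = tgt L k" using rmom_cls[OF pq] by simp
    then show "k = l" using k act ract_cls[OF pq] l ract_comp_inj[OF pq] by metis
  qed (use l act rmom_cls[OF pq] in simp)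
  then show "rmom Q q = tgt L (comp_divn (c (p, q)) (c (p', q')))"
    "ract R (c (p, q)) (comp_divn (c (p, q)) (c (p', q'))) = c (p', q')"
    "comp_divn (c (p, q)) (c (p', q')) = Q.R.divn q (lact Q n q')"
    using l act l_def by auto
qed

lemma comp_divn_cont: "continuous_map (fibre_prod (spc R) (lmom R) (spc R) (lmom R)) (arr L) (\<lambda>(z, w). comp_divn z w)"
proof (rule continuous_map_if_locally)
  let ?Z = "fibre_prod (spc R) (lmom R) (spc R) (lmom R)"
  fix z0 assume z0: "z0 \<in> topspace ?Z"
  obtain U p q where U: "openin ?Z U" "z0 \<in> U"
    and pq: "continuous_map (subtopology ?Z U) (spc P) p" "continuous_map (subtopology ?Z U) (spc Q) q"
      "\<And>z. z \<in> U \<Longrightarrow> (p z, q z) \<in> S" "\<And>z. z \<in> U \<Longrightarrow> c (p z, q z) = fst z"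
    by (rule local_lift[OF continuous_map_fst_fibre_prod z0]) blast
  obtain V p' q' where V: "openin ?Z V" "z0 \<in> V"
    and pq': "continuous_map (subtopology ?Z V) (spc P) p'" "continuous_map (subtopology ?Z V) (spc Q) q'"
      "\<And>z. z \<in> V \<Longrightarrow> (p' z, q' z) \<in> S" "\<And>z. z \<in> V \<Longrightarrow> c (p' z, q' z) = snd z"
    by (rule local_lift[OF continuous_map_snd_fibre_prod z0]) blast
  let ?W = "subtopology ?Z (U \<inter> V)"
  have cont: "continuous_map ?W (spc P) p" "continuous_map ?W (spc Q) q"
      "continuous_map ?W (spc P) p'" "continuous_map ?W (spc Q) q'"
    using pq(1,2) pq'(1,2) by (auto intro: continuous_map_from_subtopology_mono)
  have eq: "lmom P (p z) = lmom P (p' z)" if "z \<in> topspace ?W" for z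
    using that lmom_cls[OF pq(3)] lmom_cls[OF pq'(3)] pq(4) pq'(4)
    by (auto simp: topspace_fibre_prod)
  have mem: "(p z, q z) \<in> S" "(p' z, q' z) \<in> S" if "z \<in> topspace ?W" for z
    using that pq(3) pq'(3) by auto
  note d = comp_divn_cls[OF mem eq]
  have 1: "continuous_map ?W (arr N) (\<lambda>z. P.R.divn (p z) (p' z))"
    by (rule continuous_map_on_fibre_prod[OF P.R.divn_cont cont(1,3)]) (rule eq)
  have 2: "continuous_map ?W (spc Q) (\<lambda>z. lact Q (P.R.divn (p z) (p' z)) (q' z))"
    by (rule continuous_map_on_fibre_prod[OF Q.L.act_cont 1 cont(4)]) (rule d(2))
  have 3: "continuous_map ?W (arr L) (\<lambda>z. Q.R.divn (q z) (lact Q (P.R.divn (p z) (p' z)) (q' z)))"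
    by (rule continuous_map_on_fibre_prod[OF Q.R.divn_cont cont(2) 2]) (rule d(3))
  have "continuous_map ?W (arr L) (\<lambda>(z, w). comp_divn z w)"
  proof (rule continuous_map_cong_on[OF 3])
    fix z assume z: "z \<in> topspace ?W"
    then have "c (p z, q z) = fst z" "c (p' z, q' z) = snd z" using pq(4) pq'(4) by auto
    then show "Q.R.divn (q z) (lact Q (P.R.divn (p z) (p' z)) (q' z)) = (\<lambda>(z, w). comp_divn z w) z"
      using d(6)[OF z z z] by (simp add: case_prod_unfold)
  qed
  then show "\<exists>W. openin ?Z W \<and> z0 \<in> W \<and> continuous_map (subtopology ?Z W) (arr L) (\<lambda>(z, w). comp_divn z w)"
    using U V by blast
qed

lemma lact_comp_cont:
  "continuous_map (fibre_prod (arr M) (src M) (spc R) (lmom R)) (spc R) (\<lambda>(m, z). lact R m z)"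
proof (rule continuous_map_if_locally)
  let ?Z = "fibre_prod (arr M) (src M) (spc R) (lmom R)"
  fix z0 assume z0: "z0 \<in> topspace ?Z"
  obtain U p q where U: "openin ?Z U" "z0 \<in> U"
    and pq: "continuous_map (subtopology ?Z U) (spc P) p" "continuous_map (subtopology ?Z U) (spc Q) q"
      "\<And>z. z \<in> U \<Longrightarrow> (p z, q z) \<in> S" "\<And>z. z \<in> U \<Longrightarrow> c (p z, q z) = snd z"
    by (rule local_lift[OF continuous_map_snd_fibre_prod z0]) blast
  let ?W = "subtopology ?Z U"
  have m: "continuous_map ?W (arr M) fst"
    by (intro continuous_map_from_subtopology continuous_map_fst_fibre_prod)
  have eq: "fst z \<in> topspace (arr M)" "src M (fst z) = lmom P (p z)" "(p z, q z) \<in> S" "c (p z, q z) = snd z"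
    if "z \<in> topspace ?W" for z
    using that pq(3,4) lmom_cls[OF pq(3)] by (auto simp: topspace_fibre_prod)
  have 1: "continuous_map ?W (spc P) (\<lambda>z. lact P (fst z) (p z))"
    by (rule continuous_map_on_fibre_prod[OF P.L.act_cont m pq(1)]) (rule eq(2))
  have 2: "continuous_map ?W (spc R) (\<lambda>z. c (lact P (fst z) (p z), q z))"
    by (rule continuous_map_cls[OF 1 pq(2)]) (use mem_pairs_lact mem_pairs eq in blast)
  have "continuous_map ?W (spc R) (\<lambda>(m, z). lact R m z)"
  proof (rule continuous_map_cong_on[OF 2])
    fix z assume z: "z \<in> topspace ?W"
    show "c (lact P (fst z) (p z), q z) = (\<lambda>(m, z). lact R m z) z"
      using lact_cls[of "p z" "q z" "fst z"] eq[OF z] by (simp add: case_prod_unfold)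
  qed
  then show "\<exists>W. openin ?Z W \<and> z0 \<in> W \<and> continuous_map (subtopology ?Z W) (spc R) (\<lambda>(m, z). lact R m z)"
    using U by blast
qed

lemma ract_comp_cont:
  "continuous_map (fibre_prod (spc R) (rmom R) (arr L) (tgt L)) (spc R) (\<lambda>(z, l). ract R z l)"
proof (rule continuous_map_if_locally)
  let ?Z = "fibre_prod (spc R) (rmom R) (arr L) (tgt L)"
  fix z0 assume z0: "z0 \<in> topspace ?Z"
  obtain U p q where U: "openin ?Z U" "z0 \<in> U"
    and pq: "continuous_map (subtopology ?Z U) (spc P) p" "continuous_map (subtopology ?Z U) (spc Q) q"
      "\<And>z. z \<in> U \<Longrightarrow> (p z, q z) \<in> S" "\<And>z. z \<in> U \<Longrightarrow> c (p z, q z) = fst z"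
    by (rule local_lift[OF continuous_map_fst_fibre_prod z0]) blast
  let ?W = "subtopology ?Z U"
  have l: "continuous_map ?W (arr L) snd"
    by (intro continuous_map_from_subtopology continuous_map_snd_fibre_prod)
  have eq: "snd z \<in> topspace (arr L)" "rmom Q (q z) = tgt L (snd z)" "(p z, q z) \<in> S" "c (p z, q z) = fst z"
    if "z \<in> topspace ?W" for z
    using that pq(3,4) rmom_cls[OF pq(3)] by (auto simp: topspace_fibre_prod)
  have 1: "continuous_map ?W (spc Q) (\<lambda>z. ract Q (q z) (snd z))"
    by (rule continuous_map_on_fibre_prod[OF Q.R.act_cont pq(2) l]) (rule eq(2))
  have 2: "continuous_map ?W (spc R) (\<lambda>z. c (p z, ract Q (q z) (snd z)))"
    by (rule continuous_map_cls[OF pq(1) 1]) (use mem_pairs_ract mem_pairs eq in blast)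
  have "continuous_map ?W (spc R) (\<lambda>(z, l). ract R z l)"
  proof (rule continuous_map_cong_on[OF 2])
    fix z assume z: "z \<in> topspace ?W"
    show "c (p z, ract Q (q z) (snd z)) = (\<lambda>(z, l). ract R z l) z"
      using ract_cls[of "p z" "q z" "snd z"] eq[OF z] by (simp add: case_prod_unfold)
  qed
  then show "\<exists>W. openin ?Z W \<and> z0 \<in> W \<and> continuous_map (subtopology ?Z W) (spc R) (\<lambda>(z, l). ract R z l)"
    using U by blast
qed

lemma comp_ext:
  "lmom R \<in> extensional (topspace (spc R))" "rmom R \<in> extensional (topspace (spc R))"
  "(\<lambda>(m, z). lact R m z) \<in> extensional (topspace (fibre_prod (arr M) (src M) (spc R) (lmom R)))"
  "(\<lambda>(z, l). ract R z l) \<in> extensional (topspace (fibre_prod (spc R) (rmom R) (arr L) (tgt L)))"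
  unfolding topspace_fibre_prod topspace_comp extensional_def
  by (auto simp: comp_gen_mor_def Let_def descend_def)

lemma left_action_comp: "left_action M (spc R) (lmom R) (lact R)"
proof (intro left_action.intro left_action_axioms.intro)
  show "topological_groupoid M" by (rule P.L.topological_groupoid_axioms)
  fix g z assume g: "g \<in> topspace (arr M)" and z: "z \<in> topspace (spc R)" and gz: "src M g = lmom R z"
  obtain p q where pq: "z = c (p, q)" "(p, q) \<in> S" "p \<in> topspace (spc P)" using z by (rule comp_cases)
  then show "lmom R (lact R g z) = tgt M g"
    using g gz by (simp add: lmom_cls lact_cls mem_pairs_lact P.L.mom_act)
next
  fix g f z assume g: "g \<in> topspace (arr M)" "f \<in> topspace (arr M)" and z: "z \<in> topspace (spc R)"
    and gf: "src M g = tgt M f" and fz: "src M f = lmom R z"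
  obtain p q where pq: "z = c (p, q)" "(p, q) \<in> S" "p \<in> topspace (spc P)" using z by (rule comp_cases)
  then show "lact R (mul M g f) z = lact R g (lact R f z)"
    using g gf fz
    by (simp add: lmom_cls lact_cls mem_pairs_lact P.L.mom_act P.L.act_mul P.L.mul_arr P.L.src_mul)
next
  fix z assume z: "z \<in> topspace (spc R)"
  obtain p q where pq: "z = c (p, q)" "(p, q) \<in> S" "p \<in> topspace (spc P)" using z by (rule comp_cases)
  then show "lact R (one M (lmom R z)) z = z"
    by (simp add: lmom_cls lact_cls P.L.act_one P.L.one_arr P.L.mom_obj P.L.src_one)
qed (rule lmom_comp_cont lact_comp_cont comp_ext)+

lemma right_action_comp: "right_action L (spc R) (rmom R) (ract R)"
proof (intro right_action.intro right_action_axioms.intro)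
  show "topological_groupoid L" by (rule Q.R.topological_groupoid_axioms)
  fix z g assume z: "z \<in> topspace (spc R)" and g: "g \<in> topspace (arr L)" and gz: "rmom R z = tgt L g"
  obtain p q where pq: "z = c (p, q)" "(p, q) \<in> S" "q \<in> topspace (spc Q)" using z by (rule comp_cases)
  then show "rmom R (ract R z g) = src L g"
    using g gz by (simp add: rmom_cls ract_cls mem_pairs_ract Q.R.mom_act)
next
  fix z g f assume z: "z \<in> topspace (spc R)" and g: "g \<in> topspace (arr L)" "f \<in> topspace (arr L)"
    and gz: "rmom R z = tgt L g" and gf: "src L g = tgt L f"
  obtain p q where pq: "z = c (p, q)" "(p, q) \<in> S" "q \<in> topspace (spc Q)" using z by (rule comp_cases)
  then show "ract R z (mul L g f) = ract R (ract R z g) f"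
    using g gf gz
    by (simp add: rmom_cls ract_cls mem_pairs_ract Q.R.mom_act Q.R.act_mul Q.R.mul_arr Q.R.tgt_mul)
next
  fix z assume z: "z \<in> topspace (spc R)"
  obtain p q where pq: "z = c (p, q)" "(p, q) \<in> S" "q \<in> topspace (spc Q)" using z by (rule comp_cases)
  then show "ract R z (one L (rmom R z)) = z"
    by (simp add: rmom_cls ract_cls Q.R.act_one Q.R.one_arr Q.R.mom_obj Q.R.tgt_one)
qed (rule rmom_comp_cont ract_comp_cont comp_ext)+

text \<open>
  A section of \<open>P\<close> is paired with a section of \<open>Q\<close> over the image of the first under the right
  moment map.
\<close>
lemma comp_sections:
  assumes x: "x \<in> topspace (obj M)"
  shows "\<exists>U s. openin (obj M) U \<and> x \<in> U \<and> continuous_map (subtopology (obj M) U) (spc R) s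
            \<and> (\<forall>u\<in>U. lmom R (s u) = u)"
proof -
  obtain U p where U: "openin (obj M) U" "x \<in> U"
    and p: "continuous_map (subtopology (obj M) U) (spc P) p"
      "\<And>u. u \<in> U \<Longrightarrow> p u \<in> topspace (spc P)" "\<And>u. u \<in> U \<Longrightarrow> lmom P (p u) = u"
    by (rule P.R.local_section[OF x]) blast
  have "rmom P (p x) \<in> topspace (obj N)" using P.R.mom_obj p U by blast
  then obtain V q where V: "openin (obj N) V" "rmom P (p x) \<in> V"
    and q: "continuous_map (subtopology (obj N) V) (spc Q) q"
      "\<And>u. u \<in> V \<Longrightarrow> q u \<in> topspace (spc Q)" "\<And>u. u \<in> V \<Longrightarrow> lmom Q (q u) = u"
    by (rule Q.R.local_section) blast
  have rp: "continuous_map (subtopology (obj M) U) (obj N) (\<lambda>u. rmom P (p u))"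
    by (rule continuous_map_compose_on[OF P.R.mom_cont p(1)])
  define W where "W = {u \<in> U. rmom P (p u) \<in> V}"
  have "W = {u \<in> topspace (subtopology (obj M) U). rmom P (p u) \<in> V}"
    using openin_subset[OF U(1)] by (auto simp: W_def)
  then have "openin (subtopology (obj M) U) W"
    using openin_continuous_map_preimage[OF rp V(1)] by simp
  then have W: "openin (obj M) W" using openin_trans_full U(1) by blast
  have WU: "W \<subseteq> U" by (auto simp: W_def)
  have pW: "continuous_map (subtopology (obj M) W) (spc P) p"
    using p(1) WU by (rule continuous_map_from_subtopology_mono)
  have rW: "continuous_map (subtopology (obj M) W) (subtopology (obj N) V) (\<lambda>u. rmom P (p u))"
    unfolding continuous_map_in_subtopology
    using continuous_map_from_subtopology_mono[OF rp WU] by (auto simp: W_def)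
  have "continuous_map (subtopology (obj M) W) (spc R) (\<lambda>u. c (p u, q (rmom P (p u))))"
    by (rule continuous_map_cls[OF pW continuous_map_compose_on[OF q(1) rW]]) (use q(3) in \<open>auto simp: W_def\<close>)
  moreover have "lmom R (c (p u, q (rmom P (p u)))) = u" if "u \<in> W" for u
  proof -
    have "(p u, q (rmom P (p u))) \<in> S" using that p(2) q(2,3) by (auto simp: W_def mem_pairs)
    then show ?thesis using lmom_cls p(3) that WU by auto
  qed
  ultimately show ?thesis
    using W U(2) V(2) unfolding W_def by blast
qed

lemma principal_bundle_comp: "principal_bundle L (spc R) (obj M) (lmom R) (rmom R) (ract R)"
proof (rule right_action.principal_bundle_if_division[OF right_action_comp lmom_comp_cont])
  show "lmom R ` topspace (spc R) = topspace (obj M)"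
  proof
    show "lmom R ` topspace (spc R) \<subseteq> topspace (obj M)"
      using continuous_map_mem[OF lmom_comp_cont] by blast
    show "topspace (obj M) \<subseteq> lmom R ` topspace (spc R)"
    proof
      fix x assume x: "x \<in> topspace (obj M)"
      then have "x \<in> lmom P ` topspace (spc P)" by (simp add: P.R.pr_surj)
      then obtain p where p: "p \<in> topspace (spc P)" "lmom P p = x" by auto
      have "rmom P p \<in> lmom Q ` topspace (spc Q)" using P.R.mom_obj[OF p(1)] by (simp add: Q.R.pr_surj)
      then obtain q where q: "q \<in> topspace (spc Q)" "lmom Q q = rmom P p" by auto
      have "(p, q) \<in> S" using p q by (simp add: mem_pairs)
      then show "x \<in> lmom R ` topspace (spc R)"
        using lmom_cls cls_in_comp p(2) by (intro image_eqI[of _ _ "c (p, q)"]) auto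
    qed
  qed
next
  fix z n assume z: "z \<in> topspace (spc R)" and n: "n \<in> topspace (arr L)" and zn: "rmom R z = tgt L n"
  obtain p q where pq: "z = c (p, q)" "(p, q) \<in> S" "q \<in> topspace (spc Q)" using z by (rule comp_cases)
  then show "lmom R (ract R z n) = lmom R z"
    using n zn by (simp add: rmom_cls ract_cls lmom_cls mem_pairs_ract)
  assume "ract R z n = z"
  then have "c (p, ract Q q n) = c (p, q)" using pq n zn by (simp add: rmom_cls ract_cls)
  also have "\<dots> = c (p, ract Q q (one L (rmom Q q)))" using pq Q.R.act_one by simp
  finally have "n = one L (rmom Q q)"
    using ract_comp_inj[OF pq(2) n, of "one L (rmom Q q)"] zn pq
    by (simp add: rmom_cls Q.R.one_arr Q.R.tgt_obj Q.R.tgt_one n)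
  then show "n = one L (rmom R z)" using pq rmom_cls by simp
next
  show "continuous_map (fibre_prod (spc R) (lmom R) (spc R) (lmom R)) (arr L) (\<lambda>(z, w). comp_divn z w)"
    by (rule comp_divn_cont)
next
  fix z w assume z: "z \<in> topspace (spc R)" and w: "w \<in> topspace (spc R)" and zw: "lmom R z = lmom R w"
  obtain p q where pq: "z = c (p, q)" "(p, q) \<in> S" using z by (rule comp_cases)
  obtain p' q' where pq': "w = c (p', q')" "(p', q') \<in> S" using w by (rule comp_cases)
  have "lmom P p = lmom P p'" using zw pq pq' lmom_cls by simp
  then show "rmom R z = tgt L (comp_divn z w) \<and> ract R z (comp_divn z w) = w"
    using comp_divn_cls(4,5)[OF pq(2) pq'(2)] pq pq' rmom_cls by simp
qed (rule comp_sections)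

lemma generalized_morphism_comp: "generalized_morphism M L R"
proof (intro generalized_morphism.intro generalized_morphism_axioms.intro left_action_comp principal_bundle_comp)
  fix m z assume m: "m \<in> topspace (arr M)" and z: "z \<in> topspace (spc R)" and mz: "src M m = lmom R z"
  obtain p q where pq: "z = c (p, q)" "(p, q) \<in> S" using z by (rule comp_cases)
  then show "rmom R (lact R m z) = rmom R z"
    using m mz by (simp add: rmom_cls lact_cls lmom_cls mem_pairs_lact)
  fix l assume l: "l \<in> topspace (arr L)" and zl: "rmom R z = tgt L l"
  then show "ract R (lact R m z) l = lact R m (ract R z l)"
    using m mz pq by (simp add: rmom_cls lact_cls lmom_cls ract_cls mem_pairs_lact mem_pairs_ract)
qed

end

section \<open>The unit generalized morphism\<close>

context topological_groupoid begin

lemma left_action_unit: "left_action G (arr G) (tgt G) (mul G)"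
  by (intro left_action.intro left_action_axioms.intro topological_groupoid_axioms)
    (auto simp: tgt_cont mul_cont tgt_mul mul_assoc one_mul tgt_ext mul_ext)

lemma right_action_unit: "right_action G (arr G) (src G) (mul G)"
  by (intro right_action.intro right_action_axioms.intro topological_groupoid_axioms)
    (auto simp: src_cont mul_cont src_mul mul_assoc mul_one src_ext mul_ext)

text \<open>
  The unit bundle has the global section \<open>x \<mapsto> 1\<^sub>x\<close> and the division \<open>g\<^sup>-\<^sup>1f\<close>.
\<close>
lemma principal_bundle_unit: "principal_bundle G (arr G) (obj G) (tgt G) (src G) (mul G)"
proof (rule right_action.principal_bundle_if_division[OF right_action_unit tgt_cont])
  have "x \<in> tgt G ` topspace (arr G)" if "x \<in> topspace (obj G)" for x
    using that one_arr tgt_one by (intro image_eqI[of _ _ "one G x"]) auto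
  then show "tgt G ` topspace (arr G) = topspace (obj G)"
    using tgt_obj by blast
  have "continuous_map (fibre_prod (arr G) (tgt G) (arr G) (tgt G)) (arr G)
          (\<lambda>z. mul G (ginv G (fst z)) (snd z))"
    by (rule continuous_map_on_fibre_prod[OF mul_cont
          continuous_map_compose_on[OF ginv_cont continuous_map_fst_fibre_prod] continuous_map_snd_fibre_prod])
      (auto simp: topspace_fibre_prod src_ginv)
  then show "continuous_map (fibre_prod (arr G) (tgt G) (arr G) (tgt G)) (arr G)
               (\<lambda>(g, f). mul G (ginv G g) f)"
    by (simp add: case_prod_unfold)
  show "n = one G (src G p)"
    if "p \<in> topspace (arr G)" "n \<in> topspace (arr G)" "src G p = tgt G n" "mul G p n = p" for p n
    using mul_right_unit that by blast
  show "src G p = tgt G (mul G (ginv G p) q) \<and> mul G p (mul G (ginv G p) q) = q"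
    if "p \<in> topspace (arr G)" "q \<in> topspace (arr G)" "tgt G p = tgt G q" for p q
    using that by (simp add: mul_ginv_cancel_left tgt_mul ginv_arr src_ginv tgt_ginv)
  show "\<exists>U s. openin (obj G) U \<and> x \<in> U \<and> continuous_map (subtopology (obj G) U) (arr G) s
          \<and> (\<forall>u\<in>U. tgt G (s u) = u)" if "x \<in> topspace (obj G)" for x
    using that one_cont by (intro exI[of _ "topspace (obj G)"] exI[of _ "one G"]) (auto simp: tgt_one)
qed (simp add: tgt_mul)

lemma generalized_morphism_unit: "generalized_morphism G G (unit_gen_mor G)"
  unfolding unit_gen_mor_def
  by (intro generalized_morphism.intro generalized_morphism_axioms.intro)
    (auto simp: left_action_unit principal_bundle_unit src_mul mul_assoc)

end

section \<open>Equivariant maps\<close>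

locale equivariant_map =
  P: generalized_morphism M N P + Q: generalized_morphism M N Q
  for M N :: "'u groupoid" and P Q :: "'u gen_mor" and f :: "'u \<Rightarrow> 'u" +
  assumes cont: "continuous_map (spc P) (spc Q) f"
    and lmom_map: "p \<in> topspace (spc P) \<Longrightarrow> lmom Q (f p) = lmom P p"
    and rmom_map: "p \<in> topspace (spc P) \<Longrightarrow> rmom Q (f p) = rmom P p"
    and lact_map: "\<lbrakk>m \<in> topspace (arr M); p \<in> topspace (spc P); src M m = lmom P p\<rbrakk>
                    \<Longrightarrow> f (lact P m p) = lact Q m (f p)"
    and ract_map: "\<lbrakk>p \<in> topspace (spc P); n \<in> topspace (arr N); rmom P p = tgt N n\<rbrakk>
                    \<Longrightarrow> f (ract P p n) = ract Q (f p) n"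
    and ext: "f \<in> extensional (topspace (spc P))"
begin

lemma mem: "p \<in> topspace (spc P) \<Longrightarrow> f p \<in> topspace (spc Q)"
  using cont by (rule continuous_map_mem)

lemma inj: "inj_on f (topspace (spc P))"
proof (rule inj_onI)
  fix p p' assume p: "p \<in> topspace (spc P)" "p' \<in> topspace (spc P)" and eq: "f p = f p'"
  let ?n = "P.R.divn p p'"
  have "lmom P p = lmom P p'" using lmom_map p eq by metis
  note n = P.R.divn[OF p this]
  have "ract Q (f p) ?n = f p" using ract_map[of p ?n] n p eq by simp
  then have "?n = one N (rmom P p)" using Q.R.act_free[of "f p" ?n] n mem p rmom_map by simp
  then show "p = p'" using n P.R.act_one p by simp
qed

lemma surj: "f ` topspace (spc P) = topspace (spc Q)"
proof
  show "f ` topspace (spc P) \<subseteq> topspace (spc Q)" using mem by blast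
  show "topspace (spc Q) \<subseteq> f ` topspace (spc P)"
  proof
    fix q assume q: "q \<in> topspace (spc Q)"
    then have "lmom Q q \<in> lmom P ` topspace (spc P)" using Q.L.mom_obj P.R.pr_surj by simp
    then obtain p where p: "p \<in> topspace (spc P)" "lmom Q q = lmom P p" by auto
    let ?n = "Q.R.divn (f p) q"
    have n: "?n \<in> topspace (arr N)" "tgt N ?n = rmom P p" "ract Q (f p) ?n = q"
      using Q.R.divn[OF mem[OF p(1)] q] lmom_map rmom_map p by simp_all
    then have "q = f (ract P p ?n)" using ract_map[of p ?n] p by simp
    then show "q \<in> f ` topspace (spc P)" using P.R.act_spc p n by simp
  qed
qed

text \<open>
  Bijectivity is the usual argument on the fibres of principal bundles. Near a given point the
  inverse is \<open>q \<mapsto> \<sigma>(x) (f(\<sigma> x)\<^sup>-\<^sup>1q)\<close>, where \<open>\<sigma>\<close> is a local section of \<open>P\<close> and \<open>x\<close> is the left moment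
  of \<open>q\<close>; this is continuous because the division of \<open>Q\<close> is.
\<close>
lemma inverse:
  obtains g where "equivariant_map M N Q P g" "\<And>p. p \<in> topspace (spc P) \<Longrightarrow> g (f p) = p"
    "\<And>q. q \<in> topspace (spc Q) \<Longrightarrow> f (g q) = q"
proof -
  define g where "g = restrict (inv_into (topspace (spc P)) f) (topspace (spc Q))"
  have gf: "g (f p) = p" if "p \<in> topspace (spc P)" for p
    using that inj mem by (simp add: g_def)
  have fg: "f (g q) = q" and gP: "g q \<in> topspace (spc P)" if "q \<in> topspace (spc Q)" for q
    using that surj by (simp_all add: g_def f_inv_into_f inv_into_into)
  have lg: "lmom P (g q) = lmom Q q" and rg: "rmom P (g q) = rmom Q q" if "q \<in> topspace (spc Q)" for q
    using lmom_map[OF gP[OF that]] rmom_map[OF gP[OF that]] fg[OF that] by auto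
  have cont_g: "continuous_map (spc Q) (spc P) g"
  proof (rule continuous_map_if_locally)
    fix q0 assume q0: "q0 \<in> topspace (spc Q)"
    obtain U \<sigma> where U: "openin (obj M) U" "lmom Q q0 \<in> U"
      and \<sigma>: "continuous_map (subtopology (obj M) U) (spc P) \<sigma>"
        "\<And>u. u \<in> U \<Longrightarrow> \<sigma> u \<in> topspace (spc P)" "\<And>u. u \<in> U \<Longrightarrow> lmom P (\<sigma> u) = u"
      by (rule P.R.local_section[OF Q.L.mom_obj[OF q0]]) blast
    define W where "W = {q \<in> topspace (spc Q). lmom Q q \<in> U}"
    let ?W = "subtopology (spc Q) W"
    have W: "openin (spc Q) W"
      unfolding W_def by (rule openin_continuous_map_preimage[OF Q.L.mom_cont U(1)])
    have "continuous_map ?W (subtopology (obj M) U) (lmom Q)"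
      unfolding continuous_map_in_subtopology
      by (auto intro: continuous_map_from_subtopology Q.L.mom_cont simp: W_def)
    then have s: "continuous_map ?W (spc P) (\<lambda>q. \<sigma> (lmom Q q))"
      by (rule continuous_map_compose_on[OF \<sigma>(1)])
    have fs: "continuous_map ?W (spc Q) (\<lambda>q. f (\<sigma> (lmom Q q)))"
      by (rule continuous_map_compose_on[OF cont s])
    have id: "continuous_map ?W (spc Q) (\<lambda>q. q)"
      by (rule continuous_map_from_subtopology) (simp add: continuous_map_id[unfolded id_def])
    have q: "q \<in> topspace (spc Q)" "\<sigma> (lmom Q q) \<in> topspace (spc P)" "lmom P (\<sigma> (lmom Q q)) = lmom Q q"
      if "q \<in> topspace ?W" for q
      using that \<sigma>(2,3) by (auto simp: W_def)
    have eq: "lmom Q (f (\<sigma> (lmom Q q))) = lmom Q q" if "q \<in> topspace ?W" for q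
      using lmom_map q that by metis
    note n = Q.R.divn[OF mem[OF q(2)] q(1) eq]
    have d: "continuous_map ?W (arr N) (\<lambda>q. Q.R.divn (f (\<sigma> (lmom Q q))) q)"
      by (rule continuous_map_on_fibre_prod[OF Q.R.divn_cont fs id]) (rule eq)
    have r: "rmom P (\<sigma> (lmom Q q)) = tgt N (Q.R.divn (f (\<sigma> (lmom Q q))) q)" if "q \<in> topspace ?W" for q
      using n(2)[OF that that that] rmom_map[OF q(2)[OF that]] by simp
    have 1: "continuous_map ?W (spc P) (\<lambda>q. ract P (\<sigma> (lmom Q q)) (Q.R.divn (f (\<sigma> (lmom Q q))) q))"
      by (rule continuous_map_on_fibre_prod[OF P.R.act_cont s d]) (rule r)
    have "continuous_map ?W (spc P) g"
    proof (rule continuous_map_cong_on[OF 1])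
      fix q' assume z: "q' \<in> topspace ?W"
      let ?p = "ract P (\<sigma> (lmom Q q')) (Q.R.divn (f (\<sigma> (lmom Q q'))) q')"
      have "f ?p = q'" using ract_map[OF q(2)[OF z] n(1)[OF z z z] r[OF z]] n(3)[OF z z z] by simp
      moreover have "?p \<in> topspace (spc P)" using P.R.act_spc[OF q(2)[OF z] n(1)[OF z z z] r[OF z]] .
      ultimately show "?p = g q'" using gf by metis
    qed
    then show "\<exists>W. openin (spc Q) W \<and> q0 \<in> W \<and> continuous_map (subtopology (spc Q) W) (spc P) g"
      using W q0 U(2) W_def by blast
  qed
  have "equivariant_map M N Q P g"
  proof (intro equivariant_map.intro equivariant_map_axioms.intro)
    show "g (lact Q m q) = lact P m (g q)"
      if "m \<in> topspace (arr M)" "q \<in> topspace (spc Q)" "src M m = lmom Q q" for m q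
    proof -
      have "f (lact P m (g q)) = lact Q m q" using that lact_map gP lg fg by simp
      then show ?thesis using gf[of "lact P m (g q)"] P.L.act_spc that gP lg by simp
    qed
    show "g (ract Q q n) = ract P (g q) n"
      if "q \<in> topspace (spc Q)" "n \<in> topspace (arr N)" "rmom Q q = tgt N n" for q n
    proof -
      have "f (ract P (g q) n) = ract Q q n" using that ract_map gP rg fg by simp
      then show ?thesis using gf[of "ract P (g q) n"] P.R.act_spc that gP rg by simp
    qed
    show "g \<in> extensional (topspace (spc Q))" by (simp add: g_def)
  qed (use P.generalized_morphism_axioms Q.generalized_morphism_axioms cont_g lg rg in simp_all)
  then show thesis using that gf fg by blast
qed

end

lemma (in generalized_morphism) equivariant_map_id:
  "equivariant_map M N P P (\<lambda>p\<in>topspace (spc P). p)"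
  by (intro equivariant_map.intro equivariant_map_axioms.intro generalized_morphism_axioms
        continuous_map_cong_on[OF continuous_map_id])
    (simp_all add: L.act_spc R.act_spc)

lemma equivariant_map_compose:
  assumes "equivariant_map M N P Q f" "equivariant_map M N Q T g"
  shows "equivariant_map M N P T (\<lambda>p\<in>topspace (spc P). g (f p))"
proof -
  interpret f: equivariant_map M N P Q f by fact
  interpret g: equivariant_map M N Q T g by fact
  show ?thesis
    by (intro equivariant_map.intro equivariant_map_axioms.intro f.P.generalized_morphism_axioms
          g.Q.generalized_morphism_axioms
          continuous_map_cong_on[OF continuous_map_compose_on[OF g.cont f.cont]])
      (simp_all add: f.P.L.act_spc f.P.R.act_spc f.mem f.lmom_map f.rmom_map f.lact_map f.ract_map
         g.lmom_map g.rmom_map g.lact_map g.ract_map)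
qed

section \<open>Horizontal composition and unitors\<close>

context composable begin

text \<open>
  All structure maps of the bicategory are defined on composites, so their equivariance is reduced
  once and for all to identities on pairs of representatives.
\<close>
lemma equivariant_map_from_comp:
  assumes T: "generalized_morphism M L T"
    and cont: "continuous_map (pairs P Q) (spc T) (\<lambda>z. f (c z))"
    and lmom_f: "\<And>p q. (p, q) \<in> S \<Longrightarrow> lmom T (f (c (p, q))) = lmom P p"
    and rmom_f: "\<And>p q. (p, q) \<in> S \<Longrightarrow> rmom T (f (c (p, q))) = rmom Q q"
    and lact_f: "\<And>m p q. \<lbrakk>m \<in> topspace (arr M); (p, q) \<in> S; src M m = lmom P p\<rbrakk>
                  \<Longrightarrow> f (c (lact P m p, q)) = lact T m (f (c (p, q)))"
    and ract_f: "\<And>p q l. \<lbrakk>(p, q) \<in> S; l \<in> topspace (arr L); rmom Q q = tgt L l\<rbrakk>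
                  \<Longrightarrow> f (c (p, ract Q q l)) = ract T (f (c (p, q))) l"
    and ext: "f \<in> extensional (topspace (spc R))"
  shows "equivariant_map M L R T f"
proof (intro equivariant_map.intro equivariant_map_axioms.intro generalized_morphism_comp T ext)
  show "continuous_map (spc R) (spc T) f"
    by (rule continuous_map_from_comp[OF cont]) simp
  fix z assume z: "z \<in> topspace (spc R)"
  obtain p q where pq: "z = c (p, q)" "(p, q) \<in> S" using z by (rule comp_cases)
  show "lmom T (f z) = lmom R z" "rmom T (f z) = rmom R z"
    using pq lmom_f rmom_f lmom_cls rmom_cls by simp_all
  show "f (lact R m z) = lact T m (f z)" if "m \<in> topspace (arr M)" "src M m = lmom R z" for m
    using that pq lmom_cls lact_cls lact_f by simp
  show "f (ract R z l) = ract T (f z) l" if "l \<in> topspace (arr L)" "rmom R z = tgt L l" for l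
    using that pq rmom_cls ract_cls ract_f by simp
qed

lemma descend_cls_ext: "descend S c f \<in> extensional (topspace (spc R))"
  by (simp add: descend_def topspace_comp)

end

locale composable_maps =
  f: equivariant_map M N P P' f + g: equivariant_map N L Q Q' g
  for M N L :: "'u::infinite groupoid" and P P' Q Q' :: "'u gen_mor" and f g :: "'u \<Rightarrow> 'u"
begin

sublocale dom: composable M N L P Q ..
sublocale cod: composable M N L P' Q' ..

definition star :: "'u \<Rightarrow> 'u" where
  "star = descend dom.S dom.c (\<lambda>(p, q). cod.c (f p, g q))"

lemma mem_pairs: "(p, q) \<in> dom.S \<Longrightarrow> (f p, g q) \<in> cod.S"
  by (simp add: dom.mem_pairs cod.mem_pairs f.mem g.mem f.rmom_map g.lmom_map)

lemma star_cls:
  assumes pq: "(p, q) \<in> dom.S"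
  shows "star (dom.c (p, q)) = cod.c (f p, g q)"
  unfolding star_def
proof (rule dom.descend_cls[OF pq, THEN trans])
  have p: "p \<in> topspace (spc P)" using pq by (simp add: dom.mem_pairs)
  fix n q' assume n: "n \<in> topspace (arr N)" "q' \<in> topspace (spc Q)" "rmom P p = tgt N n"
              "src N n = lmom Q q'" "q = lact Q n q'"
  show "(case (ract P p n, q') of (p, q) \<Rightarrow> cod.c (f p, g q)) = (case (p, q) of (p, q) \<Rightarrow> cod.c (f p, g q))"
    using n p cod.cls_balance[of "f p" n "g q'"]
    by (simp add: f.ract_map g.lact_map f.mem g.mem f.rmom_map g.lmom_map)
qed simp

lemma equivariant_map_star: "equivariant_map M L dom.R cod.R star"
proof (rule dom.equivariant_map_from_comp[OF cod.generalized_morphism_comp])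
  have "continuous_map (pairs P Q) (spc cod.R) (\<lambda>z. cod.c (f (fst z), g (snd z)))"
    by (rule cod.continuous_map_cls[OF continuous_map_compose_on[OF f.cont dom.pairs_fst]
          continuous_map_compose_on[OF g.cont dom.pairs_snd]])
      (use mem_pairs cod.mem_pairs in auto)
  then show "continuous_map (pairs P Q) (spc cod.R) (\<lambda>z. star (dom.c z))"
    by (rule continuous_map_cong_on) (auto simp: star_cls)
  fix p q assume pq: "(p, q) \<in> dom.S"
  note pq' = mem_pairs[OF pq] and p = pq[unfolded dom.mem_pairs]
  show "lmom cod.R (star (dom.c (p, q))) = lmom P p" "rmom cod.R (star (dom.c (p, q))) = rmom Q q"
    using pq pq' p by (simp_all add: star_cls cod.lmom_cls cod.rmom_cls f.lmom_map g.rmom_map)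
  show "star (dom.c (lact P m p, q)) = lact cod.R m (star (dom.c (p, q)))"
    if "m \<in> topspace (arr M)" "src M m = lmom P p" for m
    using that pq pq' p by (simp add: star_cls dom.mem_pairs_lact cod.lact_cls f.lact_map f.lmom_map)
  show "star (dom.c (p, ract Q q l)) = ract cod.R (star (dom.c (p, q))) l"
    if "l \<in> topspace (arr L)" "rmom Q q = tgt L l" for l
    using that pq pq' p by (simp add: star_cls dom.mem_pairs_ract cod.ract_cls g.ract_map g.rmom_map)
qed (unfold star_def, rule dom.descend_cls_ext)

end

lemma unit_gen_mor_simps [simp]:
  "spc (unit_gen_mor M) = arr M" "lmom (unit_gen_mor M) = tgt M" "rmom (unit_gen_mor M) = src M"
  "lact (unit_gen_mor M) = mul M" "ract (unit_gen_mor M) = mul M"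
  by (simp_all add: unit_gen_mor_def)

text \<open>
  Composites exist only over an infinite type of points, which provides codes for pairs; this is
  the setting in which a generalized morphism can be composed with units.
\<close>
locale infinite_generalized_morphism = generalized_morphism M N P
  for M N :: "'u::infinite groupoid" and P :: "'u gen_mor"
begin

sublocale IP: composable M M N "unit_gen_mor M" P
  by (intro composable.intro L.generalized_morphism_unit generalized_morphism_axioms)

sublocale PI: composable M N N P "unit_gen_mor N"
  by (intro composable.intro R.generalized_morphism_unit generalized_morphism_axioms)

definition lun :: "'u \<Rightarrow> 'u" where
  "lun = descend IP.S IP.c (\<lambda>(m, p). lact P m p)"

definition run :: "'u \<Rightarrow> 'u" where
  "run = descend PI.S PI.c (\<lambda>(p, n). ract P p n)"

lemma lun_cls:
  assumes mp: "(m, p) \<in> IP.S"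
  shows "lun (IP.c (m, p)) = lact P m p"
  unfolding lun_def
  by (rule IP.descend_cls[OF mp, THEN trans])
    (use mp in \<open>simp_all add: IP.mem_pairs L.act_mul\<close>)

lemma run_cls:
  assumes pn: "(p, n) \<in> PI.S"
  shows "run (PI.c (p, n)) = ract P p n"
  unfolding run_def
  by (rule PI.descend_cls[OF pn, THEN trans])
    (use pn in \<open>simp_all add: PI.mem_pairs R.act_mul\<close>)

lemma equivariant_map_lun: "equivariant_map M N IP.R P lun"
proof (rule IP.equivariant_map_from_comp[OF generalized_morphism_axioms])
  have "continuous_map (pairs (unit_gen_mor M) P) (spc P) (\<lambda>z. lact P (fst z) (snd z))"
    by (rule continuous_map_on_fibre_prod[OF L.act_cont IP.pairs_fst[simplified] IP.pairs_snd])
      (auto simp: IP.mem_pairs)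
  then show "continuous_map (pairs (unit_gen_mor M) P) (spc P) (\<lambda>z. lun (IP.c z))"
    by (rule continuous_map_cong_on) (auto simp: lun_cls)
  fix m p assume mp: "(m, p) \<in> IP.S"
  note p = mp[unfolded IP.mem_pairs, simplified]
  show "lmom P (lun (IP.c (m, p))) = lmom (unit_gen_mor M) m" "rmom P (lun (IP.c (m, p))) = rmom P p"
    using mp p by (simp_all add: lun_cls L.mom_act rmom_lact)
  show "lun (IP.c (lact (unit_gen_mor M) k m, p)) = lact P k (lun (IP.c (m, p)))"
    if "k \<in> topspace (arr M)" "src M k = lmom (unit_gen_mor M) m" for k
    using that mp p IP.mem_pairs_lact[of m p k] by (simp add: lun_cls L.act_mul)
  show "lun (IP.c (m, ract P p l)) = ract P (lun (IP.c (m, p))) l"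
    if "l \<in> topspace (arr N)" "rmom P p = tgt N l" for l
    using that mp p by (simp add: lun_cls IP.mem_pairs_ract actions_commute)
qed (unfold lun_def, rule IP.descend_cls_ext)

lemma equivariant_map_run: "equivariant_map M N PI.R P run"
proof (rule PI.equivariant_map_from_comp[OF generalized_morphism_axioms])
  have "continuous_map (pairs P (unit_gen_mor N)) (spc P) (\<lambda>z. ract P (fst z) (snd z))"
    by (rule continuous_map_on_fibre_prod[OF R.act_cont PI.pairs_fst PI.pairs_snd[simplified]])
      (auto simp: PI.mem_pairs)
  then show "continuous_map (pairs P (unit_gen_mor N)) (spc P) (\<lambda>z. run (PI.c z))"
    by (rule continuous_map_cong_on) (auto simp: run_cls)
  fix p n assume pn: "(p, n) \<in> PI.S"
  note p = pn[unfolded PI.mem_pairs, simplified]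
  show "lmom P (run (PI.c (p, n))) = lmom P p" "rmom P (run (PI.c (p, n))) = rmom (unit_gen_mor N) n"
    using pn p by (simp_all add: run_cls R.mom_act R.pr_act)
  show "run (PI.c (lact P m p, n)) = lact P m (run (PI.c (p, n)))"
    if "m \<in> topspace (arr M)" "src M m = lmom P p" for m
    using that pn p by (simp add: run_cls PI.mem_pairs_lact actions_commute)
  show "run (PI.c (p, ract (unit_gen_mor N) n l)) = ract P (run (PI.c (p, n))) l"
    if "l \<in> topspace (arr N)" "rmom (unit_gen_mor N) n = tgt N l" for l
    using that pn p PI.mem_pairs_ract[of p n l] by (simp add: run_cls R.act_mul)
qed (unfold run_def, rule PI.descend_cls_ext)

end

section \<open>The associator\<close>

locale composable3 =
  PQ: composable M N L P Q + QT: composable N L K Q T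
  for M N L K :: "'u::infinite groupoid" and P Q T :: "'u gen_mor"
begin

sublocale P_QT: composable M N K P QT.R
  by (intro composable.intro PQ.P.generalized_morphism_axioms QT.generalized_morphism_comp)

sublocale PQ_T: composable M L K PQ.R T
  by (intro composable.intro QT.Q.generalized_morphism_axioms PQ.generalized_morphism_comp)

definition triples :: "('u \<times> 'u \<times> 'u) set" where
  "triples = {(p, q, t). (p, q) \<in> PQ.S \<and> (q, t) \<in> QT.S}"

definition asc :: "'u \<Rightarrow> 'u" where
  "asc = descend triples (\<lambda>(p, q, t). P_QT.c (p, QT.c (q, t))) (\<lambda>(p, q, t). PQ_T.c (PQ.c (p, q), t))"

lemma mem_P_QT: "(p, q) \<in> PQ.S \<Longrightarrow> (q, t) \<in> QT.S \<Longrightarrow> (p, QT.c (q, t)) \<in> P_QT.S"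
  by (simp add: P_QT.mem_pairs PQ.mem_pairs QT.cls_in_comp QT.lmom_cls)

lemma mem_PQ_T: "(p, q) \<in> PQ.S \<Longrightarrow> (q, t) \<in> QT.S \<Longrightarrow> (PQ.c (p, q), t) \<in> PQ_T.S"
  by (simp add: PQ_T.mem_pairs QT.mem_pairs PQ.cls_in_comp PQ.rmom_cls)

lemma P_QT_cases:
  assumes "(p, w) \<in> P_QT.S"
  obtains q t where "w = QT.c (q, t)" "(p, q) \<in> PQ.S" "(q, t) \<in> QT.S"
proof -
  have w: "p \<in> topspace (spc P)" "w \<in> topspace (spc QT.R)" "rmom P p = lmom QT.R w"
    using assms by (simp_all add: P_QT.mem_pairs)
  obtain q t where qt: "w = QT.c (q, t)" "(q, t) \<in> QT.S" "q \<in> topspace (spc Q)"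
    using w(2) by (rule QT.comp_cases)
  then have "(p, q) \<in> PQ.S" using w by (simp add: PQ.mem_pairs QT.lmom_cls)
  then show thesis using that qt by blast
qed

text \<open>
  Two representations of a point \<open>[p, [q, t]]\<close> differ by some \<open>n\<close> in the outer class and, after
  moving \<open>n\<close> into the inner one, by some \<open>l\<close> there: \<open>p' = p n\<close>, \<open>n q' = q l\<close> and \<open>t = l t'\<close>. Hence
  \<open>[[p, q], t] = [[p, q] l, t'] = [[p, n q'], t'] = [[p', q'], t']\<close>.
\<close>
lemma asc_cls:
  assumes pq: "(p, q) \<in> PQ.S" and qt: "(q, t) \<in> QT.S"
  shows "asc (P_QT.c (p, QT.c (q, t))) = PQ_T.c (PQ.c (p, q), t)"
proof -
  let ?k = "\<lambda>(p, q, t). P_QT.c (p, QT.c (q, t))" and ?F = "\<lambda>(p, q, t). PQ_T.c (PQ.c (p, q), t)"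
  have "descend triples ?k ?F (?k (p, q, t)) = ?F (p, q, t)"
  proof (rule descend_eq)
    show "(p, q, t) \<in> triples" using pq qt by (simp add: triples_def)
    fix y assume y: "y \<in> triples" and eq: "?k y = ?k (p, q, t)"
    obtain p' q' t' where y': "y = (p', q', t')" by (cases y)
    have pq': "(p', q') \<in> PQ.S" and qt': "(q', t') \<in> QT.S" using y y' by (simp_all add: triples_def)
    have p: "p \<in> topspace (spc P)" "q \<in> topspace (spc Q)" "q' \<in> topspace (spc Q)" "t' \<in> topspace (spc T)"
      "rmom P p = lmom Q q" "rmom Q q' = lmom T t'"
      using pq pq' qt' by (simp_all add: PQ.mem_pairs QT.mem_pairs)
    have "P_QT.c (p, QT.c (q, t)) = P_QT.c (p', QT.c (q', t'))" using eq y' by simp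
    then obtain n where n: "n \<in> topspace (arr N)" "rmom P p = tgt N n" "src N n = lmom QT.R (QT.c (q', t'))"
      "p' = ract P p n" "QT.c (q, t) = lact QT.R n (QT.c (q', t'))"
      using P_QT.cls_eq_iff[OF mem_P_QT[OF pq qt] mem_P_QT[OF pq' qt']] by blast
    have nq: "src N n = lmom Q q'" using n(3) QT.lmom_cls[OF qt'] by simp
    have "QT.c (q, t) = QT.c (lact Q n q', t')" using QT.lact_cls[OF qt' n(1) nq] n(5) by simp
    then obtain l where l: "l \<in> topspace (arr L)" "rmom Q q = tgt L l" "src L l = lmom T t'"
      "lact Q n q' = ract Q q l" "t = lact T l t'"
      using QT.cls_eq_iff[OF qt QT.mem_pairs_lact[OF qt' n(1) nq]] by blast
    have "PQ_T.c (PQ.c (p, q), t) = PQ_T.c (ract PQ.R (PQ.c (p, q)) l, t')"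
      using PQ_T.cls_balance[of "PQ.c (p, q)" l t'] l p pq by (simp add: PQ.cls_in_comp PQ.rmom_cls)
    also have "ract PQ.R (PQ.c (p, q)) l = PQ.c (p, lact Q n q')"
      using PQ.ract_cls[OF pq l(1,2)] l(4) by simp
    also have "\<dots> = PQ.c (p', q')" using PQ.cls_balance[of p n q'] n p nq by simp
    finally show "?F y = ?F (p, q, t)" using y' by simp
  qed
  then show ?thesis by (simp add: asc_def)
qed

lemma asc_ext: "asc \<in> extensional (topspace (spc P_QT.R))"
proof -
  have "(\<lambda>(p, q, t). P_QT.c (p, QT.c (q, t))) ` triples = topspace (spc P_QT.R)"
    unfolding P_QT.topspace_comp
    by (auto simp: triples_def image_iff intro: mem_P_QT elim!: P_QT_cases)
      (use mem_P_QT in blast)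
  then show ?thesis by (simp add: asc_def descend_def)
qed

text \<open>
  The inner class has to be lifted to representatives before the formula for the associator can
  be applied.
\<close>
lemma asc_cont: "continuous_map (pairs P QT.R) (spc PQ_T.R) (\<lambda>z. asc (P_QT.c z))"
proof (rule continuous_map_if_locally)
  let ?Z = "pairs P QT.R"
  fix z0 assume z0: "z0 \<in> topspace ?Z"
  obtain U q t where U: "openin ?Z U" "z0 \<in> U"
    and qt: "continuous_map (subtopology ?Z U) (spc Q) q" "continuous_map (subtopology ?Z U) (spc T) t"
      "\<And>z. z \<in> U \<Longrightarrow> (q z, t z) \<in> QT.S" "\<And>z. z \<in> U \<Longrightarrow> QT.c (q z, t z) = snd z"
    by (rule QT.local_lift[OF P_QT.pairs_snd z0]) blast
  let ?W = "subtopology ?Z U"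
  have p: "continuous_map ?W (spc P) fst"
    by (intro continuous_map_from_subtopology P_QT.pairs_fst)
  have eq: "(fst z, q z) \<in> PQ.S" "(q z, t z) \<in> QT.S" "z = (fst z, QT.c (q z, t z))" if "z \<in> topspace ?W" for z
  proof -
    show "(q z, t z) \<in> QT.S" "z = (fst z, QT.c (q z, t z))" using qt that by auto
    then show "(fst z, q z) \<in> PQ.S"
      using that P_QT.mem_pairs[of "fst z" "snd z"] qt(4)[of z] QT.lmom_cls[of "q z" "t z"]
      by (auto simp: PQ.mem_pairs QT.mem_pairs)
  qed
  have 1: "continuous_map ?W (spc PQ.R) (\<lambda>z. PQ.c (fst z, q z))"
    by (rule PQ.continuous_map_cls[OF p qt(1)]) (use eq(1) PQ.mem_pairs in blast)
  have 2: "continuous_map ?W (spc PQ_T.R) (\<lambda>z. PQ_T.c (PQ.c (fst z, q z), t z))"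
    by (rule PQ_T.continuous_map_cls[OF 1 qt(2)]) (use mem_PQ_T[OF eq(1,2)] PQ_T.mem_pairs in blast)
  have "continuous_map ?W (spc PQ_T.R) (\<lambda>z. asc (P_QT.c z))"
  proof (rule continuous_map_cong_on[OF 2])
    fix z assume z: "z \<in> topspace ?W"
    show "PQ_T.c (PQ.c (fst z, q z), t z) = asc (P_QT.c z)"
      using asc_cls[OF eq(1)[OF z] eq(2)[OF z]] eq(3)[OF z] by metis
  qed
  then show "\<exists>W. openin ?Z W \<and> z0 \<in> W \<and> continuous_map (subtopology ?Z W) (spc PQ_T.R) (\<lambda>z. asc (P_QT.c z))"
    using U by blast
qed

lemma equivariant_map_asc: "equivariant_map M K P_QT.R PQ_T.R asc"
proof (rule P_QT.equivariant_map_from_comp[OF PQ_T.generalized_morphism_comp asc_cont _ _ _ _ asc_ext])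
  fix p w assume pw: "(p, w) \<in> P_QT.S"
  then obtain q t where w: "w = QT.c (q, t)" and pq: "(p, q) \<in> PQ.S" and qt: "(q, t) \<in> QT.S"
    by (rule P_QT_cases)
  note mem = mem_PQ_T[OF pq qt] and asc = asc_cls[OF pq qt]
  show "lmom PQ_T.R (asc (P_QT.c (p, w))) = lmom P p" "rmom PQ_T.R (asc (P_QT.c (p, w))) = rmom QT.R w"
    by (simp_all add: w asc PQ_T.lmom_cls[OF mem] PQ_T.rmom_cls[OF mem] PQ.lmom_cls[OF pq] QT.rmom_cls[OF qt])
  show "asc (P_QT.c (lact P m p, w)) = lact PQ_T.R m (asc (P_QT.c (p, w)))"
    if "m \<in> topspace (arr M)" "src M m = lmom P p" for m
    using that by (simp add: w asc asc_cls[OF PQ.mem_pairs_lact[OF pq] qt] PQ_T.lact_cls[OF mem]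
        PQ.lmom_cls[OF pq] PQ.lact_cls[OF pq])
  show "asc (P_QT.c (p, ract QT.R w l)) = ract PQ_T.R (asc (P_QT.c (p, w))) l"
    if "l \<in> topspace (arr K)" "rmom QT.R w = tgt K l" for l
    using that by (simp add: w asc asc_cls[OF pq QT.mem_pairs_ract[OF qt]] PQ_T.ract_cls[OF mem]
        QT.rmom_cls[OF qt] QT.ract_cls[OF qt])
qed

end

section \<open>Exchanging the actions of two bundles of groups\<close>

text \<open>
  Each of the conditions (E1) and (E2) is an instance of this one.
\<close>
definition exchange ::
    "'u groupoid \<Rightarrow> ('u \<Rightarrow> 'u) \<Rightarrow> 'u groupoid \<Rightarrow> ('u \<Rightarrow> 'u) \<Rightarrow> 'u gen_mor \<Rightarrow> bool" where
  "exchange H a K b P \<longleftrightarrow> left_free H a P \<and> right_free K b P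
     \<and> left_orbit H a P ` topspace (spc P) = right_orbit K b P ` topspace (spc P)"

locale bundle_actions =
  generalized_morphism M N P +
  H: group_bundle H + a: strict_morphism H M a +
  K: group_bundle K + b: strict_morphism K N b
  for M N :: "'u groupoid" and P :: "'u gen_mor" and H K :: "'u groupoid" and a b :: "'u \<Rightarrow> 'u"
begin

lemma a_arr: "h \<in> topspace (arr H) \<Longrightarrow> a h \<in> topspace (arr M)"
  using a.cont by (rule continuous_map_mem)

lemma b_arr: "h \<in> topspace (arr K) \<Longrightarrow> b h \<in> topspace (arr N)"
  using b.cont by (rule continuous_map_mem)

lemma self_left_orbit:
  assumes p: "p \<in> topspace (spc P)"
  shows "p \<in> left_orbit H a P p"
proof -
  have x: "lmom P p \<in> topspace (obj H)" using L.mom_obj[OF p] a.same_units by simp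
  then have "lact P (a (one H (lmom P p))) p = p" using L.act_one[OF p] a.one_map by simp
  then show ?thesis
    unfolding left_orbit_def using x H.one_arr H.src_one
    by (intro CollectI exI[of _ "one H (lmom P p)"]) auto
qed

text \<open>
  Orbits of a bundle of groups partition the space: if \<open>x = p b(k)\<close> then \<open>p = x b(k\<^sup>-\<^sup>1)\<close>, and orbits
  can only shrink when passing from a point to another point of its orbit.
\<close>
lemma right_orbit_eq:
  assumes p: "p \<in> topspace (spc P)" and x: "x \<in> right_orbit K b P p"
  shows "right_orbit K b P x = right_orbit K b P p"
proof -
  obtain k where k: "k \<in> topspace (arr K)" "rmom P p = tgt K k" "x = ract P p (b k)"
    using x by (auto simp: right_orbit_def)
  have bk: "b k \<in> topspace (arr N)" "rmom P p = tgt N (b k)" "src N (b k) = tgt K k"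
    using k b_arr b.src_map b.tgt_map K.src_eq_tgt by simp_all
  have rx: "rmom P x = tgt K k" using R.mom_act[OF p bk(1,2)] bk k by simp
  have px: "x \<in> topspace (spc P)" using R.act_spc[OF p bk(1,2)] k by simp
  let ?k = "ginv K k"
  have k': "?k \<in> topspace (arr K)" "tgt K ?k = tgt K k" "src K ?k = tgt K k"
    using k K.ginv_arr K.src_ginv K.tgt_ginv K.src_eq_tgt by simp_all
  have "b (mul K k ?k) = b (one K (tgt K k))" using K.mul_ginv k by simp
  then have bk': "mul N (b k) (b ?k) = one N (tgt K k)"
    using b.mul_map[of k ?k] b.one_map[of "tgt K k"] k k' K.tgt_obj K.src_eq_tgt by simp
  have inv: "ract P x (b ?k) = p"
  proof -
    have "ract P x (b ?k) = ract P p (mul N (b k) (b ?k))"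
      using R.act_mul[OF p bk(1) b_arr[OF k'(1)] bk(2)] bk k k' b.tgt_map by simp
    then show ?thesis using bk' R.act_one[OF p] k by simp
  qed
  have sub: "right_orbit K b P y \<subseteq> right_orbit K b P z"
    if z: "z \<in> topspace (spc P)" "j \<in> topspace (arr K)" "rmom P z = tgt K j" "y = ract P z (b j)" for y z j
  proof
    have bj: "b j \<in> topspace (arr N)" "rmom P z = tgt N (b j)" "src N (b j) = tgt K j"
      using z b_arr b.src_map b.tgt_map K.src_eq_tgt by simp_all
    have ry: "rmom P y = tgt K j" using R.mom_act[OF z(1) bj(1,2)] bj z by simp
    fix w assume "w \<in> right_orbit K b P y"
    then obtain h where h: "h \<in> topspace (arr K)" "rmom P y = tgt K h" "w = ract P y (b h)"
      by (auto simp: right_orbit_def)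
    have jh: "src K j = tgt K h" using ry h z K.src_eq_tgt by simp
    have "w = ract P z (b (mul K j h))"
      using R.act_mul[OF z(1) bj(1) b_arr[OF h(1)] bj(2)] b.mul_map[OF z(2) h(1) jh] bj h z ry b.tgt_map
      by simp
    then show "w \<in> right_orbit K b P z"
      unfolding right_orbit_def using K.mul_arr[OF z(2) h(1) jh] K.tgt_mul[OF z(2) h(1) jh] z by auto
  qed
  show ?thesis
    using sub[OF p k] sub[OF px k'(1) _ inv[symmetric]] rx k' by auto
qed

text \<open>
  Equality of the two orbit spaces says that the partitions are the same, which can be tested at
  each point separately because \<open>p\<close> lies in its own left orbit.
\<close>
lemma orbits_eq_iff:
  "left_orbit H a P ` topspace (spc P) = right_orbit K b P ` topspace (spc P) \<longleftrightarrow>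
     (\<forall>p\<in>topspace (spc P). left_orbit H a P p = right_orbit K b P p)"
proof
  assume eq: "left_orbit H a P ` topspace (spc P) = right_orbit K b P ` topspace (spc P)"
  show "\<forall>p\<in>topspace (spc P). left_orbit H a P p = right_orbit K b P p"
  proof
    fix p assume p: "p \<in> topspace (spc P)"
    then have "left_orbit H a P p \<in> right_orbit K b P ` topspace (spc P)" using eq by blast
    then obtain x where x: "x \<in> topspace (spc P)" "left_orbit H a P p = right_orbit K b P x" by auto
    then have "p \<in> right_orbit K b P x" using self_left_orbit[OF p] by simp
    then show "left_orbit H a P p = right_orbit K b P p" using right_orbit_eq x by simp
  qed
qed (rule image_cong, simp_all)

end

text \<open>
  By normality of the image of \<open>a\<close>, \<open>a(h) m = m (m\<^sup>-\<^sup>1a(h) m)\<close> lies in the right orbit of \<open>m\<close>; the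
  converse inclusion uses conjugation by \<open>m\<^sup>-\<^sup>1\<close>.
\<close>
lemma exchange_unit:
  assumes "group_bundle H" "strict_morphism H M a" and inj: "inj_on a (topspace (arr H))"
    and conj: "\<And>m h. \<lbrakk>m \<in> topspace (arr M); h \<in> topspace (arr H); src H h = tgt M m\<rbrakk>
       \<Longrightarrow> \<exists>k\<in>topspace (arr H). src H k = src M m \<and> a k = mul M (ginv M m) (mul M (a h) m)"
  shows "exchange H a H a (unit_gen_mor M)"
proof -
  interpret H: group_bundle H by fact
  interpret M: topological_groupoid M using assms(2) by (simp add: strict_morphism_def)
  interpret a: strict_morphism H M a by fact
  interpret bundle_actions M M "unit_gen_mor M" H H a a
    by (intro bundle_actions.intro M.generalized_morphism_unit assms(1,2))
  have unit: "h = one H x" if "h \<in> topspace (arr H)" "x \<in> topspace (obj M)" "a h = one M x" for h x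
  proof -
    have "x \<in> topspace (obj H)" using that a.same_units by simp
    then show ?thesis using that inj_onD[OF inj] a.one_map H.one_arr by metis
  qed
  have lf: "left_free H a (unit_gen_mor M)"
    unfolding left_free_def using M.mul_left_unit unit a_arr a.src_map M.tgt_obj by simp
  have rf: "right_free H a (unit_gen_mor M)"
    unfolding right_free_def unit_gen_mor_simps
    using M.mul_right_unit unit a_arr a.tgt_map M.src_obj by metis
  have "left_orbit H a (unit_gen_mor M) m = right_orbit H a (unit_gen_mor M) m" if m: "m \<in> topspace (arr M)" for m
  proof (intro set_eqI iffI)
    fix x assume "x \<in> left_orbit H a (unit_gen_mor M) m"
    then obtain h where h: "h \<in> topspace (arr H)" "src H h = tgt M m" "x = mul M (a h) m"
      by (auto simp: left_orbit_def)
    then obtain k where k: "k \<in> topspace (arr H)" "src H k = src M m" "a k = mul M (ginv M m) (mul M (a h) m)"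
      using conj[OF m] by blast
    have ah: "a h \<in> topspace (arr M)" "src M (a h) = tgt M m" "tgt M (a h) = tgt M m"
      using h a_arr a.src_map a.tgt_map H.src_eq_tgt by simp_all
    have "mul M m (a k) = x"
      using k h M.mul_ginv_cancel_left[OF m M.mul_arr[OF ah(1) m ah(2)]] M.tgt_mul[OF ah(1) m ah(2)] ah by simp
    then show "x \<in> right_orbit H a (unit_gen_mor M) m"
      unfolding right_orbit_def using k H.src_eq_tgt[OF k(1)]
      by (intro CollectI exI[of _ k]) simp
  next
    fix x assume "x \<in> right_orbit H a (unit_gen_mor M) m"
    then obtain k where k: "k \<in> topspace (arr H)" "tgt H k = src M m" "x = mul M m (a k)"
      by (auto simp: right_orbit_def)
    let ?m = "ginv M m"
    have m': "?m \<in> topspace (arr M)" "src M ?m = tgt M m" "tgt M ?m = src M m"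
      using m M.ginv_arr M.src_ginv M.tgt_ginv by simp_all
    have sk: "src H k = tgt M ?m" using k m' H.src_eq_tgt by simp
    obtain h where h: "h \<in> topspace (arr H)" "src H h = src M ?m" "a h = mul M (ginv M ?m) (mul M (a k) ?m)"
      using conj[OF m'(1) k(1) sk] by blast
    have ak: "a k \<in> topspace (arr M)" "src M (a k) = src M m" "tgt M (a k) = src M m"
      using k a_arr a.src_map a.tgt_map H.src_eq_tgt by simp_all
    have "a h = mul M m (mul M (a k) ?m)" using h M.ginv_ginv[OF m] by simp
    also have "\<dots> = mul M (mul M m (a k)) ?m"
      using m m' ak by (intro M.mul_assoc[symmetric]) simp_all
    finally have "mul M (a h) m = mul M (mul M (mul M m (a k)) ?m) m" by simp
    also have "\<dots> = mul M (mul M m (a k)) (mul M ?m m)"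
      using m m' ak by (intro M.mul_assoc) (simp_all add: M.mul_arr M.src_mul)
    also have "\<dots> = x"
      using m ak k M.ginv_mul[OF m] M.mul_one[OF M.mul_arr[OF m ak(1)]] by (simp add: M.src_mul)
    finally have "mul M (a h) m = x" .
    then show "x \<in> left_orbit H a (unit_gen_mor M) m"
      unfolding left_orbit_def using h m' by (intro CollectI exI[of _ h]) simp
  qed
  then have "left_orbit H a (unit_gen_mor M) ` topspace (spc (unit_gen_mor M))
      = right_orbit H a (unit_gen_mor M) ` topspace (spc (unit_gen_mor M))"
    by (intro image_cong) simp_all
  then show ?thesis using lf rf by (simp add: exchange_def)
qed

text \<open>
  The left orbit of \<open>[p, q]\<close> consists of the classes \<open>[p b(k), q] = [p, b(k) q]\<close> by the exchange
  condition for \<open>P\<close>, and these form its right orbit by the condition for \<open>Q\<close>. If \<open>a(h)\<close> fixes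
  \<open>[p, q]\<close> and \<open>a(h) p = p b(k)\<close>, then \<open>[p, b(k) q] = [p, q]\<close>, so that \<open>b(k) q = q\<close> by freeness of
  the principal action on \<open>P\<close>. Now \<open>k\<close> is a unit because the middle bundle acts freely on \<open>Q\<close>, whence
  \<open>a(h) p = p\<close> and \<open>h\<close> is a unit.
\<close>
lemma (in composable) exchange_comp:
  assumes a: "group_bundle H" "strict_morphism H M a" and b: "group_bundle K" "strict_morphism K N b"
    and d: "group_bundle J" "strict_morphism J L d"
    and exP: "exchange H a K b P" and exQ: "exchange K b J d Q"
  shows "exchange H a J d R"
proof -
  interpret PA: bundle_actions M N P H K a b
    by (intro bundle_actions.intro P.generalized_morphism_axioms a b)
  interpret QA: bundle_actions N L Q K J b d
    by (intro bundle_actions.intro Q.generalized_morphism_axioms b d)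
  have orbP: "left_orbit H a P p = right_orbit K b P p" if "p \<in> topspace (spc P)" for p
    using that exP PA.orbits_eq_iff by (simp add: exchange_def)
  have orbQ: "left_orbit K b Q q = right_orbit J d Q q" if "q \<in> topspace (spc Q)" for q
    using that exQ QA.orbits_eq_iff by (simp add: exchange_def)
  have swap: "c (ract P p (b k), q) = c (p, lact Q (b k) q)"
    if "(p, q) \<in> S" "k \<in> topspace (arr K)" "rmom P p = tgt K k" for p q k
    using that PA.b_arr PA.b.src_map PA.b.tgt_map PA.K.src_eq_tgt
    by (intro cls_balance) (simp_all add: mem_pairs)
  have left: "left_orbit H a R (c (p, q)) = (\<lambda>x. c (x, q)) ` left_orbit H a P p" if pq: "(p, q) \<in> S" for p q
  proof -
    have "lact R (a h) (c (p, q)) = c (lact P (a h) p, q)" if "h \<in> topspace (arr H)" "src H h = lmom P p" for h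
      using that lact_cls[OF pq] PA.a_arr PA.a.src_map by simp
    then have "(\<lambda>h. lact R (a h) (c (p, q))) ` {h \<in> topspace (arr H). src H h = lmom P p}
        = (\<lambda>h. c (lact P (a h) p, q)) ` {h \<in> topspace (arr H). src H h = lmom P p}"
      by (intro image_cong) simp_all
    then show ?thesis by (simp add: left_orbit_def image_def lmom_cls[OF pq]) blast
  qed
  have right: "right_orbit J d R (c (p, q)) = (\<lambda>y. c (p, y)) ` right_orbit J d Q q" if pq: "(p, q) \<in> S" for p q
  proof -
    have "ract R (c (p, q)) (d h) = c (p, ract Q q (d h))" if "h \<in> topspace (arr J)" "rmom Q q = tgt J h" for h
      using that ract_cls[OF pq] QA.b_arr QA.b.tgt_map by simp
    then have "(\<lambda>h. ract R (c (p, q)) (d h)) ` {h \<in> topspace (arr J). rmom Q q = tgt J h}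
        = (\<lambda>h. c (p, ract Q q (d h))) ` {h \<in> topspace (arr J). rmom Q q = tgt J h}"
      by (intro image_cong) simp_all
    then show ?thesis by (simp add: right_orbit_def image_def rmom_cls[OF pq]) blast
  qed
  have middle: "(\<lambda>x. c (x, q)) ` right_orbit K b P p = (\<lambda>y. c (p, y)) ` left_orbit K b Q q"
    if pq: "(p, q) \<in> S" for p q
  proof -
    have iff: "k \<in> topspace (arr K) \<and> rmom P p = tgt K k \<longleftrightarrow> k \<in> topspace (arr K) \<and> src K k = lmom Q q" for k
      using pq PA.K.src_eq_tgt by (auto simp: mem_pairs)
    have "(\<lambda>x. c (x, q)) ` right_orbit K b P p
        = (\<lambda>k. c (ract P p (b k), q)) ` {k. k \<in> topspace (arr K) \<and> rmom P p = tgt K k}"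
      unfolding right_orbit_def by auto
    also have "\<dots> = (\<lambda>k. c (p, lact Q (b k) q)) ` {k. k \<in> topspace (arr K) \<and> rmom P p = tgt K k}"
      using swap[OF pq] by (intro image_cong) auto
    also have "\<dots> = (\<lambda>y. c (p, y)) ` left_orbit K b Q q"
      unfolding iff left_orbit_def by auto
    finally show ?thesis .
  qed
  have orb: "left_orbit H a R z = right_orbit J d R z" if z: "z \<in> topspace (spc R)" for z
  proof -
    obtain p q where "z = c (p, q)" "(p, q) \<in> S" "p \<in> topspace (spc P)" "q \<in> topspace (spc Q)"
      using z by (rule comp_cases)
    then show ?thesis using left right middle orbP orbQ by simp
  qed
  have triv: "n = one N (rmom P p)" if "p \<in> topspace (spc P)" "n \<in> topspace (arr N)" "rmom P p = tgt N n"
    "p = ract P p n" for p n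
    using P.R.act_free that by simp
  have lf: "left_free H a R"
    unfolding left_free_def
  proof (intro ballI impI, elim conjE)
    fix z h assume z: "z \<in> topspace (spc R)" and h: "h \<in> topspace (arr H)" and hz: "src H h = lmom R z"
      and fix_z: "lact R (a h) z = z"
    obtain p q where pq: "z = c (p, q)" "(p, q) \<in> S" "p \<in> topspace (spc P)" "q \<in> topspace (spc Q)"
      "rmom P p = lmom Q q"
      using z by (rule comp_cases)
    have hp: "src H h = lmom P p" using hz pq lmom_cls by simp
    have "lact P (a h) p \<in> left_orbit H a P p" using h hp by (auto simp: left_orbit_def)
    then obtain k where k: "k \<in> topspace (arr K)" "rmom P p = tgt K k" "lact P (a h) p = ract P p (b k)"
      using orbP pq by (auto simp: right_orbit_def)
    have bk: "b k \<in> topspace (arr N)" "src N (b k) = lmom Q q" "tgt N (b k) = rmom P p"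
      using k pq PA.b_arr PA.b.src_map PA.b.tgt_map PA.K.src_eq_tgt by simp_all
    have "c (p, q) = lact R (a h) z" using fix_z pq by simp
    also have "\<dots> = c (lact P (a h) p, q)"
      using lact_cls[OF pq(2) PA.a_arr[OF h]] hp PA.a.src_map h pq by simp
    also have "\<dots> = c (p, lact Q (b k) q)" using swap[OF pq(2) k(1,2)] k by simp
    finally have "c (p, q) = c (p, lact Q (b k) q)" .
    moreover have mem: "(p, lact Q (b k) q) \<in> S"
      using pq bk Q.L.act_spc Q.L.mom_act by (simp add: mem_pairs)
    ultimately obtain n where n: "n \<in> topspace (arr N)" "rmom P p = tgt N n" "p = ract P p n"
      "q = lact Q n (lact Q (b k) q)"
      using cls_eq_iff[OF pq(2) mem] by blast
    have "n = one N (lmom Q (lact Q (b k) q))"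
      using triv[OF pq(3) n(1-3)] mem by (simp add: mem_pairs)
    then have "lact Q (b k) q = q" using n(4) Q.L.act_one mem by (simp add: mem_pairs)
    then have "k = one K (lmom Q q)"
      using exQ k pq PA.K.src_eq_tgt unfolding exchange_def left_free_def by metis
    then have "b k = one N (rmom P p)"
      using PA.b.one_map PA.b.same_units Q.L.mom_obj pq by simp
    then have "lact P (a h) p = p" using k(3) P.R.act_one[OF pq(3)] by simp
    then have "h = one H (lmom P p)" using exP h hp pq unfolding exchange_def left_free_def by blast
    then show "h = one H (lmom R z)" using pq lmom_cls by simp
  qed
  have rf: "right_free J d R"
    unfolding right_free_def
  proof (intro ballI impI, elim conjE)
    fix z h assume z: "z \<in> topspace (spc R)" and h: "h \<in> topspace (arr J)" and hz: "rmom R z = tgt J h"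
      and fix_z: "ract R z (d h) = z"
    obtain p q where pq: "z = c (p, q)" "(p, q) \<in> S" "p \<in> topspace (spc P)" "q \<in> topspace (spc Q)"
      "rmom P p = lmom Q q"
      using z by (rule comp_cases)
    have hq: "rmom Q q = tgt J h" using hz pq rmom_cls by simp
    have dh: "d h \<in> topspace (arr L)" "rmom Q q = tgt L (d h)"
      using h hq QA.b_arr QA.b.tgt_map by simp_all
    have "c (p, ract Q q (d h)) = c (p, q)" using ract_cls[OF pq(2) dh] fix_z pq by simp
    then obtain n where n: "n \<in> topspace (arr N)" "rmom P p = tgt N n" "p = ract P p n"
      "ract Q q (d h) = lact Q n q"
      using cls_eq_iff[OF mem_pairs_ract[OF pq(2) dh] pq(2)] by blast
    have "ract Q q (d h) = q" using n(4) triv[OF pq(3) n(1-3)] Q.L.act_one[OF pq(4)] pq(5) by simp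
    then have "h = one J (rmom Q q)" using exQ h hq pq unfolding exchange_def right_free_def by blast
    then show "h = one J (rmom R z)" using pq rmom_cls by simp
  qed
  have "left_orbit H a R ` topspace (spc R) = right_orbit J d R ` topspace (spc R)"
    using orb by (intro image_cong) simp_all
  then show ?thesis using lf rf by (simp add: exchange_def)
qed

section \<open>Semi-exchangers and their morphisms\<close>

lemma semi_exchanger_iff:
  "semi_exchanger A B P \<longleftrightarrow> crossed_extension A \<and> crossed_extension B
     \<and> generalized_morphism (mid A) (mid B) P
     \<and> exchange (cmH (mod1 A)) (al1 A) (cmH (mod1 B)) (al1 B) P
     \<and> exchange (cmH (mod2 A)) (be1 A) (cmH (mod2 B)) (be1 B) P"
  unfolding semi_exchanger_def semi_exchanger_axioms_def exchange_def by blast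

lemma semi_exchanger_morphism_iff:
  "semi_exchanger_morphism A B P Q f \<longleftrightarrow> semi_exchanger A B P \<and> semi_exchanger A B Q
     \<and> equivariant_map (mid A) (mid B) P Q f"
proof -
  have "generalized_morphism (mid A) (mid B) P" if "semi_exchanger A B P" for P
    using that by (simp add: semi_exchanger_iff)
  then show ?thesis
    unfolding semi_exchanger_morphism_def semi_exchanger_morphism_axioms_def equivariant_map_def
      equivariant_map_axioms_def
    by blast
qed

lemma embedding_map_inj_on: "embedding_map X Y f \<Longrightarrow> inj_on f (topspace X)"
  unfolding embedding_map_def by (rule homeomorphic_imp_injective_map)

text \<open>
  The element \<open>m\<^sup>-\<^sup>1\<alpha>\<^sub>1(h) m\<close> is \<open>\<alpha>\<^sub>1(h\<^sup>g)\<close> with \<open>g = \<alpha>\<^sub>2(m)\<close>, and likewise for \<open>\<beta>\<^sub>1\<close>; this is the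
  normality required for exchanging the actions.
\<close>
lemma semi_exchanger_unit:
  assumes "crossed_extension A"
  shows "semi_exchanger A A (unit_gen_mor (mid A))"
proof -
  interpret crossed_extension A by fact
  have act1: "\<exists>k\<in>topspace (arr (cmH (mod1 A))). src (cmH (mod1 A)) k = src (mid A) m
      \<and> al1 A k = mul (mid A) (ginv (mid A) m) (mul (mid A) (al1 A h) m)"
    if m: "m \<in> topspace (arr (mid A))" and h: "h \<in> topspace (arr (cmH (mod1 A)))"
      "src (cmH (mod1 A)) h = tgt (mid A) m" for m h
  proof -
    let ?g = "al2 A m"
    have g: "?g \<in> topspace (arr (cmG (mod1 A)))" "tgt (cmG (mod1 A)) ?g = tgt (mid A) m"
      "src (cmG (mod1 A)) ?g = src (mid A) m"
      using m ex21.p.tgt_map ex21.p.src_map continuous_map_mem[OF ex21.p.cont] by simp_all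
    have h': "h \<in> topspace (fibre (cmH (mod1 A)) (tgt (mid A) m))" using h by (simp add: fibre_def)
    have "cmact (mod1 A) h ?g \<in> topspace (fibre (cmH (mod1 A)) (src (mid A) m))"
      using continuous_map_mem[OF homeomorphic_imp_continuous_map[OF cm1.ac.act_homeo[OF g(1)]]] g h' by simp
    then show ?thesis using al_act[OF m h'] by (auto simp: fibre_def)
  qed
  have act2: "\<exists>k\<in>topspace (arr (cmH (mod2 A))). src (cmH (mod2 A)) k = src (mid A) m
      \<and> be1 A k = mul (mid A) (ginv (mid A) m) (mul (mid A) (be1 A h) m)"
    if m: "m \<in> topspace (arr (mid A))" and h: "h \<in> topspace (arr (cmH (mod2 A)))"
      "src (cmH (mod2 A)) h = tgt (mid A) m" for m h
  proof -
    let ?g = "be2 A m"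
    have g: "?g \<in> topspace (arr (cmG (mod2 A)))" "tgt (cmG (mod2 A)) ?g = tgt (mid A) m"
      "src (cmG (mod2 A)) ?g = src (mid A) m"
      using m ex12.p.tgt_map ex12.p.src_map continuous_map_mem[OF ex12.p.cont] by simp_all
    have h': "h \<in> topspace (fibre (cmH (mod2 A)) (tgt (mid A) m))" using h by (simp add: fibre_def)
    have "cmact (mod2 A) h ?g \<in> topspace (fibre (cmH (mod2 A)) (src (mid A) m))"
      using continuous_map_mem[OF homeomorphic_imp_continuous_map[OF cm2.ac.act_homeo[OF g(1)]]] g h' by simp
    then show ?thesis using be_act[OF m h'] by (auto simp: fibre_def)
  qed
  have "exchange (cmH (mod1 A)) (al1 A) (cmH (mod1 A)) (al1 A) (unit_gen_mor (mid A))"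
    using exchange_unit[OF cm1.ac.H.group_bundle_axioms ex12.i.strict_morphism_axioms
        embedding_map_inj_on[OF ex12.embedding] act1] .
  moreover have "exchange (cmH (mod2 A)) (be1 A) (cmH (mod2 A)) (be1 A) (unit_gen_mor (mid A))"
    using exchange_unit[OF cm2.ac.H.group_bundle_axioms ex21.i.strict_morphism_axioms
        embedding_map_inj_on[OF ex21.embedding] act2] .
  ultimately show ?thesis
    using assms ex21.i.cod.generalized_morphism_unit by (simp add: semi_exchanger_iff)
qed

lemma (in crossed_extension) bundles:
  "group_bundle (cmH (mod1 A))" "strict_morphism (cmH (mod1 A)) (mid A) (al1 A)"
  "group_bundle (cmH (mod2 A))" "strict_morphism (cmH (mod2 A)) (mid A) (be1 A)"
  by (rule ex12.i.strict_morphism_axioms ex21.i.strict_morphism_axioms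
        cm1.ac.H.group_bundle_axioms cm2.ac.H.group_bundle_axioms)+

lemma semi_exchanger_comp:
  fixes A B C :: "'u::infinite crossed_ext"
  assumes "semi_exchanger A B P" "semi_exchanger B C Q"
  shows "semi_exchanger A C (comp_gen_mor (mid A) (mid B) (mid C) P Q)"
proof -
  interpret A: crossed_extension A using assms semi_exchanger_iff by blast
  interpret B: crossed_extension B using assms semi_exchanger_iff by blast
  interpret C: crossed_extension C using assms semi_exchanger_iff by blast
  interpret composable "mid A" "mid B" "mid C" P Q
    using assms by (intro composable.intro) (simp_all add: semi_exchanger_iff)
  have "exchange (cmH (mod1 A)) (al1 A) (cmH (mod1 C)) (al1 C) R"
    using assms exchange_comp[OF A.bundles(1,2) B.bundles(1,2) C.bundles(1,2)]
    by (simp add: semi_exchanger_iff)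
  moreover have "exchange (cmH (mod2 A)) (be1 A) (cmH (mod2 C)) (be1 C) R"
    using assms exchange_comp[OF A.bundles(3,4) B.bundles(3,4) C.bundles(3,4)]
    by (simp add: semi_exchanger_iff)
  ultimately show ?thesis
    using generalized_morphism_comp A.crossed_extension_axioms C.crossed_extension_axioms
    by (simp add: semi_exchanger_iff)
qed

section \<open>Labelled arrows\<close>

lemma XExt_arr1_iff:
  "P \<in> XExt_arr1 \<longleftrightarrow> semi_exchanger (sx_dom P) (sx_cod P) (sx_mor P)"
  by (simp add: XExt_arr1_def)

lemma generalized_morphism_sx:
  "P \<in> XExt_arr1 \<Longrightarrow> generalized_morphism (mid (sx_dom P)) (mid (sx_cod P)) (sx_mor P)"
  by (simp add: XExt_arr1_iff semi_exchanger_iff)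

lemma XExt_arr2_iff:
  "\<eta> \<in> XExt_arr2 \<longleftrightarrow> sxm_dom \<eta> \<in> XExt_arr1 \<and> sxm_cod \<eta> \<in> XExt_arr1
     \<and> sx_dom (sxm_dom \<eta>) = sx_dom (sxm_cod \<eta>) \<and> sx_cod (sxm_dom \<eta>) = sx_cod (sxm_cod \<eta>)
     \<and> equivariant_map (mid (sx_dom (sxm_dom \<eta>))) (mid (sx_cod (sxm_dom \<eta>)))
         (sx_mor (sxm_dom \<eta>)) (sx_mor (sxm_cod \<eta>)) (sxm_map \<eta>)"
  by (auto simp: XExt_arr2_def XExt_arr1_def semi_exchanger_morphism_iff)

lemma equivariant_map_sxm:
  "\<eta> \<in> XExt_arr2 \<Longrightarrow> equivariant_map (mid (sx_dom (sxm_dom \<eta>))) (mid (sx_cod (sxm_dom \<eta>)))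
     (sx_mor (sxm_dom \<eta>)) (sx_mor (sxm_cod \<eta>)) (sxm_map \<eta>)"
  using XExt_arr2_iff by blast

lemma XExt_arr2_ends:
  assumes "\<eta> \<in> XExt_arr2"
  shows "sxm_dom \<eta> \<in> XExt_arr1" "sxm_cod \<eta> \<in> XExt_arr1"
    "sx_dom (sxm_cod \<eta>) = sx_dom (sxm_dom \<eta>)" "sx_cod (sxm_cod \<eta>) = sx_cod (sxm_dom \<eta>)"
  using assms by (auto simp: XExt_arr2_iff)

lemma sxm_eqI:
  assumes "\<eta> \<in> XExt_arr2" "\<mu> \<in> XExt_arr2" "sxm_dom \<eta> = sxm_dom \<mu>" "sxm_cod \<eta> = sxm_cod \<mu>"
    and "\<And>p. p \<in> sx_pts (sxm_dom \<eta>) \<Longrightarrow> sxm_map \<eta> p = sxm_map \<mu> p"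
  shows "\<eta> = \<mu>"
proof -
  have "sxm_map \<eta> = sxm_map \<mu>"
  proof (rule extensionalityI)
    show "sxm_map \<eta> \<in> extensional (sx_pts (sxm_dom \<eta>))" "sxm_map \<mu> \<in> extensional (sx_pts (sxm_dom \<eta>))"
      using equivariant_map_sxm[THEN equivariant_map.ext] assms(1-3) by metis+
  qed (rule assms(5))
  then show ?thesis using assms(3,4) by simp
qed

lemma sxm_map_mem:
  "\<eta> \<in> XExt_arr2 \<Longrightarrow> p \<in> sx_pts (sxm_dom \<eta>) \<Longrightarrow> sxm_map \<eta> p \<in> sx_pts (sxm_cod \<eta>)"
  by (auto simp: XExt_arr2_iff dest: equivariant_map.mem)

lemma sxm_id_simps [simp]:
  "sxm_dom (sxm_id P) = P" "sxm_cod (sxm_id P) = P"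
  "p \<in> sx_pts P \<Longrightarrow> sxm_map (sxm_id P) p = p"
  by (simp_all add: sxm_id_def)

lemma sxm_id_arr2: "P \<in> XExt_arr1 \<Longrightarrow> sxm_id P \<in> XExt_arr2"
  using generalized_morphism.equivariant_map_id[OF generalized_morphism_sx]
  by (simp add: XExt_arr2_iff) (simp add: sxm_id_def)

lemma sxm_comp_simps [simp]:
  "sxm_dom (sxm_comp \<eta> \<mu>) = sxm_dom \<eta>" "sxm_cod (sxm_comp \<eta> \<mu>) = sxm_cod \<mu>"
  "p \<in> sx_pts (sxm_dom \<eta>) \<Longrightarrow> sxm_map (sxm_comp \<eta> \<mu>) p = sxm_map \<mu> (sxm_map \<eta> p)"
  by (simp_all add: sxm_comp_def)

lemma sxm_comp_arr2:
  assumes "\<eta> \<in> XExt_arr2" "\<mu> \<in> XExt_arr2" "sxm_cod \<eta> = sxm_dom \<mu>"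
  shows "sxm_comp \<eta> \<mu> \<in> XExt_arr2"
proof -
  have "equivariant_map (mid (sx_dom (sxm_dom \<eta>))) (mid (sx_cod (sxm_dom \<eta>)))
          (sx_mor (sxm_dom \<eta>)) (sx_mor (sxm_cod \<mu>)) (sxm_map (sxm_comp \<eta> \<mu>))"
    using equivariant_map_compose[OF equivariant_map_sxm[OF assms(1)]]
      equivariant_map_sxm[OF assms(2)] XExt_arr2_ends[OF assms(1)] assms(3)
    by (simp add: sxm_comp_def)
  then show ?thesis using assms by (simp add: XExt_arr2_iff)
qed

text \<open>
  Every 2-arrow is invertible, so that the associators and unitors are isomorphisms without further
  work.
\<close>
lemma sxm_invertible:
  assumes \<eta>: "\<eta> \<in> XExt_arr2"
  shows "\<exists>\<beta>\<in>XExt_arr2. sxm_dom \<beta> = sxm_cod \<eta> \<and> sxm_cod \<beta> = sxm_dom \<eta>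
           \<and> sxm_comp \<eta> \<beta> = sxm_id (sxm_dom \<eta>) \<and> sxm_comp \<beta> \<eta> = sxm_id (sxm_cod \<eta>)"
proof -
  interpret equivariant_map "mid (sx_dom (sxm_dom \<eta>))" "mid (sx_cod (sxm_dom \<eta>))"
    "sx_mor (sxm_dom \<eta>)" "sx_mor (sxm_cod \<eta>)" "sxm_map \<eta>"
    by (rule equivariant_map_sxm[OF \<eta>])
  obtain g where g: "equivariant_map (mid (sx_dom (sxm_dom \<eta>))) (mid (sx_cod (sxm_dom \<eta>)))
      (sx_mor (sxm_cod \<eta>)) (sx_mor (sxm_dom \<eta>)) g"
    "\<And>p. p \<in> sx_pts (sxm_dom \<eta>) \<Longrightarrow> g (sxm_map \<eta> p) = p"
    "\<And>q. q \<in> sx_pts (sxm_cod \<eta>) \<Longrightarrow> sxm_map \<eta> (g q) = q"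
    by (rule inverse) blast
  define \<beta> where "\<beta> = \<lparr>sxm_dom = sxm_cod \<eta>, sxm_cod = sxm_dom \<eta>, sxm_map = g\<rparr>"
  have \<beta>: "\<beta> \<in> XExt_arr2"
    unfolding XExt_arr2_iff \<beta>_def using XExt_arr2_ends[OF \<eta>] g(1) by simp
  have "sxm_comp \<eta> \<beta> = sxm_id (sxm_dom \<eta>)"
    using \<eta> \<beta> g(2) by (intro sxm_eqI sxm_comp_arr2 sxm_id_arr2) (simp_all add: \<beta>_def XExt_arr2_ends)
  moreover have "sxm_comp \<beta> \<eta> = sxm_id (sxm_cod \<eta>)"
    using \<eta> \<beta> g(3) by (intro sxm_eqI sxm_comp_arr2 sxm_id_arr2) (simp_all add: \<beta>_def XExt_arr2_ends)
  ultimately show ?thesis using \<beta> by (intro bexI[of _ \<beta>]) (simp_all add: \<beta>_def)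
qed

section \<open>Points of composites\<close>

lemma sx_unit_simps [simp]:
  "sx_dom (sx_unit A) = A" "sx_cod (sx_unit A) = A" "sx_mor (sx_unit A) = unit_gen_mor (mid A)"
  by (simp_all add: sx_unit_def)

lemma sx_unit_arr1: "crossed_extension A \<Longrightarrow> sx_unit A \<in> XExt_arr1"
  by (simp add: XExt_arr1_iff semi_exchanger_unit)

lemma sx_comp_simps [simp]:
  "sx_dom (sx_comp P Q) = sx_dom P" "sx_cod (sx_comp P Q) = sx_cod Q"
  by (simp_all add: sx_comp_def)

lemma composable_sx:
  fixes P Q :: "'u::infinite sx"
  assumes "P \<in> XExt_arr1" "Q \<in> XExt_arr1" "sx_cod P = sx_dom Q"
  shows "composable (mid (sx_dom P)) (mid (sx_cod P)) (mid (sx_cod Q)) (sx_mor P) (sx_mor Q)"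
  using assms generalized_morphism_sx by (metis composable.intro)

lemma sx_comp_arr1:
  fixes P Q :: "'u::infinite sx"
  assumes "P \<in> XExt_arr1" "Q \<in> XExt_arr1" "sx_cod P = sx_dom Q"
  shows "sx_comp P Q \<in> XExt_arr1"
  using assms by (simp add: XExt_arr1_iff sx_comp_def semi_exchanger_comp)

lemma mem_sx_pairs:
  "(p, q) \<in> sx_pairs P Q \<longleftrightarrow> p \<in> sx_pts P \<and> q \<in> sx_pts Q \<and> rmom (sx_mor P) p = lmom (sx_mor Q) q"
  by (simp add: sx_pairs_def pairs_def topspace_fibre_prod)

context
  fixes P Q :: "'u::infinite sx"
  assumes PQ: "P \<in> XExt_arr1" "Q \<in> XExt_arr1" "sx_cod P = sx_dom Q"
begin

interpretation composable "mid (sx_dom P)" "mid (sx_cod P)" "mid (sx_cod Q)" "sx_mor P" "sx_mor Q"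
  by (rule composable_sx[OF PQ])

lemma sx_cls_mem: "(p, q) \<in> sx_pairs P Q \<Longrightarrow> sx_cls P Q (p, q) \<in> sx_pts (sx_comp P Q)"
  using cls_in_comp by (simp add: sx_pairs_def sx_cls_def sx_comp_def)

lemma lmom_sx_cls:
  "(p, q) \<in> sx_pairs P Q \<Longrightarrow> lmom (sx_mor (sx_comp P Q)) (sx_cls P Q (p, q)) = lmom (sx_mor P) p"
  using lmom_cls by (simp add: sx_pairs_def sx_cls_def sx_comp_def)

lemma rmom_sx_cls:
  "(p, q) \<in> sx_pairs P Q \<Longrightarrow> rmom (sx_mor (sx_comp P Q)) (sx_cls P Q (p, q)) = rmom (sx_mor Q) q"
  using rmom_cls by (simp add: sx_pairs_def sx_cls_def sx_comp_def)

lemma sx_comp_cases: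
  assumes "z \<in> sx_pts (sx_comp P Q)"
  obtains p q where "z = sx_cls P Q (p, q)" "(p, q) \<in> sx_pairs P Q"
proof -
  have "z \<in> topspace (spc R)" using assms by (simp add: sx_comp_def)
  then show thesis using that unfolding sx_pairs_def sx_cls_def by (rule comp_cases)
qed

lemma sx_cls_balance:
  assumes "p \<in> sx_pts P" "n \<in> topspace (arr (mid (sx_cod P)))" "q \<in> sx_pts Q"
    "rmom (sx_mor P) p = tgt (mid (sx_cod P)) n" "src (mid (sx_cod P)) n = lmom (sx_mor Q) q"
  shows "sx_cls P Q (ract (sx_mor P) p n, q) = sx_cls P Q (p, lact (sx_mor Q) n q)"
  using cls_balance[OF assms] by (simp add: sx_cls_def)

end

context
  fixes P Q T :: "'u::infinite sx"
  assumes PQT: "P \<in> XExt_arr1" "Q \<in> XExt_arr1" "T \<in> XExt_arr1" "sx_cod P = sx_dom Q" "sx_cod Q = sx_dom T"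
begin

lemma sx_pairs_right:
  "(p, q) \<in> sx_pairs P Q \<Longrightarrow> (q, t) \<in> sx_pairs Q T \<Longrightarrow> (p, sx_cls Q T (q, t)) \<in> sx_pairs P (sx_comp Q T)"
  using PQT by (simp add: mem_sx_pairs[of p] sx_cls_mem lmom_sx_cls)

lemma sx_pairs_left:
  "(p, q) \<in> sx_pairs P Q \<Longrightarrow> (q, t) \<in> sx_pairs Q T \<Longrightarrow> (sx_cls P Q (p, q), t) \<in> sx_pairs (sx_comp P Q) T"
  using PQT by (simp add: mem_sx_pairs[of _ t] sx_cls_mem rmom_sx_cls)

lemma sx_pairs_right_cases:
  assumes "(p, w) \<in> sx_pairs P (sx_comp Q T)"
  obtains q t where "w = sx_cls Q T (q, t)" "(p, q) \<in> sx_pairs P Q" "(q, t) \<in> sx_pairs Q T"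
proof -
  have w: "p \<in> sx_pts P" "w \<in> sx_pts (sx_comp Q T)" "rmom (sx_mor P) p = lmom (sx_mor (sx_comp Q T)) w"
    using assms by (simp_all add: mem_sx_pairs)
  obtain q t where qt: "w = sx_cls Q T (q, t)" "(q, t) \<in> sx_pairs Q T"
    using sx_comp_cases[OF PQT(2,3,5) w(2)] .
  then have "(p, q) \<in> sx_pairs P Q" using w lmom_sx_cls[OF PQT(2,3,5) qt(2)] by (simp add: mem_sx_pairs)
  then show thesis using that qt by blast
qed

lemma sx_comp_cases3:
  assumes "z \<in> sx_pts (sx_comp P (sx_comp Q T))"
  obtains p q t where "z = sx_cls P (sx_comp Q T) (p, sx_cls Q T (q, t))"
    "(p, q) \<in> sx_pairs P Q" "(q, t) \<in> sx_pairs Q T"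
proof -
  have "sx_comp Q T \<in> XExt_arr1" using sx_comp_arr1 PQT by blast
  then obtain p w where "z = sx_cls P (sx_comp Q T) (p, w)" "(p, w) \<in> sx_pairs P (sx_comp Q T)"
    using sx_comp_cases[OF PQT(1) _ _ assms] PQT by auto
  then show thesis using that by (metis sx_pairs_right_cases)
qed

end

section \<open>The structure 2-arrows on points\<close>

lemma sxm_star_simps [simp]:
  "sxm_dom (sxm_star \<eta> \<mu>) = sx_comp (sxm_dom \<eta>) (sxm_dom \<mu>)"
  "sxm_cod (sxm_star \<eta> \<mu>) = sx_comp (sxm_cod \<eta>) (sxm_cod \<mu>)"
  by (simp_all add: sxm_star_def)

context
  fixes \<eta> \<mu> :: "'u::infinite sxm"
  assumes arrs: "\<eta> \<in> XExt_arr2" "\<mu> \<in> XExt_arr2" "sx_cod (sxm_dom \<eta>) = sx_dom (sxm_dom \<mu>)"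
begin

interpretation composable_maps "mid (sx_dom (sxm_dom \<eta>))" "mid (sx_cod (sxm_dom \<eta>))"
    "mid (sx_cod (sxm_dom \<mu>))" "sx_mor (sxm_dom \<eta>)" "sx_mor (sxm_cod \<eta>)"
    "sx_mor (sxm_dom \<mu>)" "sx_mor (sxm_cod \<mu>)" "sxm_map \<eta>" "sxm_map \<mu>"
  using equivariant_map_sxm[OF arrs(1)] equivariant_map_sxm[OF arrs(2)] arrs(3)
  by (intro composable_maps.intro) simp_all

lemma sxm_map_star: "sxm_map (sxm_star \<eta> \<mu>) = star"
  by (simp add: sxm_star_def star_def sx_pairs_def sx_cls_def XExt_arr2_ends[OF arrs(1)])

lemma sxm_star_cls:
  "(p, q) \<in> sx_pairs (sxm_dom \<eta>) (sxm_dom \<mu>) \<Longrightarrow>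
     sxm_map (sxm_star \<eta> \<mu>) (sx_cls (sxm_dom \<eta>) (sxm_dom \<mu>) (p, q))
       = sx_cls (sxm_cod \<eta>) (sxm_cod \<mu>) (sxm_map \<eta> p, sxm_map \<mu> q)"
  using star_cls arrs by (simp add: sxm_map_star sx_pairs_def sx_cls_def XExt_arr2_ends)

lemma sxm_star_pairs:
  "(p, q) \<in> sx_pairs (sxm_dom \<eta>) (sxm_dom \<mu>) \<Longrightarrow>
     (sxm_map \<eta> p, sxm_map \<mu> q) \<in> sx_pairs (sxm_cod \<eta>) (sxm_cod \<mu>)"
  using mem_pairs by (simp add: sx_pairs_def)

lemma sxm_star_arr2: "sxm_star \<eta> \<mu> \<in> XExt_arr2"
  unfolding XExt_arr2_iff sxm_star_simps sxm_map_star
  using equivariant_map_star arrs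
  by (simp add: sx_comp_arr1 XExt_arr2_ends) (simp add: sx_comp_def XExt_arr2_ends)

end

lemma sx_assoc_simps [simp]:
  "sxm_dom (sx_assoc P Q T) = sx_comp P (sx_comp Q T)"
  "sxm_cod (sx_assoc P Q T) = sx_comp (sx_comp P Q) T"
  by (simp_all add: sx_assoc_def)

context
  fixes P Q T :: "'u::infinite sx"
  assumes PQT: "P \<in> XExt_arr1" "Q \<in> XExt_arr1" "T \<in> XExt_arr1" "sx_cod P = sx_dom Q" "sx_cod Q = sx_dom T"
begin

interpretation composable3 "mid (sx_dom P)" "mid (sx_cod P)" "mid (sx_cod Q)" "mid (sx_cod T)"
    "sx_mor P" "sx_mor Q" "sx_mor T"
  using composable_sx[OF PQT(1,2,4)] composable_sx[OF PQT(2,3,5)] PQT(4)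
  by (intro composable3.intro) simp_all

lemma sxm_map_assoc: "sxm_map (sx_assoc P Q T) = asc"
  by (simp add: PQT(4)[symmetric] sx_assoc_def asc_def triples_def sx_pairs_def sx_cls_def sx_comp_def)

lemma sx_assoc_cls:
  "(p, q) \<in> sx_pairs P Q \<Longrightarrow> (q, t) \<in> sx_pairs Q T \<Longrightarrow>
     sxm_map (sx_assoc P Q T) (sx_cls P (sx_comp Q T) (p, sx_cls Q T (q, t)))
       = sx_cls (sx_comp P Q) T (sx_cls P Q (p, q), t)"
  using asc_cls PQT by (simp add: sxm_map_assoc sx_pairs_def sx_cls_def sx_comp_def)

lemma sx_assoc_arr2: "sx_assoc P Q T \<in> XExt_arr2"
  unfolding XExt_arr2_iff sx_assoc_simps sxm_map_assoc
  using equivariant_map_asc PQT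
  by (simp add: sx_comp_arr1) (simp add: sx_comp_def)

end

lemma sx_lunit_simps [simp]:
  "sxm_dom (sx_lunit P) = sx_comp (sx_unit (sx_dom P)) P" "sxm_cod (sx_lunit P) = P"
  by (simp_all add: sx_lunit_def Let_def)

lemma sx_runit_simps [simp]:
  "sxm_dom (sx_runit P) = sx_comp P (sx_unit (sx_cod P))" "sxm_cod (sx_runit P) = P"
  by (simp_all add: sx_runit_def Let_def)

lemma crossed_extension_ends:
  "P \<in> XExt_arr1 \<Longrightarrow> crossed_extension (sx_dom P)" "P \<in> XExt_arr1 \<Longrightarrow> crossed_extension (sx_cod P)"
  by (simp_all add: XExt_arr1_iff semi_exchanger_iff)

context
  fixes P :: "'u::infinite sx"
  assumes P: "P \<in> XExt_arr1"
begin

interpretation infinite_generalized_morphism "mid (sx_dom P)" "mid (sx_cod P)" "sx_mor P"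
  by (intro infinite_generalized_morphism.intro generalized_morphism_sx P)

lemma sxm_map_lunit: "sxm_map (sx_lunit P) = lun"
  by (simp add: sx_lunit_def Let_def lun_def sx_pairs_def sx_cls_def)

lemma sxm_map_runit: "sxm_map (sx_runit P) = run"
  by (simp add: sx_runit_def Let_def run_def sx_pairs_def sx_cls_def)

lemma sx_lunit_cls:
  "(m, p) \<in> sx_pairs (sx_unit (sx_dom P)) P \<Longrightarrow>
     sxm_map (sx_lunit P) (sx_cls (sx_unit (sx_dom P)) P (m, p)) = lact (sx_mor P) m p"
  using lun_cls by (simp add: sxm_map_lunit sx_pairs_def sx_cls_def)

lemma sx_runit_cls:
  "(p, n) \<in> sx_pairs P (sx_unit (sx_cod P)) \<Longrightarrow>
     sxm_map (sx_runit P) (sx_cls P (sx_unit (sx_cod P)) (p, n)) = ract (sx_mor P) p n"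
  using run_cls by (simp add: sxm_map_runit sx_pairs_def sx_cls_def)

lemma sx_lunit_arr2: "sx_lunit P \<in> XExt_arr2"
  unfolding XExt_arr2_iff sx_lunit_simps sxm_map_lunit
  using equivariant_map_lun P
  by (simp add: sx_comp_arr1 sx_unit_arr1 crossed_extension_ends) (simp add: sx_comp_def)

lemma sx_runit_arr2: "sx_runit P \<in> XExt_arr2"
  unfolding XExt_arr2_iff sx_runit_simps sxm_map_runit
  using equivariant_map_run P
  by (simp add: sx_comp_arr1 sx_unit_arr1 crossed_extension_ends) (simp add: sx_comp_def)

end

section \<open>Coherence\<close>

lemmas arr_types = XExt_arr2_ends sxm_id_arr2 sxm_comp_arr2 sxm_star_arr2 sx_comp_arr1
  sx_assoc_arr2 sx_lunit_arr2 sx_runit_arr2 sx_unit_arr1 crossed_extension_ends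

lemma sxm_star_id:
  fixes P Q :: "'u::infinite sx"
  assumes PQ: "P \<in> XExt_arr1" "Q \<in> XExt_arr1" "sx_cod P = sx_dom Q"
  shows "sxm_star (sxm_id P) (sxm_id Q) = sxm_id (sx_comp P Q)"
proof (rule sxm_eqI)
  fix z assume "z \<in> sx_pts (sxm_dom (sxm_star (sxm_id P) (sxm_id Q)))"
  then have "z \<in> sx_pts (sx_comp P Q)" by simp
  then obtain p q where z: "z = sx_cls P Q (p, q)" "(p, q) \<in> sx_pairs P Q"
    using sx_comp_cases[OF PQ] by blast
  then have "p \<in> sx_pts P" "q \<in> sx_pts Q" by (simp_all add: mem_sx_pairs)
  then show "sxm_map (sxm_star (sxm_id P) (sxm_id Q)) z = sxm_map (sxm_id (sx_comp P Q)) z"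
    using z PQ sxm_star_cls[of "sxm_id P" "sxm_id Q" p q] sx_cls_mem[OF PQ] by (simp add: arr_types)
qed (use PQ in \<open>simp_all add: arr_types\<close>)

lemma sxm_interchange:
  fixes \<eta> \<eta>' \<mu> \<mu>' :: "'u::infinite sxm"
  assumes arrs: "\<eta> \<in> XExt_arr2" "\<eta>' \<in> XExt_arr2" "\<mu> \<in> XExt_arr2" "\<mu>' \<in> XExt_arr2"
    and comp: "sxm_cod \<eta> = sxm_dom \<eta>'" "sxm_cod \<mu> = sxm_dom \<mu>'"
    and ends: "sx_cod (sxm_dom \<eta>) = sx_dom (sxm_dom \<mu>)"
  shows "sxm_star (sxm_comp \<eta> \<eta>') (sxm_comp \<mu> \<mu>') = sxm_comp (sxm_star \<eta> \<mu>) (sxm_star \<eta>' \<mu>')"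
    (is "?l = ?r")
proof -
  have ends': "sx_cod (sxm_dom \<eta>') = sx_dom (sxm_dom \<mu>')"
    using ends comp arrs XExt_arr2_ends by metis
  show ?thesis
  proof (rule sxm_eqI)
    show "?l \<in> XExt_arr2" using arrs comp ends by (simp add: arr_types)
    show "?r \<in> XExt_arr2" using arrs comp ends ends' by (simp add: arr_types)
    fix z assume "z \<in> sx_pts (sxm_dom ?l)"
    then have "z \<in> sx_pts (sx_comp (sxm_dom \<eta>) (sxm_dom \<mu>))" by simp
    then obtain p q where z: "z = sx_cls (sxm_dom \<eta>) (sxm_dom \<mu>) (p, q)"
      and pq: "(p, q) \<in> sx_pairs (sxm_dom \<eta>) (sxm_dom \<mu>)"
      using sx_comp_cases arrs ends XExt_arr2_ends(1) by metis
    have p: "p \<in> sx_pts (sxm_dom \<eta>)" "q \<in> sx_pts (sxm_dom \<mu>)" using pq by (simp_all add: mem_sx_pairs)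
    have "sxm_map ?l z = sx_cls (sxm_cod \<eta>') (sxm_cod \<mu>')
        (sxm_map \<eta>' (sxm_map \<eta> p), sxm_map \<mu>' (sxm_map \<mu> q))"
      using sxm_star_cls[of "sxm_comp \<eta> \<eta>'" "sxm_comp \<mu> \<mu>'" p q] arrs comp ends p pq z
      by (simp add: arr_types)
    also have "\<dots> = sxm_map (sxm_star \<eta>' \<mu>') (sxm_map (sxm_star \<eta> \<mu>) z)"
      using sxm_star_cls[OF arrs(1,3) ends pq] sxm_star_pairs[OF arrs(1,3) ends pq]
        sxm_star_cls[OF arrs(2,4) ends'] comp z by simp
    also have "\<dots> = sxm_map ?r z"
      using z sx_cls_mem[OF _ _ _ pq] arrs ends by (simp add: arr_types)
    finally show "sxm_map ?l z = sxm_map ?r z" .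
  qed (use comp in simp_all)
qed

text \<open>
  Both sides send \<open>[p, [q, t]]\<close> to \<open>[[\<eta> p, \<mu> q], \<nu> t]\<close>.
\<close>
lemma sx_assoc_natural:
  fixes \<eta> \<mu> \<nu> :: "'u::infinite sxm"
  assumes arrs: "\<eta> \<in> XExt_arr2" "\<mu> \<in> XExt_arr2" "\<nu> \<in> XExt_arr2"
    and ends: "sx_cod (sxm_dom \<eta>) = sx_dom (sxm_dom \<mu>)" "sx_cod (sxm_dom \<mu>) = sx_dom (sxm_dom \<nu>)"
  shows "sxm_comp (sxm_star \<eta> (sxm_star \<mu> \<nu>)) (sx_assoc (sxm_cod \<eta>) (sxm_cod \<mu>) (sxm_cod \<nu>))
       = sxm_comp (sx_assoc (sxm_dom \<eta>) (sxm_dom \<mu>) (sxm_dom \<nu>)) (sxm_star (sxm_star \<eta> \<mu>) \<nu>)"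
    (is "?l = ?r")
proof (rule sxm_eqI)
  let ?P = "sxm_dom \<eta>" and ?Q = "sxm_dom \<mu>" and ?T = "sxm_dom \<nu>"
  let ?P' = "sxm_cod \<eta>" and ?Q' = "sxm_cod \<mu>" and ?T' = "sxm_cod \<nu>"
  have P: "?P \<in> XExt_arr1" "?Q \<in> XExt_arr1" "?T \<in> XExt_arr1"
    and P': "?P' \<in> XExt_arr1" "?Q' \<in> XExt_arr1" "?T' \<in> XExt_arr1"
    "sx_cod ?P' = sx_dom ?Q'" "sx_cod ?Q' = sx_dom ?T'"
    using arrs ends by (simp_all add: arr_types)
  show l: "?l \<in> XExt_arr2" using arrs ends P' by (simp add: arr_types)
  show r: "?r \<in> XExt_arr2" using arrs ends by (simp add: arr_types)
  fix z assume "z \<in> sx_pts (sxm_dom ?l)"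
  then have z0: "z \<in> sx_pts (sx_comp ?P (sx_comp ?Q ?T))" by simp
  obtain p q t where z: "z = sx_cls ?P (sx_comp ?Q ?T) (p, sx_cls ?Q ?T (q, t))"
    and pq: "(p, q) \<in> sx_pairs ?P ?Q" and qt: "(q, t) \<in> sx_pairs ?Q ?T"
    using sx_comp_cases3[OF P ends z0] .
  note pq' = sxm_star_pairs[OF arrs(1,2) ends(1) pq] and qt' = sxm_star_pairs[OF arrs(2,3) ends(2) qt]
  let ?p = "sxm_map \<eta> p" and ?q = "sxm_map \<mu> q" and ?t = "sxm_map \<nu> t"
  have "sxm_map ?l z = sxm_map (sx_assoc ?P' ?Q' ?T') (sxm_map (sxm_star \<eta> (sxm_star \<mu> \<nu>)) z)"
    using z0 by simp
  also have "\<dots> = sxm_map (sx_assoc ?P' ?Q' ?T') (sx_cls ?P' (sx_comp ?Q' ?T') (?p, sx_cls ?Q' ?T' (?q, ?t)))"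
    using sxm_star_cls[of \<eta> "sxm_star \<mu> \<nu>" p "sx_cls ?Q ?T (q, t)"] arrs ends z
      sx_pairs_right[OF P ends pq qt] sxm_star_cls[OF arrs(2,3) ends(2) qt] by (simp add: arr_types)
  also have "\<dots> = sx_cls (sx_comp ?P' ?Q') ?T' (sx_cls ?P' ?Q' (?p, ?q), ?t)"
    by (rule sx_assoc_cls[OF P' pq' qt'])
  also have "\<dots> = sxm_map (sxm_star (sxm_star \<eta> \<mu>) \<nu>) (sx_cls (sx_comp ?P ?Q) ?T (sx_cls ?P ?Q (p, q), t))"
    using sxm_star_cls[of "sxm_star \<eta> \<mu>" \<nu> "sx_cls ?P ?Q (p, q)" t] arrs ends
      sx_pairs_left[OF P ends pq qt] sxm_star_cls[OF arrs(1,2) ends(1) pq] by (simp add: arr_types)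
  also have "\<dots> = sxm_map ?r z" using sx_assoc_cls[OF P ends pq qt] z z0 by simp
  finally show "sxm_map ?l z = sxm_map ?r z" .
qed simp_all

text \<open>
  On a point \<open>[m, p]\<close> this is the equation \<open>m \<eta>(p) = \<eta>(m p)\<close>.
\<close>
lemma sx_lunit_natural:
  fixes \<eta> :: "'u::infinite sxm"
  assumes \<eta>: "\<eta> \<in> XExt_arr2"
  shows "sxm_comp (sxm_star (sxm_id (sx_unit (sx_dom (sxm_dom \<eta>)))) \<eta>) (sx_lunit (sxm_cod \<eta>))
       = sxm_comp (sx_lunit (sxm_dom \<eta>)) \<eta>" (is "?l = ?r")
proof (rule sxm_eqI)
  let ?P = "sxm_dom \<eta>" and ?Q = "sxm_cod \<eta>"
  let ?I = "sx_unit (sx_dom ?P)"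
  interpret equivariant_map "mid (sx_dom ?P)" "mid (sx_cod ?P)" "sx_mor ?P" "sx_mor ?Q" "sxm_map \<eta>"
    by (rule equivariant_map_sxm[OF \<eta>])
  have P: "?P \<in> XExt_arr1" "?Q \<in> XExt_arr1" "sx_dom ?Q = sx_dom ?P" and I: "?I \<in> XExt_arr1"
    using \<eta> by (simp_all add: arr_types)
  show "?l \<in> XExt_arr2" "?r \<in> XExt_arr2" using \<eta> I by (simp_all add: arr_types)
  fix z assume "z \<in> sx_pts (sxm_dom ?l)"
  then have z0: "z \<in> sx_pts (sx_comp ?I ?P)" by simp
  obtain m p where z: "z = sx_cls ?I ?P (m, p)" and mp: "(m, p) \<in> sx_pairs ?I ?P"
    using sx_comp_cases[OF I P(1) _ z0] by auto
  have m: "m \<in> topspace (arr (mid (sx_dom ?P)))" "p \<in> sx_pts ?P" "src (mid (sx_dom ?P)) m = lmom (sx_mor ?P) p"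
    using mp by (simp_all add: mem_sx_pairs)
  have mp': "(m, sxm_map \<eta> p) \<in> sx_pairs (sx_unit (sx_dom ?Q)) ?Q"
    using m P mem lmom_map by (simp add: mem_sx_pairs)
  have "sxm_map ?l z = sxm_map (sx_lunit ?Q) (sxm_map (sxm_star (sxm_id ?I) \<eta>) z)" using z0 by simp
  also have "\<dots> = sxm_map (sx_lunit ?Q) (sx_cls (sx_unit (sx_dom ?Q)) ?Q (m, sxm_map \<eta> p))"
    using sxm_star_cls[of "sxm_id ?I" \<eta> m p] I \<eta> mp z m P by (simp add: arr_types)
  also have "\<dots> = lact (sx_mor ?Q) m (sxm_map \<eta> p)" by (rule sx_lunit_cls[OF P(2) mp'])
  also have "\<dots> = sxm_map ?r z" using lact_map m sx_lunit_cls[OF P(1) mp] z z0 by simp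
  finally show "sxm_map ?l z = sxm_map ?r z" .
qed simp_all

text \<open>
  On a point \<open>[p, n]\<close> this is the equation \<open>\<eta>(p) n = \<eta>(p n)\<close>.
\<close>
lemma sx_runit_natural:
  fixes \<eta> :: "'u::infinite sxm"
  assumes \<eta>: "\<eta> \<in> XExt_arr2"
  shows "sxm_comp (sxm_star \<eta> (sxm_id (sx_unit (sx_cod (sxm_dom \<eta>))))) (sx_runit (sxm_cod \<eta>))
       = sxm_comp (sx_runit (sxm_dom \<eta>)) \<eta>" (is "?l = ?r")
proof (rule sxm_eqI)
  let ?P = "sxm_dom \<eta>" and ?Q = "sxm_cod \<eta>"
  let ?I = "sx_unit (sx_cod ?P)"
  interpret equivariant_map "mid (sx_dom ?P)" "mid (sx_cod ?P)" "sx_mor ?P" "sx_mor ?Q" "sxm_map \<eta>"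
    by (rule equivariant_map_sxm[OF \<eta>])
  have P: "?P \<in> XExt_arr1" "?Q \<in> XExt_arr1" "sx_cod ?Q = sx_cod ?P" and I: "?I \<in> XExt_arr1"
    using \<eta> by (simp_all add: arr_types)
  show "?l \<in> XExt_arr2" "?r \<in> XExt_arr2" using \<eta> I by (simp_all add: arr_types)
  fix z assume "z \<in> sx_pts (sxm_dom ?l)"
  then have z0: "z \<in> sx_pts (sx_comp ?P ?I)" by simp
  obtain p n where z: "z = sx_cls ?P ?I (p, n)" and pn: "(p, n) \<in> sx_pairs ?P ?I"
    using sx_comp_cases[OF P(1) I _ z0] by auto
  have n: "n \<in> topspace (arr (mid (sx_cod ?P)))" "p \<in> sx_pts ?P" "rmom (sx_mor ?P) p = tgt (mid (sx_cod ?P)) n"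
    using pn by (simp_all add: mem_sx_pairs)
  have pn': "(sxm_map \<eta> p, n) \<in> sx_pairs ?Q (sx_unit (sx_cod ?Q))"
    using n P mem rmom_map by (simp add: mem_sx_pairs)
  have "sxm_map ?l z = sxm_map (sx_runit ?Q) (sxm_map (sxm_star \<eta> (sxm_id ?I)) z)" using z0 by simp
  also have "\<dots> = sxm_map (sx_runit ?Q) (sx_cls ?Q (sx_unit (sx_cod ?Q)) (sxm_map \<eta> p, n))"
    using sxm_star_cls[of \<eta> "sxm_id ?I" p n] I \<eta> pn z n P by (simp add: arr_types)
  also have "\<dots> = ract (sx_mor ?Q) (sxm_map \<eta> p) n" by (rule sx_runit_cls[OF P(2) pn'])
  also have "\<dots> = sxm_map ?r z" using ract_map n sx_runit_cls[OF P(1) pn] z z0 by simp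
  finally show "sxm_map ?l z = sxm_map ?r z" .
qed simp_all

text \<open>
  Both sides send \<open>[p, [q, [t, v]]]\<close> to \<open>[[[p, q], t], v]\<close>.
\<close>
lemma sx_pentagon:
  fixes P Q T V :: "'u::infinite sx"
  assumes P: "P \<in> XExt_arr1" and Q: "Q \<in> XExt_arr1" and T: "T \<in> XExt_arr1" and V: "V \<in> XExt_arr1"
    and PQ: "sx_cod P = sx_dom Q" and QT: "sx_cod Q = sx_dom T" and TV: "sx_cod T = sx_dom V"
  shows "sxm_comp (sx_assoc P Q (sx_comp T V)) (sx_assoc (sx_comp P Q) T V)
       = sxm_comp (sxm_comp (sxm_star (sxm_id P) (sx_assoc Q T V)) (sx_assoc P (sx_comp Q T) V))
           (sxm_star (sx_assoc P Q T) (sxm_id V))" (is "?l = ?r")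
proof (rule sxm_eqI)
  note arr = P Q T V PQ QT TV
  have arr': "sx_comp P Q \<in> XExt_arr1" "sx_comp Q T \<in> XExt_arr1" "sx_comp T V \<in> XExt_arr1"
    using arr by (simp_all add: arr_types)
  show "?l \<in> XExt_arr2" "?r \<in> XExt_arr2" using arr by (simp_all add: arr_types)
  fix z assume "z \<in> sx_pts (sxm_dom ?l)"
  then have z0: "z \<in> sx_pts (sx_comp P (sx_comp Q (sx_comp T V)))" by simp
  obtain p q w where z: "z = sx_cls P (sx_comp Q (sx_comp T V)) (p, sx_cls Q (sx_comp T V) (q, w))"
    and pq: "(p, q) \<in> sx_pairs P Q" and qw: "(q, w) \<in> sx_pairs Q (sx_comp T V)"
    using sx_comp_cases3[OF P Q arr'(3) PQ _ z0] QT by auto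
  obtain t v where w: "w = sx_cls T V (t, v)"
    and qt: "(q, t) \<in> sx_pairs Q T" and tv: "(t, v) \<in> sx_pairs T V"
    using sx_pairs_right_cases[OF Q T V QT TV qw] .
  let ?pq = "sx_cls P Q (p, q)" and ?qt = "sx_cls Q T (q, t)"
  have pq_t: "(?pq, t) \<in> sx_pairs (sx_comp P Q) T" by (rule sx_pairs_left[OF P Q T PQ QT pq qt])
  have p_qt: "(p, ?qt) \<in> sx_pairs P (sx_comp Q T)" by (rule sx_pairs_right[OF P Q T PQ QT pq qt])
  have qt_v: "(?qt, v) \<in> sx_pairs (sx_comp Q T) V" by (rule sx_pairs_left[OF Q T V QT TV qt tv])
  have pv: "p \<in> sx_pts P" "v \<in> sx_pts V" using pq tv by (simp_all add: mem_sx_pairs)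
  let ?top = "sx_cls (sx_comp (sx_comp P Q) T) V (sx_cls (sx_comp P Q) T (?pq, t), v)"
  have l1: "sxm_map (sx_assoc P Q (sx_comp T V)) z = sx_cls (sx_comp P Q) (sx_comp T V) (?pq, w)"
    using sx_assoc_cls[OF P Q arr'(3) PQ _ pq qw] QT z by simp
  have l2: "sxm_map (sx_assoc (sx_comp P Q) T V) (sx_cls (sx_comp P Q) (sx_comp T V) (?pq, w)) = ?top"
    using sx_assoc_cls[OF arr'(1) T V _ TV pq_t tv] QT w by simp
  have l: "sxm_map ?l z = ?top" using l1 l2 z0 by simp
  have p_qw: "(p, sx_cls Q (sx_comp T V) (q, w)) \<in> sx_pairs P (sx_comp Q (sx_comp T V))"
    using sx_pairs_right[OF P Q arr'(3) PQ _ pq qw] QT by simp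
  have r1: "sxm_map (sxm_star (sxm_id P) (sx_assoc Q T V)) z
      = sx_cls P (sx_comp (sx_comp Q T) V) (p, sx_cls (sx_comp Q T) V (?qt, v))"
    using sxm_star_cls[of "sxm_id P" "sx_assoc Q T V" p "sx_cls Q (sx_comp T V) (q, w)"] p_qw
      sx_assoc_cls[OF Q T V QT TV qt tv] w z pv arr by (simp add: arr_types)
  have r2: "sxm_map (sx_assoc P (sx_comp Q T) V)
        (sx_cls P (sx_comp (sx_comp Q T) V) (p, sx_cls (sx_comp Q T) V (?qt, v)))
      = sx_cls (sx_comp P (sx_comp Q T)) V (sx_cls P (sx_comp Q T) (p, ?qt), v)"
    using sx_assoc_cls[OF P arr'(2) V _ _ p_qt qt_v] PQ TV by simp
  have "(sx_cls P (sx_comp Q T) (p, ?qt), v) \<in> sx_pairs (sx_comp P (sx_comp Q T)) V"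
    using sx_pairs_left[OF P arr'(2) V _ _ p_qt qt_v] PQ TV by simp
  then have r3: "sxm_map (sxm_star (sx_assoc P Q T) (sxm_id V))
        (sx_cls (sx_comp P (sx_comp Q T)) V (sx_cls P (sx_comp Q T) (p, ?qt), v)) = ?top"
    using sxm_star_cls[of "sx_assoc P Q T" "sxm_id V" "sx_cls P (sx_comp Q T) (p, ?qt)" v]
      sx_assoc_cls[OF P Q T PQ QT pq qt] pv arr by (simp add: arr_types)
  have "sxm_map ?r z = ?top" using r1 r2 r3 z0 by simp
  then show "sxm_map ?l z = sxm_map ?r z" using l by simp
qed simp_all

text \<open>
  The two sides send \<open>[p, [n, q]]\<close> to \<open>[p n, q]\<close> and to \<open>[p, n q]\<close>; these classes agree because
  they are identified in the definition of the composite.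
\<close>
lemma sx_triangle:
  fixes P Q :: "'u::infinite sx"
  assumes PQ: "P \<in> XExt_arr1" "Q \<in> XExt_arr1" "sx_cod P = sx_dom Q"
  shows "sxm_comp (sx_assoc P (sx_unit (sx_cod P)) Q) (sxm_star (sx_runit P) (sxm_id Q))
       = sxm_star (sxm_id P) (sx_lunit Q)" (is "?l = ?r")
proof (rule sxm_eqI)
  let ?I = "sx_unit (sx_cod P)"
  have I: "?I \<in> XExt_arr1" "sx_cod P = sx_dom ?I" "sx_cod ?I = sx_dom Q" using PQ by (simp_all add: arr_types)
  show "?l \<in> XExt_arr2" "?r \<in> XExt_arr2" using PQ I by (simp_all add: arr_types)
  fix z assume "z \<in> sx_pts (sxm_dom ?l)"
  then have z0: "z \<in> sx_pts (sx_comp P (sx_comp ?I Q))" by simp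
  obtain p n q where z: "z = sx_cls P (sx_comp ?I Q) (p, sx_cls ?I Q (n, q))"
    and pn: "(p, n) \<in> sx_pairs P ?I" and nq: "(n, q) \<in> sx_pairs ?I Q"
    using sx_comp_cases3[OF PQ(1) I(1) PQ(2) I(2,3) z0] .
  have n: "p \<in> sx_pts P" "n \<in> topspace (arr (mid (sx_cod P)))" "q \<in> sx_pts Q"
    "rmom (sx_mor P) p = tgt (mid (sx_cod P)) n" "src (mid (sx_cod P)) n = lmom (sx_mor Q) q"
    using pn nq by (simp_all add: mem_sx_pairs)
  have pn_q: "(sx_cls P ?I (p, n), q) \<in> sx_pairs (sx_comp P ?I) Q"
    by (rule sx_pairs_left[OF PQ(1) I(1) PQ(2) I(2,3) pn nq])
  have p_nq: "(p, sx_cls ?I Q (n, q)) \<in> sx_pairs P (sx_comp ?I Q)"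
    by (rule sx_pairs_right[OF PQ(1) I(1) PQ(2) I(2,3) pn nq])
  have "sxm_map ?l z = sxm_map (sxm_star (sx_runit P) (sxm_id Q))
      (sx_cls (sx_comp P ?I) Q (sx_cls P ?I (p, n), q))"
    using sx_assoc_cls[OF PQ(1) I(1) PQ(2) I(2,3) pn nq] z z0 by simp
  also have "\<dots> = sx_cls P Q (ract (sx_mor P) p n, q)"
    using sxm_star_cls[of "sx_runit P" "sxm_id Q" "sx_cls P ?I (p, n)" q] sx_runit_cls[OF PQ(1) pn] pn_q n PQ
    by (simp add: arr_types)
  also have "\<dots> = sx_cls P Q (p, lact (sx_mor Q) n q)"
    by (rule sx_cls_balance[OF PQ n])
  also have "\<dots> = sxm_map ?r z"
    using sxm_star_cls[of "sxm_id P" "sx_lunit Q" p "sx_cls ?I Q (n, q)"] sx_lunit_cls[OF PQ(2), of n q]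
      p_nq nq n PQ z by (simp add: arr_types)
  finally show "sxm_map ?l z = sxm_map ?r z" .
qed (use PQ in simp_all)

theorem theorem5p18:
  shows "bicategory (XExt_obj :: 'u::infinite crossed_ext set)
           XExt_arr1 sx_dom sx_cod
           XExt_arr2 sxm_dom sxm_cod
           sxm_id sxm_comp
           sx_unit sx_comp sxm_star
           sx_assoc sx_lunit sx_runit"
proof (unfold_locales, goal_cases)
  \<comment> \<open>The numbered goals are the category laws for vertical composition, functoriality of the
      horizontal composition, and invertibility, naturality and coherence of the structure
      2-arrows; the remaining ones are typing conditions.\<close>
  case (9 \<eta> \<mu> \<nu>)
  then show ?case using sxm_map_mem[of \<eta>] by (intro sxm_eqI) (simp_all add: arr_types)
next
  case (10 \<eta>)
  then show ?case by (intro sxm_eqI) (simp_all add: arr_types)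
next
  case (11 \<eta>)
  then show ?case by (intro sxm_eqI) (simp_all add: arr_types sxm_map_mem)
next
  case (15 P Q) then show ?case by (rule sxm_star_id)
next
  case (16 \<eta> \<eta>' \<mu> \<mu>') then show ?case by (rule sxm_interchange)
next
  case (18 P Q T) then show ?case using sxm_invertible[of "sx_assoc P Q T"] by (simp add: arr_types)
next
  case (19 \<eta> \<mu> \<nu>) then show ?case by (rule sx_assoc_natural)
next
  case (21 P) then show ?case using sxm_invertible[of "sx_lunit P"] by (simp add: arr_types)
next
  case (22 \<eta>) then show ?case by (rule sx_lunit_natural)
next
  case (24 P) then show ?case using sxm_invertible[of "sx_runit P"] by (simp add: arr_types)
next
  case (25 \<eta>) then show ?case by (rule sx_runit_natural)
next
  case (26 P Q T V) then show ?case by (rule sx_pentagon)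
next
  case (27 P Q) then show ?case by (rule sx_triangle)
qed (simp_all add: arr_types XExt_obj_def)

end
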